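(* Fix integers $n \geq 2$ and $d \geq 2$, let $G$ be either of the complex reflection groups $G(d,1,n)$ or $G(d,d,n)$, and let $c$ be a Coxeter element of $G$. Let $T$ be the set of reflections of $G$. Then two reflection factorizations $(t_1,\ldots,t_m)\in T^m$ and $(t'_1,\ldots,t'_{m'})\in T^{m'}$ of $c$ (i.e. $t_1\cdots t_m = c = t'_1\cdots t'_{m'}$) lie in the same orbit of the Hurwitz action if and only if the multiset of $G$-conjugacy classes of $t_1,\ldots,t_m$ equals the multiset of $G$-conjugacy classes of $t'_1,\ldots,t'_{m'}$.
   Context: For positive integers $d,e,n$, $G(de,e,n)$ is the group of $n\times n$ monomial complex matrices whose nonzero entries are $(de)$-th roots of unity and whose nonzero entries have product a $d$-th root of unity; it acts on $\mathbb{C}^n$. Thus $G(d,1,n)$ consists of all monomial matrices with $d$-th roots of unity as nonzero entries, and $G(d,d,n)$ is the subgroup of those whose nonzero entries have product $1$. A reflection is a linear map $t:\mathbb{C}^n\to\mathbb{C}^n$ whose fixed space $\ker(t-1)$ is a hyperplane; $G$ is generated by its set $T$ of reflections. Let $A$ be the set of fixed hyperplanes of the reflections in $G$. An element $g\in G$ is regular if it has an eigenvector lying on no hyperplane in $A$. A Coxeter element of $G$ is a regular element of multiplicative order $h = (|T|+|A|)/n$. (For example $[(1\,2\,\cdots\,n);(0,\ldots,0,1)]$ in $G(d,1,n)$, the matrix with $\exp(2\pi i/d)$ in position $(1,n)$ and $1$'s in positions $(k+1,k)$, is a Coxeter element.) The Hurwitz action: for $m\ge 1$, the braid group $\mathcal{B}_m=\langle\sigma_1,\ldots,\sigma_{m-1}\mid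 \sigma_i\sigma_{i+1}\sigma_i=\sigma_{i+1}\sigma_i\sigma_{i+1},\ \sigma_i\sigma_j=\sigma_j\sigma_i \ (|i-j|\ge 2)\rangle$ acts on $T^m$ by $\sigma_i(t_1,\ldots,t_m)=(t_1,\ldots,t_{i-1},t_{i+1},t_{i+1}^{-1}t_it_{i+1},t_{i+2},\ldots,t_m)$; this preserves the product $t_1\cdots t_m$, so it acts on reflection factorizations of $c$ of length $m$. Two factorizations are in the same Hurwitz orbit if one is obtained from the other by an element of $\mathcal{B}_m$ (in particular they have the same length). *)

theory Defs
  imports "HOL-Analysis.Analysis" "HOL-Algebra.Multiplicative_Group" "HOL-Library.Multiset"
begin

section \<open>The groups G(de,e,n)\<close>

text \<open>The dimension n is the cardinality of the finite index type \<open>'n\<close>.\<close>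

definition monomial_matrix :: "'a::zero ^ 'n ^ 'n \<Rightarrow> bool" where
  "monomial_matrix A \<longleftrightarrow>
     (\<forall>i. \<exists>!j. A $ i $ j \<noteq> 0) \<and> (\<forall>j. \<exists>!i. A $ i $ j \<noteq> 0)"

definition nonzero_positions :: "'a::zero ^ 'n ^ 'm \<Rightarrow> ('m \<times> 'n) set" where
  "nonzero_positions A = {(i, j). A $ i $ j \<noteq> 0}"

text \<open>\<open>monomial_group d e\<close> is G(de,e,n); so G(d,1,n) is \<open>monomial_group d 1\<close> and
  G(d,d,n) is \<open>monomial_group 1 d\<close>.\<close>

definition monomial_group :: "nat \<Rightarrow> nat \<Rightarrow> (complex ^ 'n ^ 'n) monoid" where
  "monomial_group d e =
     \<lparr>carrier = {A. monomial_matrix A \<and>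
                    (\<forall>(i, j) \<in> nonzero_positions A. (A $ i $ j) ^ (d * e) = 1) \<and>
                    (\<Prod>(i, j) \<in> nonzero_positions A. A $ i $ j) ^ d = 1},
      monoid.mult = (\<lambda>A B. A ** B),
      one = mat 1\<rparr>"

lemma monomial_matrixE:
  fixes A :: "'a::zero ^ 'n ^ 'n"
  assumes "monomial_matrix A"
  obtains p a where "bij p" "\<And>i. a i \<noteq> 0" "A = (\<chi> i j. if j = p i then a i else 0)"
proof -
  obtain p where p: "\<And>i j. A $ i $ j \<noteq> 0 \<longleftrightarrow> j = p i"
    using assms unfolding monomial_matrix_def by metis
  have "bij p"
    unfolding bij_iff using assms unfolding monomial_matrix_def p by metis
  moreover have "A = (\<chi> i j. if j = p i then A $ i $ p i else 0)"
    using p by (auto simp: vec_eq_iff)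
  ultimately show ?thesis using that[of p "\<lambda>i. A $ i $ p i"] p by auto
qed

lemma carrier_monomial_groupE:
  assumes "A \<in> carrier (monomial_group d e)"
  obtains p a where "bij p" "\<And>i. a i \<noteq> 0" "\<And>i. a i ^ (d * e) = 1" "(\<Prod>i\<in>UNIV. a i) ^ d = 1"
    "A = (\<chi> i j. if j = p i then a i else 0)"
proof -
  obtain p a where pa: "bij p" "\<And>i. a i \<noteq> 0" "A = (\<chi> i j. if j = p i then a i else 0)"
    using assms monomial_matrixE[of A] by (auto simp: monomial_group_def)
  have pos: "nonzero_positions A = (\<lambda>i. (i, p i)) ` UNIV"
    using pa by (auto simp: nonzero_positions_def split: if_splits)
  have "(\<Prod>(i, j) \<in> nonzero_positions A. A $ i $ j) = (\<Prod>i\<in>UNIV. a i)"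
    unfolding pos by (subst prod.reindex) (auto simp: inj_on_def pa(3))
  then have "(\<Prod>i\<in>UNIV. a i) ^ d = 1"
    using assms by (simp add: monomial_group_def)
  moreover have "a i ^ (d * e) = 1" for i
  proof -
    have "(i, p i) \<in> nonzero_positions A" by (simp add: pos)
    then have "(A $ i $ p i) ^ (d * e) = 1"
      using assms unfolding monomial_group_def by fastforce
    then show ?thesis by (simp add: pa(3))
  qed
  ultimately show ?thesis using that pa by blast
qed

lemma carrier_monomial_groupI:
  assumes "bij p" "\<And>i. a i \<noteq> 0" "\<And>i. a i ^ (d * e) = 1" "(\<Prod>i\<in>UNIV. a i) ^ d = 1"
  shows "(\<chi> i j. if j = p i then a i else 0) \<in> carrier (monomial_group d e)" (is "?A \<in> _")
proof -
  have pos: "nonzero_positions ?A = (\<lambda>i. (i, p i)) ` UNIV"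
    using assms by (auto simp: nonzero_positions_def split: if_splits)
  have "(\<Prod>(i, j) \<in> nonzero_positions ?A. ?A $ i $ j) = (\<Prod>i\<in>UNIV. a i)"
    unfolding pos by (subst prod.reindex) (auto simp: inj_on_def)
  moreover have "monomial_matrix ?A"
  proof -
    have "\<exists>!i. j = p i" for j using assms(1) unfolding bij_iff by metis
    then show ?thesis using assms(2) by (simp add: monomial_matrix_def)
  qed
  moreover have "\<forall>(i, j) \<in> nonzero_positions ?A. (?A $ i $ j) ^ (d * e) = 1"
    using assms(3) by (auto simp: pos)
  ultimately show ?thesis
    using assms(4) unfolding monomial_group_def by (simp only: partial_object.simps mem_Collect_eq)
qed

lemma monomial_matrix_mult:
  fixes a b :: "'n::finite \<Rightarrow> 'a::semiring_1"
  shows "(\<chi> i j. if j = p i then a i else 0) ** (\<chi> i j. if j = q i then b i else 0) =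
         (\<chi> i j. if j = (q \<circ> p) i then a i * b (p i) else 0)"
proof -
  have "(\<Sum>k\<in>UNIV. (if k = p i then a i else 0) * (if j = q k then b k else 0)) =
        (\<Sum>k\<in>UNIV. if k = p i then a i * (if j = q (p i) then b (p i) else 0) else 0)" for i j
    by (intro sum.cong) auto
  then show ?thesis by (simp add: matrix_matrix_mult_def vec_eq_iff)
qed

lemma group_monomial_group: "group (monomial_group d e :: (complex ^ 'n ^ 'n) monoid)"
proof (rule groupI)
  let ?G = "monomial_group d e :: (complex ^ 'n ^ 'n) monoid"
  have one: "\<one>\<^bsub>?G\<^esub> = (\<chi> i j. if j = id i then 1 else 0)"
    by (auto simp: monomial_group_def mat_def vec_eq_iff)
  show "\<one>\<^bsub>?G\<^esub> \<in> carrier ?G"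
    unfolding one by (rule carrier_monomial_groupI) (simp_all only: bij_id, simp_all)
  show "x \<otimes>\<^bsub>?G\<^esub> y \<in> carrier ?G" if xy: "x \<in> carrier ?G" "y \<in> carrier ?G" for x y
  proof -
    obtain p a where x: "bij p" "\<And>i. a i \<noteq> 0" "\<And>i. a i ^ (d * e) = 1" "(\<Prod>i\<in>UNIV. a i) ^ d = 1"
      "x = (\<chi> i j. if j = p i then a i else 0)" using carrier_monomial_groupE[OF xy(1)] by blast
    obtain q b where y: "bij q" "\<And>i. b i \<noteq> 0" "\<And>i. b i ^ (d * e) = 1" "(\<Prod>i\<in>UNIV. b i) ^ d = 1"
      "y = (\<chi> i j. if j = q i then b i else 0)" using carrier_monomial_groupE[OF xy(2)] by blast
    have "(\<Prod>i\<in>UNIV. a i * b (p i)) = (\<Prod>i\<in>UNIV. a i) * (\<Prod>i\<in>UNIV. b i)"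
      using prod.reindex_bij_betw[OF x(1), of b] by (simp add: prod.distrib)
    then have "(\<chi> i j. if j = (q \<circ> p) i then a i * b (p i) else 0) \<in> carrier ?G"
      using x(2-4) y(2-4) bij_comp[OF x(1) y(1)]
      by (intro carrier_monomial_groupI) (simp_all add: comp_def power_mult_distrib)
    moreover have "x \<otimes>\<^bsub>?G\<^esub> y = (\<chi> i j. if j = (q \<circ> p) i then a i * b (p i) else 0)"
      unfolding x(5) y(5) monomial_matrix_mult[symmetric] by (simp add: monomial_group_def)
    ultimately show ?thesis by simp
  qed
  show "\<exists>y\<in>carrier ?G. y \<otimes>\<^bsub>?G\<^esub> x = \<one>\<^bsub>?G\<^esub>" if xG: "x \<in> carrier ?G" for x
  proof -
    obtain p a where x: "bij p" "\<And>i. a i \<noteq> 0" "\<And>i. a i ^ (d * e) = 1" "(\<Prod>i\<in>UNIV. a i) ^ d = 1"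
      "x = (\<chi> i j. if j = p i then a i else 0)" using carrier_monomial_groupE[OF xG] by blast
    have bi: "bij (inv_into UNIV p)" using x(1) by (rule bij_imp_bij_inv)
    let ?y = "(\<chi> i j. if j = inv_into UNIV p i then inverse (a (inv_into UNIV p i)) else 0) :: complex ^ 'n ^ 'n"
    have "(\<Prod>i\<in>UNIV. inverse (a (inv_into UNIV p i))) = inverse (\<Prod>i\<in>UNIV. a i)"
      using prod.reindex_bij_betw[OF bi, of "\<lambda>i. inverse (a i)"] by (simp add: prod_inversef[symmetric] comp_def)
    then have "?y \<in> carrier ?G"
      using x(1-4) bi by (intro carrier_monomial_groupI) (auto simp: power_inverse)
    moreover have "?y \<otimes>\<^bsub>?G\<^esub> x = \<one>\<^bsub>?G\<^esub>"
    proof -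
      have "?y \<otimes>\<^bsub>?G\<^esub> x = ?y ** x" by (simp add: monomial_group_def)
      also have "\<dots> = \<one>\<^bsub>?G\<^esub>"
        unfolding x(5) monomial_matrix_mult one
        using x(1,2) by (simp add: vec_eq_iff bij_is_surj surj_f_inv_f)
      finally show ?thesis .
    qed
    ultimately show ?thesis by blast
  qed
qed (simp_all add: monomial_group_def matrix_mul_assoc)

section \<open>Reflections and Coxeter elements\<close>

definition fixed_space :: "complex ^ 'n ^ 'n \<Rightarrow> (complex ^ 'n) set" where
  "fixed_space A = {v. A *v v = v}"

definition is_reflection :: "complex ^ 'n ^ 'n \<Rightarrow> bool" where
  "is_reflection A \<longleftrightarrow> vec.dim (fixed_space A) = CARD('n) - 1"

definition reflections :: "(complex ^ 'n ^ 'n) monoid \<Rightarrow> (complex ^ 'n ^ 'n) set" where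
  "reflections G = {t \<in> carrier G. is_reflection t}"

definition reflecting_hyperplanes ::
    "(complex ^ 'n ^ 'n) monoid \<Rightarrow> (complex ^ 'n) set set" where
  "reflecting_hyperplanes G = fixed_space ` reflections G"

definition regular_element ::
    "(complex ^ 'n ^ 'n) monoid \<Rightarrow> complex ^ 'n ^ 'n \<Rightarrow> bool" where
  "regular_element G g \<longleftrightarrow> g \<in> carrier G \<and>
     (\<exists>v z. v \<noteq> 0 \<and> g *v v = z *s v \<and> (\<forall>H \<in> reflecting_hyperplanes G. v \<notin> H))"

text \<open>The order is compared with the Coxeter number in the reals, so that the division by n
  is exact.\<close>

definition coxeter_element ::
    "(complex ^ 'n ^ 'n) monoid \<Rightarrow> complex ^ 'n ^ 'n \<Rightarrow> bool" where
  "coxeter_element G c \<longleftrightarrow> regular_element G c \<and>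
     real (group.ord G c) =
       real (card (reflections G) + card (reflecting_hyperplanes G)) / real CARD('n)"

section \<open>Factorizations and conjugacy classes\<close>

definition list_product :: "('a, 'b) monoid_scheme \<Rightarrow> 'a list \<Rightarrow> 'a" where
  "list_product G ts = foldr (\<lambda>x y. x \<otimes>\<^bsub>G\<^esub> y) ts \<one>\<^bsub>G\<^esub>"

definition reflection_factorization ::
    "(complex ^ 'n ^ 'n) monoid \<Rightarrow> complex ^ 'n ^ 'n \<Rightarrow> (complex ^ 'n ^ 'n) list \<Rightarrow> bool" where
  "reflection_factorization G c ts \<longleftrightarrow> set ts \<subseteq> reflections G \<and> list_product G ts = c"

definition conjugacy_class :: "('a, 'b) monoid_scheme \<Rightarrow> 'a \<Rightarrow> 'a set" where
  "conjugacy_class G x = {g \<otimes>\<^bsub>G\<^esub> x \<otimes>\<^bsub>G\<^esub> inv\<^bsub>G\<^esub> g | g. g \<in> carrier G}"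

section \<open>The Hurwitz action\<close>

text \<open>The generator \<open>\<sigma>\<^sub>i\<close> with \<open>1 \<le> i < m\<close> acts on the entries number i and i+1 of a
  list of length m, that is, on the list positions \<open>i - 1\<close> and \<open>i\<close>. The function
  \<open>hurwitz_gen_inv\<close> is the action of the inverse of \<open>\<sigma>\<^sub>i\<close>.\<close>

definition hurwitz_gen :: "('a, 'b) monoid_scheme \<Rightarrow> nat \<Rightarrow> 'a list \<Rightarrow> 'a list" where
  "hurwitz_gen G i ts =
     (let a = ts ! (i - 1); b = ts ! i
      in ts[i - 1 := b, i := inv\<^bsub>G\<^esub> b \<otimes>\<^bsub>G\<^esub> a \<otimes>\<^bsub>G\<^esub> b])"

definition hurwitz_gen_inv :: "('a, 'b) monoid_scheme \<Rightarrow> nat \<Rightarrow> 'a list \<Rightarrow> 'a list" where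
  "hurwitz_gen_inv G i ts =
     (let a = ts ! (i - 1); b = ts ! i
      in ts[i - 1 := a \<otimes>\<^bsub>G\<^esub> b \<otimes>\<^bsub>G\<^esub> inv\<^bsub>G\<^esub> a, i := a])"

text \<open>An element of the braid group on m strands is represented by a word in its generators and
  their inverses: \<open>(i, True)\<close> stands for \<open>\<sigma>\<^sub>i\<close> and \<open>(i, False)\<close> for its inverse.
  The lemmas below show that the defining relations of the braid group hold for the action
  of the generators, so the action of a word depends only on the braid it represents.\<close>

type_synonym braid_word = "(nat \<times> bool) list"

definition braid_words :: "nat \<Rightarrow> braid_word set" where
  "braid_words m = {w. \<forall>(i, s) \<in> set w. 1 \<le> i \<and> i < m}"

definition hurwitz_letter ::
    "('a, 'b) monoid_scheme \<Rightarrow> nat \<times> bool \<Rightarrow> 'a list \<Rightarrow> 'a list" where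
  "hurwitz_letter G x = (if snd x then hurwitz_gen G (fst x) else hurwitz_gen_inv G (fst x))"

definition hurwitz_action ::
    "('a, 'b) monoid_scheme \<Rightarrow> braid_word \<Rightarrow> 'a list \<Rightarrow> 'a list" where
  "hurwitz_action G w ts = foldr (hurwitz_letter G) w ts"

definition same_hurwitz_orbit ::
    "('a, 'b) monoid_scheme \<Rightarrow> 'a list \<Rightarrow> 'a list \<Rightarrow> bool" where
  "same_hurwitz_orbit G ts us \<longleftrightarrow> length ts = length us \<and>
     (\<exists>w \<in> braid_words (length ts). hurwitz_action G w ts = us)"

context group
begin

lemma cancel_inv_middle:
  assumes "x \<in> carrier G" "y \<in> carrier G"
  shows "x \<otimes> (inv x \<otimes> y) = y" "inv x \<otimes> (x \<otimes> y) = y"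
  using assms by (simp_all add: m_assoc[symmetric])

lemma hurwitz_letter_carrier:
  assumes "set ts \<subseteq> carrier G" "1 \<le> i" "i < length ts"
  shows "set (hurwitz_letter G (i, s) ts) \<subseteq> carrier G"
    and "length (hurwitz_letter G (i, s) ts) = length ts"
proof -
  have "ts ! (i - 1) \<in> carrier G" "ts ! i \<in> carrier G"
    using assms nth_mem[of "i - 1" ts] nth_mem[of i ts] by auto
  then show "set (hurwitz_letter G (i, s) ts) \<subseteq> carrier G"
    using assms(1) m_closed inv_closed
    unfolding hurwitz_letter_def hurwitz_gen_def hurwitz_gen_inv_def Let_def
    by (simp add: set_update_subsetI)
  show "length (hurwitz_letter G (i, s) ts) = length ts"
    by (simp add: hurwitz_letter_def hurwitz_gen_def hurwitz_gen_inv_def Let_def)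
qed

lemma hurwitz_gen_inverse:
  assumes "set ts \<subseteq> carrier G" "1 \<le> i" "i < length ts"
  shows "hurwitz_gen_inv G i (hurwitz_gen G i ts) = ts"
    and "hurwitz_gen G i (hurwitz_gen_inv G i ts) = ts"
proof -
  obtain k where i: "i = Suc k" using assms(2) by (cases i) auto
  define a b where "a = ts ! k" and "b = ts ! Suc k"
  have c: "a \<in> carrier G" "b \<in> carrier G"
    using assms i nth_mem[of k ts] nth_mem[of "Suc k" ts] by (auto simp: a_def b_def)
  have e: "b \<otimes> (inv b \<otimes> a \<otimes> b) \<otimes> inv b = a" "inv a \<otimes> (a \<otimes> b \<otimes> inv a) \<otimes> a = b"
    using c by (simp_all add: m_assoc cancel_inv_middle)
  show "hurwitz_gen_inv G i (hurwitz_gen G i ts) = ts"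
    using assms i e unfolding a_def b_def
    by (intro nth_equalityI)
       (auto simp: hurwitz_gen_def hurwitz_gen_inv_def Let_def nth_list_update)
  show "hurwitz_gen G i (hurwitz_gen_inv G i ts) = ts"
    using assms i e unfolding a_def b_def
    by (intro nth_equalityI)
       (auto simp: hurwitz_gen_def hurwitz_gen_inv_def Let_def nth_list_update)
qed

lemma hurwitz_gen_braid:
  assumes "set ts \<subseteq> carrier G" "1 \<le> i" "Suc i < length ts"
  shows "hurwitz_gen G i (hurwitz_gen G (Suc i) (hurwitz_gen G i ts)) =
         hurwitz_gen G (Suc i) (hurwitz_gen G i (hurwitz_gen G (Suc i) ts))"
proof -
  obtain k where i: "i = Suc k" using assms(2) by (cases i) auto
  define a b c where "a = ts ! k" and "b = ts ! Suc k" and "c = ts ! Suc (Suc k)"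
  have "a \<in> carrier G" "b \<in> carrier G" "c \<in> carrier G"
    using assms i nth_mem[of k ts] nth_mem[of "Suc k" ts] nth_mem[of "Suc (Suc k)" ts]
    by (auto simp: a_def b_def c_def)
  then have e: "inv (inv c \<otimes> b \<otimes> c) \<otimes> (inv c \<otimes> a \<otimes> c) \<otimes> (inv c \<otimes> b \<otimes> c) =
      inv c \<otimes> (inv b \<otimes> a \<otimes> b) \<otimes> c"
    by (simp add: m_assoc inv_mult_group cancel_inv_middle)
  show ?thesis
    using assms i e unfolding a_def b_def c_def
    by (intro nth_equalityI)
       (auto simp: hurwitz_gen_def Let_def nth_list_update)
qed

lemma hurwitz_gen_commute:
  assumes "1 \<le> i" "i + 2 \<le> j" "j < length ts"
  shows "hurwitz_gen G i (hurwitz_gen G j ts) = hurwitz_gen G j (hurwitz_gen G i ts)"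
  using assms
  by (intro nth_equalityI) (auto simp: hurwitz_gen_def Let_def nth_list_update)

end

end

theory Submission
  imports Defs
begin

text \<open>A reflection of a monomial group is a weighted edge (a transposition with weights
  \<open>\<alpha>, \<alpha>\<^sup>-\<^sup>1\<close>) or diagonal. Adjacent equal edges \<open>t, t\<close> can be moved past everything and
  conjugated by the group generated by the rest, and three edges with the same end points always
  produce such a pair, by the Euclidean algorithm on exponents. Sorting out the edges at one point
  after the other shows that a factorization into edges without removable pairs is determined up to
  Hurwitz moves by its product, as soon as the product is a long cycle, or a cycle missing one point
  whose weight generates the roots of unity. These are the permutation parts of Coxeter elements,
  as follows by comparing the order with the eigenvector equations on an invariant set of
  coordinates. In \<open>G(d,1,n)\<close> the diagonal reflections are first moved to the front and
  carried along edges to one fixed coordinate. What remains is to change the pairs inside their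
  conjugacy classes.\<close>

section \<open>Monomial matrices\<close>

text \<open>The obstacle is that Hurwitz moves conjugate a removable pair only by factors occurring
  in the rest of the list, whereas conjugacy classes are taken in the whole group. The rest has to
  supply enough conjugators, and in both families their source is a primitive d-th root of unity
  contained in the Coxeter element. In G(d,1,n) it is the product of the weights of the diagonal
  reflections; all edges become exchangeable, so only the classes of the diagonal reflections and
  the number of pairs matter. In G(d,d,n) it is the quotient of the weights of the last two edges
  that remain when the cycle has been stripped off. A move shifts both weights by this quotient, so
  edges of every weight on these two points occur in equivalent lists and may be used as
  conjugators. For n >= 3 this again makes all edges exchangeable; for n = 2 the group is dihedral,
  and the classes restrict the weights through squares.\<close>

abbreviation (input) tr :: "'n \<Rightarrow> 'n \<Rightarrow> 'n \<Rightarrow> 'n" where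
  "tr \<equiv> Transposition.transpose"

text \<open>Row \<open>i\<close> has its nonzero entry in column \<open>p i\<close>, so permutations
  compose from left to right: in \<open>M p a ** M q b\<close> the map \<open>p\<close> acts
  first.\<close>

definition M :: "('n \<Rightarrow> 'n) \<Rightarrow> ('n \<Rightarrow> complex) \<Rightarrow> complex ^ 'n ^ 'n" where
  "M p a = (\<chi> i j. if j = p i then a i else 0)"

definition E :: "'n \<Rightarrow> 'n \<Rightarrow> complex \<Rightarrow> complex ^ 'n ^ 'n" where
  "E i j \<alpha> = M (tr i j) (\<lambda>k. if k = i then \<alpha> else if k = j then inverse \<alpha> else 1)"

definition D :: "'n \<Rightarrow> complex \<Rightarrow> complex ^ 'n ^ 'n" where
  "D i w = M id (\<lambda>k. if k = i then w else 1)"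

lemma M_mult: "M p a ** M q b = M (q \<circ> p) (\<lambda>i. a i * b (p i))"
  unfolding M_def by (rule monomial_matrix_mult)

lemma mat_1_eq_M: "mat 1 = M id (\<lambda>_. 1)"
  by (auto simp: M_def mat_def vec_eq_iff)

lemma M_cong: "p = q \<Longrightarrow> (\<And>i. a i = b i) \<Longrightarrow> M p a = M q b"
  by (simp add: M_def cong: if_cong)

lemma M_inject:
  assumes "M p a = M q b" "\<And>i. a i \<noteq> 0"
  shows "p = q" "a = b"
proof -
  have *: "(if j = p i then a i else 0) = (if j = q i then b i else 0)" for i j
    using assms(1) by (simp add: M_def vec_eq_iff)
  have "p i = q i" for i using *[of "p i" i] assms(2)[of i] by (auto split: if_splits)
  then show 1: "p = q" by auto
  have "a i = b i" for i using *[of "p i" i] 1 by auto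
  then show "a = b" by auto
qed

lemma M_vec: "(M p a *v v) $ i = a i * v $ p i"
  by (simp add: M_def matrix_vector_mult_def if_distrib[of "\<lambda>x. x * _"] cong: if_cong)

lemma E_sym: "i \<noteq> j \<Longrightarrow> E i j \<alpha> = E j i (inverse \<alpha>)"
  unfolding E_def by (intro M_cong) (auto simp: transpose_commute)

text \<open>The new weight can be read off from hyperplanes: \<open>E i j \<alpha>\<close> fixes the
  \<open>v\<close> with \<open>v $ i = \<alpha> * v $ j\<close>, and replacing \<open>v\<close> by
  \<open>M p a *v v\<close> gives an equation between the coordinates \<open>p i\<close> and
  \<open>p j\<close> with factor \<open>\<alpha> * a j / a i\<close>.\<close>

lemma E_conj:
  assumes "bij p" "\<And>k. a k \<noteq> 0" "i \<noteq> j" "\<alpha> \<noteq> 0"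
  shows "E i j \<alpha> ** M p a = M p a ** E (p i) (p j) (\<alpha> * a j / a i)"
proof -
  have inj: "p k = p l \<longleftrightarrow> k = l" for k l using assms(1) by (auto simp: bij_def inj_eq)
  show ?thesis
    unfolding E_def M_mult
    using assms(2,3,4) by (intro M_cong ext) (auto simp: Transposition.transpose_def inj field_simps)
qed

lemma D_conj:
  assumes "bij p" "\<And>k. a k \<noteq> 0"
  shows "D i w ** M p a = M p a ** D (p i) w"
proof -
  have inj: "p k = p l \<longleftrightarrow> k = l" for k l using assms(1) by (auto simp: bij_def inj_eq)
  show ?thesis unfolding D_def M_mult by (intro M_cong) (auto simp: inj)
qed

lemma E_square: "i \<noteq> j \<Longrightarrow> \<alpha> \<noteq> 0 \<Longrightarrow> E i j \<alpha> ** E i j \<alpha> = mat 1"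
  unfolding E_def M_mult mat_1_eq_M by (intro M_cong) (auto simp: Transposition.transpose_def)

lemma E_conj_E:
  assumes "k \<noteq> l" "\<beta> \<noteq> 0" "i \<noteq> j" "\<alpha> \<noteq> 0"
  shows "E i j \<alpha> ** E k l \<beta> = E k l \<beta> ** E (tr k l i) (tr k l j)
    (\<alpha> * (if j = k then \<beta> else if j = l then inverse \<beta> else 1)
       / (if i = k then \<beta> else if i = l then inverse \<beta> else 1))"
  unfolding E_def[of k l] using assms by (intro E_conj) auto

lemma E_move_end:
  assumes "x \<noteq> b" "b \<noteq> c" "x \<noteq> c" "\<alpha> \<noteq> 0" "\<beta> \<noteq> 0"
  shows "E x b \<alpha> ** E b c \<beta> = E b c \<beta> ** E x c (\<alpha> * \<beta>)"
  using E_conj_E[of b c \<beta> x b \<alpha>] assms by simp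

text \<open>The edges on two fixed points behave like the reflections of a dihedral group: on
  exponents of the weights the move takes \<open>a, b\<close> to \<open>b, 2 * b - a\<close>. The
  quotient of neighbouring weights is preserved.\<close>

lemma E_reflect:
  assumes "x \<noteq> b" "\<alpha> \<noteq> 0" "\<beta> \<noteq> 0"
  shows "E x b \<alpha> ** E x b \<beta> = E x b \<beta> ** E x b (\<beta>\<^sup>2 / \<alpha>)"
  using E_conj_E[of x b \<beta> x b \<alpha>] E_sym[of b x "\<alpha> * inverse \<beta> / \<beta>"] assms
  by (simp add: field_simps power2_eq_square)

subsection \<open>The full monomial group\<close>

text \<open>The common ambient group: it is the carrier of G(d,1,n) and contains that of G(d,d,n),
  so conjugation is computed here for both families. Weights are required to be nonzero since
  \<open>d = 0\<close> is not excluded.\<close>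

definition Mon :: "nat \<Rightarrow> (complex ^ 'n ^ 'n) set" where
  "Mon d = {M p a | p a. bij p \<and> (\<forall>i. a i \<noteq> 0) \<and> (\<forall>i. a i ^ d = 1)}"

definition edges :: "nat \<Rightarrow> 'n set \<Rightarrow> (complex ^ 'n ^ 'n) set" where
  "edges d X = {E i j \<alpha> | i j \<alpha>. i \<in> X \<and> j \<in> X \<and> i \<noteq> j \<and> \<alpha> \<noteq> 0 \<and> \<alpha> ^ d = 1}"

definition loops :: "nat \<Rightarrow> (complex ^ 'n ^ 'n) set" where
  "loops d = {D i w | i w. w \<noteq> 0 \<and> w ^ d = 1}"

lemma edgesI: "i \<in> X \<Longrightarrow> j \<in> X \<Longrightarrow> i \<noteq> j \<Longrightarrow> \<alpha> \<noteq> 0 \<Longrightarrow> \<alpha> ^ d = 1 \<Longrightarrow> E i j \<alpha> \<in> edges d X"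
  by (auto simp: edges_def)

lemma edgesE:
  assumes "e \<in> edges d X"
  obtains i j \<alpha> where "e = E i j \<alpha>" "i \<in> X" "j \<in> X" "i \<noteq> j" "\<alpha> \<noteq> 0" "\<alpha> ^ d = 1"
  using assms by (auto simp: edges_def)

lemma edges_Mon: "edges d X \<subseteq> Mon d"
proof
  fix e assume "e \<in> edges d X"
  then obtain i j \<alpha> where e: "e = E i j \<alpha>" "i \<noteq> j" "\<alpha> \<noteq> 0" "\<alpha> ^ d = 1"
    by (rule edgesE)
  show "e \<in> Mon d" unfolding Mon_def e(1) E_def using e
    by (intro CollectI exI[of _ "tr i j"] exI conjI) (auto simp: power_inverse split: if_splits)
qed

lemma loops_Mon: "loops d \<subseteq> Mon d"
  unfolding loops_def Mon_def D_def
  by (auto intro!: exI[of _ id] split: if_splits simp: bij_id)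

lemma MonE:
  assumes "g \<in> Mon d"
  obtains p a where "g = M p a" "bij p" "\<And>i. a i \<noteq> 0" "\<And>i. a i ^ d = 1"
  using assms by (auto simp: Mon_def)

lemma MonI: "bij p \<Longrightarrow> (\<And>i. a i \<noteq> 0) \<Longrightarrow> (\<And>i. a i ^ d = 1) \<Longrightarrow> M p a \<in> Mon d"
  by (auto simp: Mon_def)

lemma Mon_mult:
  assumes "g \<in> Mon d" "h \<in> Mon d"
  shows "g ** h \<in> Mon d"
proof -
  obtain p a where g: "g = M p a" "bij p" "\<And>i. a i \<noteq> 0" "\<And>i. a i ^ d = 1"
    using assms(1) by (rule MonE) blast
  obtain q b where h: "h = M q b" "bij q" "\<And>i. b i \<noteq> 0" "\<And>i. b i ^ d = 1"
    using assms(2) by (rule MonE) blast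
  show ?thesis unfolding g(1) h(1) M_mult
    using g h by (intro MonI bij_comp) (auto simp: power_mult_distrib)
qed

lemma mat_1_Mon: "mat 1 \<in> Mon d"
  unfolding mat_1_eq_M by (rule MonI) (auto simp: bij_id)

lemma Mon_inverse:
  assumes "g \<in> Mon d"
  obtains h where "h \<in> Mon d" "g ** h = mat 1" "h ** g = mat 1"
proof -
  obtain p a where g: "g = M p a" "bij p" "\<And>i. a i \<noteq> 0" "\<And>i. a i ^ d = 1"
    using assms by (rule MonE) blast
  define h where "h = M (inv_into UNIV p) (\<lambda>i. inverse (a (inv_into UNIV p i)))"
  have pi: "p (inv_into UNIV p i) = i" "inv_into UNIV p (p i) = i" for i
    using g(2) by (simp_all add: bij_is_surj surj_f_inv_f bij_is_inj)
  have "h \<in> Mon d" unfolding h_def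
    using g by (intro MonI bij_imp_bij_inv) (auto simp: power_inverse)
  moreover have "g ** h = mat 1" "h ** g = mat 1"
    unfolding g(1) h_def M_mult mat_1_eq_M by (intro M_cong; auto simp: pi g(3))+
  ultimately show ?thesis using that by blast
qed

lemma Mon_cancel_left:
  assumes "g \<in> Mon d" "g ** x = g ** y" shows "x = y"
  using Mon_inverse[OF assms(1)] assms(2) by (metis matrix_mul_assoc matrix_mul_lid)

lemma Mon_cancel_right:
  assumes "g \<in> Mon d" "x ** g = y ** g" shows "x = y"
  using Mon_inverse[OF assms(1)] assms(2) by (metis matrix_mul_assoc matrix_mul_rid)

lemma edge_conj_Mon:
  assumes "t \<in> edges d UNIV" "g \<in> Mon d"
  obtains t' where "t' \<in> edges d UNIV" "t ** g = g ** t'"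
proof -
  obtain p a where g: "g = M p a" "bij p" "\<And>i. a i \<noteq> 0" "\<And>i. a i ^ d = 1"
    using assms(2) by (rule MonE) blast
  obtain i j \<alpha> where t: "t = E i j \<alpha>" "i \<noteq> j" "\<alpha> \<noteq> 0" "\<alpha> ^ d = 1"
    using assms(1) by (rule edgesE)
  have "p i \<noteq> p j" using g(2) t(2) by (auto simp: bij_def inj_eq)
  then have "E (p i) (p j) (\<alpha> * a j / a i) \<in> edges d UNIV"
    using g t by (intro edgesI) (auto simp: power_mult_distrib power_divide)
  moreover have "t ** g = g ** E (p i) (p j) (\<alpha> * a j / a i)"
    unfolding t(1) g(1) using g t by (intro E_conj)
  ultimately show ?thesis using that by blast
qed

lemma edge_conj_Mon':
  assumes "t \<in> edges d UNIV" "g \<in> Mon d"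
  obtains t' where "t' \<in> edges d UNIV" "t' ** g = g ** t"
proof -
  obtain h where h: "h \<in> Mon d" "g ** h = mat 1" "h ** g = mat 1"
    using Mon_inverse[OF assms(2)] by blast
  obtain t' where t': "t' \<in> edges d UNIV" "t ** h = h ** t'"
    using edge_conj_Mon[OF assms(1) h(1)] by blast
  have "g ** (t ** h) ** g = g ** (h ** t') ** g" using t' by simp
  then have "g ** t = t' ** g"
    by (metis h(2,3) matrix_mul_assoc matrix_mul_lid matrix_mul_rid)
  then show ?thesis using that t' by metis
qed

lemma edge_square: "t \<in> edges d X \<Longrightarrow> t ** t = mat 1"
  by (auto simp: edges_def E_square)

section \<open>Hurwitz moves as equations\<close>

text \<open>A move replaces adjacent entries \<open>a, b\<close> by \<open>b, b\<^sup>-\<^sup>1ab\<close>; stating it through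
  \<open>a ** b = b ** a'\<close> avoids inverses and makes the relation independent of the ambient group.\<close>

definition hz_step :: "(complex ^ 'n ^ 'n) list \<Rightarrow> (complex ^ 'n ^ 'n) list \<Rightarrow> bool" where
  "hz_step ts us \<longleftrightarrow> (\<exists>xs a b a' ys. ts = xs @ a # b # ys \<and> us = xs @ b # a' # ys \<and> a ** b = b ** a')"

text \<open>The symmetric closure accounts for the inverse generators, which are the same moves read
  backwards.\<close>

abbreviation hz :: "(complex ^ 'n ^ 'n) list \<Rightarrow> (complex ^ 'n ^ 'n) list \<Rightarrow> bool" (infix "\<sim>" 50)
  where "hz \<equiv> equivclp hz_step"

lemma hz_sym: "ts \<sim> us \<Longrightarrow> us \<sim> ts"
  by (rule equivclp_sym)

lemma hz_trans [trans]: "ts \<sim> us \<Longrightarrow> us \<sim> vs \<Longrightarrow> ts \<sim> vs"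
  by (rule equivclp_trans)

lemma hz_refl [simp]: "ts \<sim> ts"
  by (rule equivclp_refl)

lemma hz_move: "a ** b = b ** a' \<Longrightarrow> xs @ a # b # ys \<sim> xs @ b # a' # ys"
  unfolding hz_step_def[abs_def] by (rule r_into_equivclp) blast

lemma hz_move0: "a ** b = b ** a' \<Longrightarrow> a # b # ys \<sim> b # a' # ys"
  using hz_move[of a b a' "[]"] by simp

lemma hz_induct [consumes 1, case_names refl move unmove]:
  assumes "ts \<sim> us"
    and "P ts"
    and "\<And>xs a b a' ys. P (xs @ a # b # ys) \<Longrightarrow> a ** b = b ** a' \<Longrightarrow> P (xs @ b # a' # ys)"
    and "\<And>xs a b a' ys. P (xs @ b # a' # ys) \<Longrightarrow> a ** b = b ** a' \<Longrightarrow> P (xs @ a # b # ys)"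
  shows "P us"
  using assms(1)
proof (induction rule: equivclp_induct)
  case base
  then show ?case by (rule assms(2))
next
  case (step us vs)
  then show ?case using assms(3,4) unfolding hz_step_def by blast
qed

lemma hz_context:
  assumes "ts \<sim> us" shows "xs @ ts @ ys \<sim> xs @ us @ ys"
  using assms
proof (induction rule: hz_induct)
  case (move us a b a' vs)
  then show ?case using hz_move[of a b a' "xs @ us" "vs @ ys"] hz_trans by fastforce
next
  case (unmove us a b a' vs)
  then show ?case using hz_sym[OF hz_move[of a b a' "xs @ us" "vs @ ys"]] hz_trans by fastforce
qed simp

lemma hz_append_right: "ts \<sim> us \<Longrightarrow> ts @ ys \<sim> us @ ys"
  using hz_context[of ts us "[]"] by simp

lemma hz_append_left: "ts \<sim> us \<Longrightarrow> xs @ ts \<sim> xs @ us"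
  using hz_context[of ts us xs "[]"] by simp

lemma hz_Cons: "ts \<sim> us \<Longrightarrow> x # ts \<sim> x # us"
  using hz_append_left[of ts us "[x]"] by simp

lemma hz_length: "ts \<sim> us \<Longrightarrow> length us = length ts"
  by (induction rule: hz_induct) auto

definition mat_prod :: "(complex ^ 'n ^ 'n) list \<Rightarrow> complex ^ 'n ^ 'n" where
  "mat_prod ts = foldr (**) ts (mat 1)"

lemma mat_prod_Nil [simp]: "mat_prod [] = mat 1"
  and mat_prod_Cons [simp]: "mat_prod (t # ts) = t ** mat_prod ts"
  by (simp_all add: mat_prod_def)

lemma mat_prod_append [simp]: "mat_prod (ts @ us) = mat_prod ts ** mat_prod us"
  by (induction ts) (simp_all add: matrix_mul_assoc)

lemma hz_mat_prod: "ts \<sim> us \<Longrightarrow> mat_prod us = mat_prod ts"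
  by (induction rule: hz_induct) (simp_all add: matrix_mul_assoc)

lemma hz_closed:
  assumes "ts \<sim> us" "set ts \<subseteq> S"
    and "\<And>a b a'. a \<in> S \<Longrightarrow> b \<in> S \<Longrightarrow> a ** b = b ** a' \<Longrightarrow> a' \<in> S"
    and "\<And>a b a'. b \<in> S \<Longrightarrow> a' \<in> S \<Longrightarrow> a ** b = b ** a' \<Longrightarrow> a \<in> S"
  shows "set us \<subseteq> S"
  using assms(1)
proof (induction rule: hz_induct)
  case refl
  then show ?case by (rule assms(2))
next
  case (move xs a b a' ys)
  then show ?case using assms(3)[of a b a'] by auto
next
  case (unmove xs a b a' ys)
  then show ?case using assms(4)[of b a' a] by auto
qed

lemma hz_edges:
  assumes "ts \<sim> us" "set ts \<subseteq> edges d UNIV" shows "set us \<subseteq> edges d UNIV"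
proof (rule hz_closed[OF assms])
  fix a b a' :: "complex ^ 'a ^ 'a"
  assume *: "a \<in> edges d UNIV" "b \<in> edges d UNIV" "a ** b = b ** a'"
  have b: "b \<in> Mon d" using * edges_Mon by blast
  then show "a' \<in> edges d UNIV"
    using edge_conj_Mon[OF *(1) b] *(3) Mon_cancel_left[OF b] by metis
next
  fix a b a' :: "complex ^ 'a ^ 'a"
  assume *: "b \<in> edges d UNIV" "a' \<in> edges d UNIV" "a ** b = b ** a'"
  have b: "b \<in> Mon d" using * edges_Mon by blast
  then show "a \<in> edges d UNIV"
    using edge_conj_Mon'[OF *(2) b] *(3) Mon_cancel_right[OF b] by metis
qed

section \<open>Pairs of equal involutions\<close>

text \<open>Passing one copy of \<open>t\<close> over \<open>x\<close> conjugates \<open>x\<close>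
  by \<open>t\<close>; passing the second copy undoes this because \<open>t\<close> is an
  involution.\<close>

lemma hz_pair_past:
  assumes "t ** t = mat 1"
  shows "xs @ t # t # ys \<sim> t # t # xs @ ys"
proof (induction xs)
  case (Cons x xs)
  let ?x' = "t ** x ** t"
  have tt: "t ** (t ** z) = z" for z using assms by (simp add: matrix_mul_assoc)
  have 1: "?x' ** t = t ** x" "x ** t = t ** ?x'"
    by (simp_all add: matrix_mul_assoc[symmetric] assms tt)
  have "(x # xs) @ t # t # ys \<sim> x # t # t # xs @ ys"
    using hz_Cons[OF Cons] by simp
  also have "\<dots> \<sim> t # ?x' # t # xs @ ys" using hz_move0[OF 1(2)] .
  also have "\<dots> \<sim> t # t # x # xs @ ys"
    by (rule hz_Cons, rule hz_move0[OF 1(1)])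
  finally show ?case by simp
qed simp

lemma hz_pair_conj:
  assumes "t ** t = mat 1" "t ** y = y ** t'"
  shows "xs @ t # t # y # ys \<sim> xs @ y # t' # t' # ys"
proof -
  have "t # t # y # ys \<sim> t # y # t' # ys"
    by (rule hz_Cons, rule hz_move0[OF assms(2)])
  also have "\<dots> \<sim> y # t' # t' # ys" by (rule hz_move0[OF assms(2)])
  finally show ?thesis by (rule hz_append_left)
qed

text \<open>A pair can cross \<open>y\<close> in two ways: either it stays unchanged, or it is
  conjugated by \<open>y\<close>. Crossing once in each way conjugates the pair by a member of the
  list and restores everything else.\<close>

lemma hz_pair_conj_member:
  assumes "t ** t = mat 1" "t' ** t' = mat 1" "y \<in> set ts" "t ** y = y ** t'"
  shows "t # t # ts \<sim> t' # t' # ts"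
proof -
  obtain us vs where ts: "ts = us @ y # vs" using assms(3) by (metis split_list)
  have "t # t # ts \<sim> us @ t # t # y # vs" unfolding ts
    by (rule hz_sym, rule hz_pair_past[OF assms(1)])
  also have "\<dots> \<sim> us @ y # t' # t' # vs" by (rule hz_pair_conj[OF assms(1,4)])
  also have "\<dots> \<sim> t' # t' # ts" using hz_pair_past[OF assms(2), of "us @ [y]" vs] ts by simp
  finally show ?thesis .
qed

definition dbl :: "'a list \<Rightarrow> 'a list" where
  "dbl ts = concat (map (\<lambda>t. [t, t]) ts)"

lemma dbl_simps [simp]: "dbl [] = []" "dbl (t # ts) = t # t # dbl ts" "dbl (ts @ us) = dbl ts @ dbl us"
  by (simp_all add: dbl_def)

lemma mset_dbl: "mset (dbl ts) = mset ts + mset ts"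
  by (induction ts) auto

lemma set_dbl [simp]: "set (dbl ts) = set ts"
  by (induction ts) auto

lemma mat_prod_dbl: "(\<And>t. t \<in> set ts \<Longrightarrow> t ** t = mat 1) \<Longrightarrow> mat_prod (dbl ts) = mat 1"
  by (induction ts) (auto simp: matrix_mul_assoc)

text \<open>\<open>cl\<close> is an arbitrary invariant that says which pairs may replace each
  other; it becomes the conjugacy class for G(d,d,n) and a constant for G(d,1,n). Equal multisets
  provide the matching of the pairs.\<close>

lemma hz_dbl_exchange:
  assumes "\<And>t. t \<in> set ps \<union> set qs \<Longrightarrow> t ** t = mat 1"
    and "\<And>t s. t \<in> set ps \<Longrightarrow> s \<in> set qs \<Longrightarrow> cl t = cl s \<Longrightarrow> t # t # rest \<sim> s # s # rest"
    and "image_mset cl (mset ps) = image_mset cl (mset qs)"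
  shows "dbl ps @ rest \<sim> dbl qs @ rest"
  using assms
proof (induction ps arbitrary: qs)
  case (Cons t ps)
  have "cl t \<in># image_mset cl (mset qs)" using Cons.prems(3) by (metis image_mset_add_mset mset.simps(2) union_single_eq_member)
  then obtain s where s: "s \<in> set qs" "cl t = cl s" by auto
  then obtain us vs where qs: "qs = us @ s # vs" by (metis split_list)
  have sq: "t ** t = mat 1" "s ** s = mat 1" using Cons.prems(1) s by auto
  have "image_mset cl (mset ps) = image_mset cl (mset (us @ vs))"
    using Cons.prems(3) s(2) by (simp add: qs)
  then have IH: "dbl ps @ rest \<sim> dbl (us @ vs) @ rest"
    by (intro Cons.IH) (use Cons.prems in \<open>auto simp: qs\<close>)
  have "dbl (t # ps) @ rest \<sim> t # t # dbl (us @ vs) @ rest"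
    using hz_append_left[OF IH, of "[t, t]"] by simp
  \<comment> \<open>The exchange hypothesis speaks of a pair directly in front of
    \<open>rest\<close>, so the pair is carried there before it is changed.\<close>
  also have "\<dots> \<sim> dbl (us @ vs) @ t # t # rest"
    by (rule hz_sym, rule hz_pair_past[OF sq(1)])
  also have "\<dots> \<sim> dbl (us @ vs) @ s # s # rest"
    using Cons.prems(2)[of t s] s by (intro hz_append_left) auto
  also have "\<dots> \<sim> s # s # dbl (us @ vs) @ rest" by (rule hz_pair_past[OF sq(2)])
  also have "\<dots> \<sim> dbl qs @ rest"
    using hz_sym[OF hz_pair_past[OF sq(2), of "dbl us" "dbl vs @ rest"]] by (simp add: qs)
  finally show ?case .
qed simp

text \<open>Asking for the pair at the front is no restriction, since a pair moves past everything.
  The notion depends only on the Hurwitz orbit, so it survives all rearrangements below.\<close>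

definition pair_free :: "nat \<Rightarrow> (complex ^ 'n ^ 'n) list \<Rightarrow> bool" where
  "pair_free d es \<longleftrightarrow> \<not> (\<exists>t us. t \<in> edges d UNIV \<and> es \<sim> t # t # us)"

lemma pair_free_hz: "pair_free d es \<Longrightarrow> es \<sim> es' \<Longrightarrow> pair_free d es'"
  unfolding pair_free_def using hz_trans by blast

lemma pair_free_appendD: "pair_free d (es @ us) \<Longrightarrow> pair_free d es"
  unfolding pair_free_def using hz_append_right[of es _ us] by fastforce

lemma not_pair_free_pair:
  assumes "t \<in> edges d UNIV" "es \<sim> us @ t # t # vs"
  shows "\<not> pair_free d es"
  unfolding pair_free_def using assms hz_pair_past[OF edge_square[OF assms(1)]] hz_trans by blast

lemma hz_split_pairs:
  assumes "set es \<subseteq> edges d UNIV"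
  shows "\<exists>ps us. es \<sim> dbl ps @ us \<and> pair_free d us \<and> set ps \<subseteq> edges d UNIV \<and> set us \<subseteq> edges d UNIV"
  using assms
proof (induction "length es" arbitrary: es rule: less_induct)
  case less
  show ?case
  proof (cases "pair_free d es")
    case True
    then show ?thesis using less.prems by (intro exI[of _ "[]"] exI[of _ es]) auto
  next
    case False
    then obtain t vs where t: "t \<in> edges d UNIV" "es \<sim> t # t # vs" by (auto simp: pair_free_def)
    have vs: "set vs \<subseteq> edges d UNIV" using hz_edges[OF t(2) less.prems] by auto
    have "length vs < length es" using hz_length[OF t(2)] by auto
    then obtain ps us where *: "vs \<sim> dbl ps @ us" "pair_free d us" "set ps \<subseteq> edges d UNIV" "set us \<subseteq> edges d UNIV"
      using less.hyps vs by blast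
    have "es \<sim> dbl (t # ps) @ us"
      using hz_trans[OF t(2)] hz_append_left[OF *(1), of "[t, t]"] by simp
    then show ?thesis using * t by (intro exI[of _ "t # ps"] exI[of _ us]) auto
  qed
qed

lemma M_perm_eq: "M p a = M q b \<Longrightarrow> \<forall>i. a i \<noteq> 0 \<Longrightarrow> p = q"
  using M_inject(1)[of p a q b] by blast

lemma M_weight_eq: "M p a = M q b \<Longrightarrow> \<forall>i. a i \<noteq> 0 \<Longrightarrow> a = b"
  using M_inject(2)[of p a q b] by blast

section \<open>Factorizations into edges without removable pairs\<close>

text \<open>On three edges with the same end points the moves perform the Euclidean algorithm on the
  differences of the exponents, until two neighbours agree.\<close>

lemma hz_euclid:
  fixes e :: "int \<Rightarrow> complex ^ 'n ^ 'n"
  assumes refl: "\<And>a b. e a ** e b = e b ** e (2 * b - a)"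
  shows "\<exists>us k vs. [e a, e b, e c] \<sim> us @ e k # e k # vs"
proof (induction "nat (\<bar>b - a\<bar> + \<bar>c - b\<bar>)" arbitrary: a b c rule: less_induct)
  case less
  have m1: "[e a, e b, e c] \<sim> [e b, e (2 * b - a), e c]" for a b c
    using hz_move0[OF refl[of a b], of "[e c]"] .
  have m2: "[e a, e b, e c] \<sim> [e a, e c, e (2 * c - b)]" for a b c
    using hz_move[OF refl[of b c], of "[e a]" "[]"] by simp
  have m1': "[e a, e b, e c] \<sim> [e (2 * a - b), e a, e c]" for a b c
    using hz_sym[OF m1[of "2 * a - b" a c]] by simp
  have m2': "[e a, e b, e c] \<sim> [e a, e (2 * b - c), e b]" for a b c
    using hz_sym[OF m2[of a "2 * b - c" b]] by simp
  note IH = less.hyps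
  consider "a = b" | "b = c" | "a \<noteq> b" "b \<noteq> c" by blast
  then show ?case
  proof cases
    case 1
    have "[e a, e b, e c] \<sim> [] @ e a # e a # [e c]" using 1 by simp
    then show ?thesis by blast
  next
    case 2
    have "[e a, e b, e c] \<sim> [e a] @ e b # e b # []" using 2 by simp
    then show ?thesis by blast
  next
    case 3
    \<comment> \<open>With the nonzero differences \<open>u = b - a\<close> and
      \<open>v = c - b\<close>, a move replaces one of them by \<open>u + v\<close> or
      \<open>u - v\<close>, up to sign. According to the signs of \<open>u\<close> and
      \<open>v\<close>, one of these is smaller in absolute value than the larger of the
      two.\<close>
    consider "\<bar>c - 2 * b + a\<bar> < \<bar>c - b\<bar>" | "\<bar>c - a\<bar> < \<bar>c - b\<bar>"
      | "\<bar>c - a\<bar> < \<bar>b - a\<bar>" | "\<bar>2 * b - c - a\<bar> < \<bar>b - a\<bar>"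
      using 3 by linarith
    then show ?thesis
    proof cases
      case 1
      then show ?thesis using IH[of "2 * b - a" b c] m1[of a b c] hz_trans by fastforce
    next
      case 2
      then show ?thesis using IH[of a "2 * a - b" c] m1'[of a b c] hz_trans by fastforce
    next
      case 3
      then show ?thesis using IH[of c a "2 * c - b"] m2[of a b c] hz_trans by fastforce
    next
      case 4
      then show ?thesis using IH[of "2 * b - c" a b] m2'[of a b c] hz_trans by fastforce
    qed
  qed
qed

text \<open>A primitive d-th root of unity, in the form in which it is used. The exponent is a
  natural number because it counts repetitions of a move or of a conjugation.\<close>

definition root_generator :: "nat \<Rightarrow> complex \<Rightarrow> bool" where
  "root_generator d \<omega> \<longleftrightarrow> \<omega> ^ d = 1 \<and> (\<forall>\<alpha>. \<alpha> ^ d = 1 \<longrightarrow> (\<exists>k::nat. \<alpha> = \<omega> ^ k))"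

lemma root_generator_exists: "d > 0 \<Longrightarrow> \<exists>\<omega>. root_generator d \<omega>"
proof -
  assume d: "d > 0"
  let ?\<omega> = "cis (2 * pi / real d)"
  have "\<exists>k. \<alpha> = ?\<omega> ^ k" if "\<alpha> ^ d = 1" for \<alpha>
  proof -
    have "\<alpha> \<in> (\<lambda>k. cis (2 * pi * real k / real d)) ` {..<d}"
      using Complex.bij_betw_roots_unity[OF d] that by (auto simp: bij_betw_def)
    then obtain k where "\<alpha> = cis (2 * pi * real k / real d)" by auto
    moreover have "?\<omega> ^ k = cis (real k * (2 * pi / real d))" by (rule Complex.DeMoivre)
    ultimately have "\<alpha> = ?\<omega> ^ k" by (simp add: mult.commute mult.left_commute)
    then show ?thesis ..
  qed
  moreover have "?\<omega> ^ d = 1" unfolding Complex.DeMoivre using d by simp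
  ultimately show ?thesis unfolding root_generator_def by blast
qed

section \<open>Gathering the edges at one point\<close>

definition star :: "nat \<Rightarrow> 'n \<Rightarrow> 'n \<Rightarrow> (complex ^ 'n ^ 'n) set" where
  "star d x b = {E x b \<alpha> | \<alpha>. \<alpha> \<noteq> 0 \<and> \<alpha> ^ d = 1}"

lemma star_edges: "x \<in> X \<Longrightarrow> b \<in> X \<Longrightarrow> x \<noteq> b \<Longrightarrow> star d x b \<subseteq> edges d X"
  by (auto simp: star_def edges_def)

lemma edges_cases_star:
  assumes "e \<in> edges d X"
  obtains "e \<in> edges d (X - {x})" | b where "b \<in> X - {x}" "e \<in> star d x b"
proof -
  obtain i j \<alpha> where e: "e = E i j \<alpha>" "i \<in> X" "j \<in> X" "i \<noteq> j" "\<alpha> \<noteq> 0" "\<alpha> ^ d = 1"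
    using assms by (rule edgesE)
  have 1: "E i j \<alpha> = E j i (inverse \<alpha>)" using e by (intro E_sym)
  have 2: "inverse \<alpha> \<noteq> 0 \<and> (inverse \<alpha>) ^ d = 1" using e by (simp add: power_inverse)
  consider "x = i" | "x = j" | "x \<noteq> i" "x \<noteq> j" by blast
  then show ?thesis
  proof cases
    case 1 then show ?thesis using e that(2)[of j] by (auto simp: star_def)
  next
    case 2
    then have "e \<in> star d x i" unfolding star_def e(1) 1 using \<open>inverse \<alpha> \<noteq> 0 \<and> _\<close> by blast
    then show ?thesis using e 2 that(2)[of i] by auto
  next
    case 3 then show ?thesis using e that(1) by (auto intro!: edgesI)
  qed
qed

text \<open>Writing the weights as integer powers of a primitive root lifts residues modulo
  \<open>d\<close> to integers, where the descent of \<open>hz_euclid\<close> terminates.\<close>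

lemma not_pair_free_three:
  assumes d: "d > 0" and "x \<noteq> b" and "set fs \<subseteq> star d x b" "length fs \<ge> 3"
  shows "\<not> pair_free d (us @ fs)"
proof -
  obtain e1 e2 e3 vs where fs: "fs = e1 # e2 # e3 # vs"
    using assms(4) by (auto simp: Suc_le_length_iff numeral_eq_Suc)
  obtain \<zeta> where \<zeta>: "root_generator d \<zeta>" using root_generator_exists[OF d] by blast
  have \<zeta>0: "\<zeta> \<noteq> 0" "\<zeta> ^ d = 1" using \<zeta> d by (auto simp: root_generator_def zero_power)
  define e where "e k = E x b (\<zeta> powi k)" for k
  have star: "\<exists>k. f = e k" if "f \<in> set fs" for f
  proof -
    have "f \<in> star d x b" using that assms(3) by auto
    then obtain \<alpha> where "f = E x b \<alpha>" "\<alpha> ^ d = 1" by (auto simp: star_def)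
    then obtain k :: nat where "f = E x b (\<zeta> ^ k)" using \<zeta> by (auto simp: root_generator_def)
    then have "f = e (int k)" by (simp add: e_def)
    then show ?thesis ..
  qed
  obtain k1 k2 k3 where k: "e1 = e k1" "e2 = e k2" "e3 = e k3" using star fs by (metis list.set_intros)
  have "e a ** e b = e b ** e (2 * b - a)" for a b
    unfolding e_def using E_reflect[OF assms(2), of "\<zeta> powi a" "\<zeta> powi b"] \<zeta>0(1)
    by (simp add: power_int_diff power_int_mult mult.commute[of 2])
  from hz_euclid[OF this] obtain ws k vs' where "[e k1, e k2, e k3] \<sim> ws @ e k # e k # vs'" by blast
  from hz_context[OF this, of us vs]
  have *: "us @ fs \<sim> (us @ ws) @ e k # e k # vs' @ vs" by (simp add: fs k)
  have "(\<zeta> powi k) ^ d = (\<zeta> ^ d) powi k"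
    by (metis power_int_mult power_int_of_nat mult.commute)
  then have "e k \<in> edges d UNIV" unfolding e_def using assms(2) \<zeta>0 by (intro edgesI) auto
  then show ?thesis using not_pair_free_pair * by blast
qed

lemma star_conj:
  assumes "e \<in> star d x b" "b \<noteq> x" "y \<in> edges d Y" "x \<notin> Y" "b \<in> Y"
  shows "\<exists>b'\<in>Y. \<exists>e'\<in>star d x b'. e ** y = y ** e'"
proof -
  obtain \<alpha> where e: "e = E x b \<alpha>" "\<alpha> \<noteq> 0" "\<alpha> ^ d = 1" using assms(1) by (auto simp: star_def)
  obtain k l \<beta> where y: "y = E k l \<beta>" "k \<in> Y" "l \<in> Y" "k \<noteq> l" "\<beta> \<noteq> 0" "\<beta> ^ d = 1"
    using assms(3) by (rule edgesE)
  have x: "x \<noteq> k" "x \<noteq> l" using assms(4) y by auto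
  define \<gamma> where "\<gamma> = \<alpha> * (if b = k then \<beta> else if b = l then inverse \<beta> else 1)"
  have "e ** y = y ** E x (tr k l b) \<gamma>"
    using E_conj_E[OF y(4,5), of x b \<alpha>] e x assms(2) unfolding y(1) e(1) \<gamma>_def by simp
  moreover have "E x (tr k l b) \<gamma> \<in> star d x (tr k l b)"
    unfolding star_def \<gamma>_def using e y by (auto simp: power_mult_distrib power_inverse)
  moreover have "tr k l b \<in> Y" using y assms(5) by (auto simp: Transposition.transpose_def)
  ultimately show ?thesis by blast
qed

lemma hz_star_past:
  assumes "set gs \<subseteq> edges d Y" "x \<notin> Y" "b \<in> Y" "e \<in> star d x b"
  shows "\<exists>b'\<in>Y. \<exists>e'\<in>star d x b'. e # gs \<sim> gs @ [e']"
  using assms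
proof (induction gs arbitrary: e b)
  case Nil
  then show ?case by (intro bexI[of _ b] bexI[of _ e]) auto
next
  case (Cons y gs)
  obtain b' e' where 1: "b' \<in> Y" "e' \<in> star d x b'" "e ** y = y ** e'"
    using star_conj[of e d x b y Y] Cons.prems by auto
  obtain b'' e'' where 2: "b'' \<in> Y" "e'' \<in> star d x b''" "e' # gs \<sim> gs @ [e'']"
    using Cons.IH[of b' e'] Cons.prems 1 by auto
  have "e # y # gs \<sim> y # e' # gs" by (rule hz_move0[OF 1(3)])
  also have "\<dots> \<sim> y # gs @ [e'']" by (rule hz_Cons[OF 2(3)])
  finally show ?case using 2 by auto
qed

text \<open>If \<open>e\<close> and the edges of \<open>fs\<close> lead from \<open>x\<close> to
  different points, inverse moves turn every edge of \<open>fs\<close> into an edge avoiding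
  \<open>x\<close>, and \<open>e\<close> remains as the only edge at \<open>x\<close>. If they lead
  to the same point, nothing has to be done.\<close>

lemma hz_star_absorb:
  assumes "set fs \<subseteq> star d x b" "fs \<noteq> [] \<longrightarrow> b \<in> Y" "x \<notin> Y" "c \<in> Y" "e \<in> star d x c"
  shows "\<exists>gs hs b'. e # fs \<sim> gs @ hs \<and> set gs \<subseteq> edges d Y \<and> set hs \<subseteq> star d x b' \<and> b' \<in> Y"
  using assms
proof (induction fs)
  case Nil
  then have "e # [] \<sim> [] @ [e]" by simp
  then show ?case using Nil by (intro exI[of _ "[]"] exI[of _ "[e]"] exI[of _ c]) auto
next
  case (Cons f fs)
  show ?case
  proof (cases "b = c")
    case True
    then show ?thesis using Cons.prems
      by (intro exI[of _ "[]"] exI[of _ "e # f # fs"] exI[of _ c]) auto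
  next
    case False
    obtain \<alpha> where e: "e = E x c \<alpha>" "\<alpha> \<noteq> 0" "\<alpha> ^ d = 1" using Cons.prems by (auto simp: star_def)
    obtain \<beta> where f: "f = E x b \<beta>" "\<beta> \<noteq> 0" "\<beta> ^ d = 1" using Cons.prems by (auto simp: star_def)
    have ne: "x \<noteq> b" "x \<noteq> c" "b \<in> Y" using Cons.prems by auto
    \<comment> \<open>This is \<open>f\<close> conjugated by \<open>e\<close>, the third side of the
      triangle on \<open>c\<close>, \<open>x\<close>, \<open>b\<close>.\<close>
    let ?y = "E c b (\<beta> / \<alpha>)"
    have "?y ** e = e ** f" unfolding e(1) f(1)
      using E_conj_E[of x c \<alpha> c b "\<beta> / \<alpha>"] ne False e f by simp
    then have 1: "e # f # fs \<sim> ?y # e # fs" by (intro hz_sym[OF hz_move0])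
    have y: "?y \<in> edges d Y" using ne Cons.prems e f False
      by (intro edgesI) (auto simp: power_divide)
    obtain gs hs b' where 2: "e # fs \<sim> gs @ hs" "set gs \<subseteq> edges d Y"
      "set hs \<subseteq> star d x b'" "b' \<in> Y"
      using Cons.IH Cons.prems ne by auto
    have "e # f # fs \<sim> (?y # gs) @ hs" using hz_trans[OF 1 hz_Cons[OF 2(1)]] by simp
    then show ?thesis using 2 y by (intro exI[of _ "?y # gs"] exI[of _ hs] exI[of _ b']) auto
  qed
qed

text \<open>A new edge at \<open>x\<close> is carried to the right over the edges that avoid
  \<open>x\<close>; its end \<open>x\<close> stays, only the other end moves. It is then absorbed
  into the edges already gathered. For empty \<open>fs\<close> the point \<open>b\<close> is
  arbitrary, hence the implication.\<close>

lemma hz_eliminate: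
  assumes "set es \<subseteq> edges d X"
  shows "\<exists>gs fs b. es \<sim> gs @ fs \<and> set gs \<subseteq> edges d (X - {x}) \<and> set fs \<subseteq> star d x b \<and>
    (fs \<noteq> [] \<longrightarrow> b \<in> X - {x})"
  using assms
proof (induction es)
  case Nil
  then show ?case by (intro exI[of _ "[]"]) auto
next
  case (Cons e es)
  then obtain gs fs b where 1: "es \<sim> gs @ fs" "set gs \<subseteq> edges d (X - {x})"
    "set fs \<subseteq> star d x b" "fs \<noteq> [] \<longrightarrow> b \<in> X - {x}" by auto
  have "e \<in> edges d X" using Cons by auto
  then show ?case
  proof (cases rule: edges_cases_star[of _ _ _ x])
    case 1
    then show ?thesis using hz_Cons[OF \<open>es \<sim> gs @ fs\<close>, of e] \<open>set gs \<subseteq> _\<close> \<open>set fs \<subseteq> _\<close> \<open>fs \<noteq> [] \<longrightarrow> _\<close>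
      by (intro exI[of _ "e # gs"] exI[of _ fs] exI[of _ b]) auto
  next
    case (2 c)
    obtain c' e' where 3: "c' \<in> X - {x}" "e' \<in> star d x c'" "e # gs \<sim> gs @ [e']"
      using hz_star_past[OF 1(2) _ 2(1) 2(2)] by auto
    obtain us hs b' where 4: "e' # fs \<sim> us @ hs" "set us \<subseteq> edges d (X - {x})"
      "set hs \<subseteq> star d x b'" "b' \<in> X - {x}"
      using hz_star_absorb[OF 1(3,4) _ 3(1,2)] by auto
    have "e # es \<sim> (e # gs) @ fs" using hz_Cons[OF 1(1), of e] by simp
    also have "\<dots> \<sim> (gs @ [e']) @ fs" by (rule hz_append_right[OF 3(3)])
    also have "\<dots> \<sim> gs @ us @ hs" using hz_append_left[OF 4(1), of gs] by simp
    finally have "e # es \<sim> (gs @ us) @ hs" by simp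
    then show ?thesis using 1 4 by (intro exI[of _ "gs @ us"] exI[of _ hs] exI[of _ b']) auto
  qed
qed

lemma mat_prod_edges:
  assumes "set es \<subseteq> edges d X"
  obtains p a where "mat_prod es = M p a" "bij p" "\<forall>i. a i \<noteq> 0 \<and> a i ^ d = 1"
    "\<forall>i. i \<notin> X \<longrightarrow> p i = i \<and> a i = 1"
proof -
  have "\<exists>p a. mat_prod es = M p a \<and> bij p \<and> (\<forall>i. a i \<noteq> 0 \<and> a i ^ d = 1 \<and> (i \<notin> X \<longrightarrow> p i = i \<and> a i = 1))"
    using assms
  proof (induction es)
    case Nil
    then show ?case by (auto simp: mat_1_eq_M intro!: exI[of _ id] exI[of _ "\<lambda>_. 1"])
  next
    case (Cons e es)
    then obtain p a where pa: "mat_prod es = M p a" "bij p"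
      "\<And>i. a i \<noteq> 0 \<and> a i ^ d = 1 \<and> (i \<notin> X \<longrightarrow> p i = i \<and> a i = 1)" by auto
    have "e \<in> edges d X" using Cons.prems by auto
    then obtain i j \<alpha> where e: "e = E i j \<alpha>" "i \<in> X" "j \<in> X" "i \<noteq> j" "\<alpha> \<noteq> 0" "\<alpha> ^ d = 1"
      by (rule edgesE)
    define b where "b = (\<lambda>k. (if k = i then \<alpha> else if k = j then inverse \<alpha> else 1) * a (tr i j k))"
    have "mat_prod (e # es) = M (p \<circ> tr i j) b"
      unfolding mat_prod_Cons pa(1) e(1) E_def M_mult b_def ..
    moreover have "bij (p \<circ> tr i j)" using pa(2) by (intro bij_comp) auto
    moreover have "b k \<noteq> 0 \<and> b k ^ d = 1 \<and> (k \<notin> X \<longrightarrow> (p \<circ> tr i j) k = k \<and> b k = 1)" for k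
      unfolding b_def using e pa(3)
      by (auto simp: power_mult_distrib power_inverse Transposition.transpose_def)
    ultimately show ?case by blast
  qed
  then show ?thesis using that by blast
qed

text \<open>Three edges at \<open>x\<close> would produce a removable pair, and none or two of them
  on the same points would make the product fix \<open>x\<close>. So exactly one is left, and since
  the others act trivially on row \<open>x\<close>, its other end and its weight are dictated by the
  product.\<close>

lemma hz_eliminate_pair_free:
  assumes d: "d > 0" and es: "set es \<subseteq> edges d X" "pair_free d es"
    and prod: "mat_prod es = M p a" and nz: "\<forall>i. a i \<noteq> 0" and px: "p x \<noteq> x"
  shows "\<exists>gs. es \<sim> gs @ [E x (p x) (a x)] \<and> set gs \<subseteq> edges d (X - {x}) \<and> pair_free d gs"
proof -
  obtain gs fs b where 1: "es \<sim> gs @ fs" "set gs \<subseteq> edges d (X - {x})" "set fs \<subseteq> star d x b"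
      "fs \<noteq> [] \<longrightarrow> b \<in> X - {x}"
    using hz_eliminate[OF es(1), of x] by blast
  have pair_free: "pair_free d (gs @ fs)" using pair_free_hz[OF es(2) 1(1)] .
  obtain q c where q: "mat_prod gs = M q c" "bij q" "\<forall>i. c i \<noteq> 0 \<and> c i ^ d = 1"
    "\<forall>i. i \<notin> X - {x} \<longrightarrow> q i = i \<and> c i = 1"
    by (rule mat_prod_edges[OF 1(2)])
  have qx: "q x = x" "c x = 1" using q by auto
  have prod': "M p a = M q c ** mat_prod fs" using hz_mat_prod[OF 1(1)] q(1) prod by simp
  have "length fs < 3"
  proof (rule ccontr)
    assume "\<not> length fs < 3"
    then have "length fs \<ge> 3" "x \<noteq> b" using 1(4) by auto
    then show False using not_pair_free_three[OF d _ 1(3), of gs] pair_free by blast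
  qed
  moreover have "fs \<noteq> []"
  proof
    assume "fs = []"
    then have "M p a = M q c" using prod' by simp
    then show False using M_perm_eq[OF _ nz] qx px by blast
  qed
  moreover have "length fs \<noteq> 2"
  proof
    assume "length fs = 2"
    then obtain \<alpha> \<beta> where fs: "fs = [E x b \<alpha>, E x b \<beta>]"
      using 1(3) by (auto simp: numeral_eq_Suc length_Suc_conv star_def)
    have "p x = x" using prod' unfolding fs mat_prod_Cons mat_prod_Nil matrix_mul_rid E_def M_mult
      using M_perm_eq[OF _ nz] qx by fastforce
    then show False using px by simp
  qed
  ultimately have "length fs = 1" by (cases fs) (auto simp: less_Suc_eq numeral_eq_Suc)
  then obtain \<alpha> where fs: "fs = [E x b \<alpha>]"
    using 1(3) by (auto simp: length_Suc_conv star_def)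
  have *: "M p a = M (tr x b \<circ> q) (\<lambda>i. c i * (if q i = x then \<alpha> else if q i = b then inverse \<alpha> else 1))"
    using prod' by (simp add: fs E_def M_mult)
  have "p x = b" using M_perm_eq[OF * nz] qx by simp
  moreover have "a x = \<alpha>" using M_weight_eq[OF * nz] qx by simp
  ultimately show ?thesis using 1 pair_free_appendD[OF pair_free] fs by blast
qed

text \<open>For a permutation \<open>p\<close> preserving \<open>X\<close> this says that \<open>p\<close> is a single cycle on \<open>X\<close>.\<close>

definition cyc :: "('n \<Rightarrow> 'n) \<Rightarrow> 'n set \<Rightarrow> bool" where
  "cyc p X \<longleftrightarrow> (\<forall>S. S \<subseteq> X \<longrightarrow> S \<noteq> {} \<longrightarrow> p ` S \<subseteq> S \<longrightarrow> S = X)"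

lemma cyc_moves:
  assumes "cyc p X" "x \<in> X" "y \<in> X" "x \<noteq> y" shows "p x \<noteq> x"
  using assms(1)[unfolded cyc_def, rule_format, of "{x}"] assms by auto

text \<open>The composed map sends the predecessor of \<open>x\<close> directly to
  \<open>p x\<close>, so the cycle takes a shortcut past \<open>x\<close>.\<close>

lemma cyc_remove:
  assumes "cyc p X" "x \<in> X"
  shows "cyc (tr x (p x) \<circ> p) (X - {x})"
  unfolding cyc_def
proof (intro allI impI)
  fix S assume S: "S \<subseteq> X - {x}" "S \<noteq> {}" "(tr x (p x) \<circ> p) ` S \<subseteq> S"
  have mem: "tr x (p x) (p s) \<in> S" if "s \<in> S" for s using S(3) that by auto
  have x: "x \<notin> S" using S by auto
  show "S = X - {x}"
  proof (cases "p x \<in> S")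
    case True
    have "p ` insert x S \<subseteq> insert x S"
    proof
      fix y assume "y \<in> p ` insert x S"
      then consider "y = p x" | s where "s \<in> S" "y = p s" by auto
      then show "y \<in> insert x S"
      proof cases
        case 2
        then show ?thesis using mem[of s] True by (auto simp: Transposition.transpose_def split: if_splits)
      qed (use True in auto)
    qed
    then have "insert x S = X" using assms S by (intro assms(1)[unfolded cyc_def, rule_format]) auto
    then show ?thesis using x by auto
  next
    case False
    have "p ` S \<subseteq> S"
    proof
      fix y assume "y \<in> p ` S"
      then obtain s where "s \<in> S" "y = p s" by auto
      then show "y \<in> S" using mem[of s] False x
        by (auto simp: Transposition.transpose_def split: if_splits)
    qed
    then have "S = X" using assms S by (intro assms(1)[unfolded cyc_def, rule_format]) auto
    then show ?thesis using x assms by auto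
  qed
qed

lemma edges_singleton: "edges d {f} = {}"
  by (auto simp: edges_def)

lemma edges_pair:
  assumes "f \<noteq> b" shows "edges d {f, b} = star d f b"
proof
  have "{f, b} - {f} = {b}" using assms by auto
  then show "edges d {f, b} \<subseteq> star d f b"
    using edges_cases_star[of _ d "{f, b}" f] edges_singleton[of d b] by (metis empty_iff singletonD subsetI)
  show "star d f b \<subseteq> edges d {f, b}" using assms by (intro star_edges) auto
qed

text \<open>The product determines only the quotient \<open>a f\<close> of the two weights;
  \<open>\<alpha>\<close> stays undetermined. This is the single freedom that stripping a cycle
  leaves open.\<close>

lemma pair_free_two_points:
  assumes d: "d > 0" and fb: "f \<noteq> b" and es: "set es \<subseteq> edges d {f, b}" "pair_free d es"
    and prod: "mat_prod es = M p a" and nz: "\<forall>i. a i \<noteq> 0" and f: "p f = f" "a f \<noteq> 1"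
  obtains \<alpha> where "\<alpha> \<noteq> 0" "\<alpha> ^ d = 1" "es = [E f b \<alpha>, E f b (\<alpha> / a f)]"
proof -
  have s: "set es \<subseteq> star d f b" using es(1) edges_pair[OF fb] by simp
  have "length es < 3" using not_pair_free_three[OF d fb s, of "[]"] es(2) not_less by fastforce
  moreover have "es \<noteq> []"
  proof
    assume "es = []"
    then have "M p a = M id (\<lambda>_. 1)" using prod by (simp add: mat_1_eq_M)
    then show False using M_weight_eq[OF _ nz] f by metis
  qed
  moreover have "length es \<noteq> 1"
  proof
    assume "length es = 1"
    then obtain \<alpha> where "es = [E f b \<alpha>]" using s by (auto simp: length_Suc_conv star_def)
    then have "M p a = M (tr f b) (\<lambda>k. if k = f then \<alpha> else if k = b then inverse \<alpha> else 1)"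
      using prod by (simp add: E_def)
    then show False using M_perm_eq[OF _ nz] f fb by (metis transpose_apply_first)
  qed
  ultimately have "length es = 2" by (cases es) (auto simp: less_Suc_eq numeral_eq_Suc)
  then obtain \<alpha> \<beta> where \<alpha>: "es = [E f b \<alpha>, E f b \<beta>]" "\<alpha> \<noteq> 0" "\<beta> \<noteq> 0" "\<alpha> ^ d = 1"
    using s by (auto simp: numeral_eq_Suc length_Suc_conv star_def)
  have "M p a = E f b \<alpha> ** E f b \<beta>" using prod \<alpha>(1) by simp
  then have "a f = \<alpha> * inverse \<beta>"
    unfolding E_def M_mult using M_weight_eq[OF _ nz] fb by fastforce
  then have "\<beta> = \<alpha> / a f" using \<alpha>(3) nz[rule_format, of f] by (auto simp: field_simps)
  then show ?thesis using that \<alpha> by blast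
qed

text \<open>One move divides both weights by their quotient \<open>\<omega>\<close>, and the powers
  of \<open>\<omega>\<close> reach every root of unity.\<close>

lemma hz_shift:
  assumes "f \<noteq> b" "root_generator d \<omega>" "\<omega> \<noteq> 0" "\<alpha> \<noteq> 0" "\<beta> \<noteq> 0" "\<alpha> ^ d = 1" "\<beta> ^ d = 1"
  shows "[E f b \<alpha>, E f b (\<alpha> / \<omega>)] \<sim> [E f b \<beta>, E f b (\<beta> / \<omega>)]"
proof -
  have step: "[E f b \<alpha>, E f b (\<alpha> / \<omega>)] \<sim> [E f b (\<alpha> / \<omega>), E f b (\<alpha> / \<omega> / \<omega>)]" if "\<alpha> \<noteq> 0" for \<alpha>
    using hz_move0[OF E_reflect[OF assms(1), of \<alpha> "\<alpha> / \<omega>"], of "[]"] that assms(3)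
    by (simp add: power2_eq_square)
  have steps: "[E f b \<alpha>, E f b (\<alpha> / \<omega>)] \<sim> [E f b (\<alpha> / \<omega> ^ k), E f b (\<alpha> / \<omega> ^ k / \<omega>)]" for k
  proof (induction k)
    case (Suc k)
    show ?case using hz_trans[OF Suc step[of "\<alpha> / \<omega> ^ k"]] assms(3,4) by (simp add: field_simps)
  qed simp
  have "(\<alpha> / \<beta>) ^ d = 1" using assms by (simp add: power_divide)
  then obtain k where "\<alpha> / \<beta> = \<omega> ^ k" using assms(2) by (auto simp: root_generator_def)
  then have "\<beta> = \<alpha> / \<omega> ^ k" using assms by (simp add: field_simps)
  then show ?thesis using steps[of k] by simp
qed

section \<open>Stripping edges off a cycle\<close>

definition cut_perm :: "('n \<Rightarrow> 'n) \<Rightarrow> 'n \<Rightarrow> 'n \<Rightarrow> 'n" where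
  "cut_perm p x = tr x (p x) \<circ> p"

definition cut_weight :: "('n \<Rightarrow> 'n) \<Rightarrow> ('n \<Rightarrow> complex) \<Rightarrow> 'n \<Rightarrow> 'n \<Rightarrow> complex" where
  "cut_weight p a x i = a i * (if p i = x then a x else if p i = p x then inverse (a x) else 1)"

lemma cut_weight_nonzero: "\<forall>i. a i \<noteq> 0 \<Longrightarrow> \<forall>i. cut_weight p a x i \<noteq> 0"
  by (simp add: cut_weight_def)

text \<open>The last edge is an involution, so a further multiplication by it removes it;
  \<open>cut_perm\<close> and \<open>cut_weight\<close> are the components of
  \<open>M p a ** E x (p x) (a x)\<close>.\<close>

lemma mat_prod_without_last:
  assumes "mat_prod (gs @ [E x (p x) (a x)]) = M p a" "p x \<noteq> x" "a x \<noteq> 0"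
  shows "mat_prod gs = M (cut_perm p x) (cut_weight p a x)"
proof -
  let ?e = "E x (p x) (a x)"
  have "mat_prod gs = mat_prod gs ** (?e ** ?e)" using E_square[of x "p x" "a x"] assms by simp
  also have "\<dots> = M p a ** ?e" using assms(1) by (simp add: matrix_mul_assoc)
  finally show ?thesis by (simp add: E_def M_mult cut_perm_def cut_weight_def[abs_def])
qed

text \<open>For \<open>X = UNIV\<close> this is the form of the Coxeter elements of G(d,d,n), while those of
  G(d,1,n) satisfy \<open>cyc p UNIV\<close>.\<close>

definition near_cycle :: "nat \<Rightarrow> 'n \<Rightarrow> 'n set \<Rightarrow> ('n \<Rightarrow> 'n) \<Rightarrow> ('n \<Rightarrow> complex) \<Rightarrow> bool" where
  "near_cycle d f X p a \<longleftrightarrow> cyc p (X - {f}) \<and> p f = f \<and> X \<noteq> {f} \<and> a f \<noteq> 1 \<and> root_generator d (a f)"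

text \<open>Injectivity of \<open>p\<close> gives \<open>p x \<noteq> f\<close>, so the stripped
  edge does not touch \<open>f\<close>, and the generating weight \<open>a f\<close> is inherited by
  the shorter product. A third point in \<open>X\<close> is what guarantees
  \<open>p x \<noteq> x\<close>.\<close>

lemma near_cycle_eliminate:
  assumes d: "d > 0" and es: "set es \<subseteq> edges d X" "pair_free d es"
    and prod: "mat_prod es = M p a" and nz: "\<forall>i. a i \<noteq> 0" and x: "x \<in> X" "x \<noteq> f" "X \<noteq> {f, x}" and f: "f \<in> X"
    and nc: "near_cycle d f X p a"
  obtains gs where "es \<sim> gs @ [E x (p x) (a x)]" "set gs \<subseteq> edges d (X - {x})" "pair_free d gs"
    "mat_prod gs = M (cut_perm p x) (cut_weight p a x)"
    "near_cycle d f (X - {x}) (cut_perm p x) (cut_weight p a x)"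
proof -
  obtain y where y: "y \<in> X - {f}" "y \<noteq> x" using x f by blast
  have px: "p x \<noteq> x" using cyc_moves[of p "X - {f}" x y] nc x y by (auto simp: near_cycle_def)
  obtain gs where gs: "es \<sim> gs @ [E x (p x) (a x)]" "set gs \<subseteq> edges d (X - {x})" "pair_free d gs"
    using hz_eliminate_pair_free[OF d es prod nz px] by blast
  obtain p' a' where p': "mat_prod es = M p' a'" "bij p'" by (rule mat_prod_edges[OF es(1)])
  have "p = p'" using M_perm_eq[OF _ nz] p' prod by metis
  then have pf: "p x \<noteq> f" using p'(2) nc x by (metis bij_def injD near_cycle_def)
  have 1: "mat_prod gs = M (cut_perm p x) (cut_weight p a x)"
    using hz_mat_prod[OF gs(1)] prod nz px by (intro mat_prod_without_last) auto
  have 3: "cut_weight p a x f = a f" unfolding cut_weight_def using nc x pf by (auto simp: near_cycle_def)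
  have "X - {f} - {x} = X - {x} - {f}" by auto
  then have "cyc (cut_perm p x) (X - {x} - {f})" using cyc_remove[of p "X - {f}" x] nc x
    unfolding cut_perm_def near_cycle_def by simp
  moreover have "cut_perm p x f = f" unfolding cut_perm_def using nc x pf by (auto simp: near_cycle_def)
  ultimately have "near_cycle d f (X - {x}) (cut_perm p x) (cut_weight p a x)"
    using nc x y unfolding near_cycle_def 3 by auto
  with gs 1 show ?thesis by (rule that)
qed

text \<open>Both lists can be brought to end in the same edge, because the product dictates it.
  Stripping it shortens the cycle until two points remain; there \<open>hz_shift\<close> identifies
  the possible weights.\<close>

lemma hz_pair_free_near_cycle:
  assumes d: "d > 0" and f: "f \<in> X" and fin: "finite X"
    and es: "set es \<subseteq> edges d X" "pair_free d es" "mat_prod es = M p a"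
    and us: "set us \<subseteq> edges d X" "pair_free d us" "mat_prod us = M p a"
    and a: "\<forall>i. a i \<noteq> 0" and nc: "near_cycle d f X p a"
  shows "es \<sim> us"
  using assms
proof (induction "card X" arbitrary: X es us p a rule: less_induct)
  case less
  obtain b where b: "b \<in> X" "b \<noteq> f" using less.prems(2,11) by (auto simp: near_cycle_def)
  show ?case
  proof (cases "X = {f, b}")
    case True
    have nc: "p f = f" "a f \<noteq> 1" "root_generator d (a f)" using less.prems(11) by (auto simp: near_cycle_def)
    have fb: "f \<noteq> b" using b by auto
    obtain \<alpha> where \<alpha>: "\<alpha> \<noteq> 0" "\<alpha> ^ d = 1" "es = [E f b \<alpha>, E f b (\<alpha> / a f)]"
      using pair_free_two_points[OF d fb _ less.prems(5,6,10) nc(1,2)] less.prems(4) True by blast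
    obtain \<beta> where \<beta>: "\<beta> \<noteq> 0" "\<beta> ^ d = 1" "us = [E f b \<beta>, E f b (\<beta> / a f)]"
      using pair_free_two_points[OF d fb _ less.prems(8,9,10) nc(1,2)] less.prems(7) True by blast
    show ?thesis unfolding \<alpha>(3) \<beta>(3)
      using hz_shift[OF fb nc(3) less.prems(10)[rule_format]] \<alpha> \<beta> by blast
  next
    case False
    note elim = near_cycle_eliminate[OF d _ _ _ less.prems(10) b False less.prems(2,11)]
    obtain gs where gs: "es \<sim> gs @ [E b (p b) (a b)]" "set gs \<subseteq> edges d (X - {b})" "pair_free d gs"
      "mat_prod gs = M (cut_perm p b) (cut_weight p a b)"
      "near_cycle d f (X - {b}) (cut_perm p b) (cut_weight p a b)"
      by (rule elim[OF less.prems(4-6)])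
    obtain hs where hs: "us \<sim> hs @ [E b (p b) (a b)]" "set hs \<subseteq> edges d (X - {b})" "pair_free d hs"
      "mat_prod hs = M (cut_perm p b) (cut_weight p a b)"
      by (rule elim[OF less.prems(7-9)])
    have "card (X - {b}) < card X" using b less.prems(3) by (intro psubset_card_mono) auto
    then have "gs \<sim> hs"
      by (rule less.hyps[OF _ d _ _ gs(2-4) hs(2-4) cut_weight_nonzero[OF less.prems(10)] gs(5)])
        (use less.prems(2,3) b in auto)
    from hz_append_right[OF this] show ?thesis by (rule hz_trans[OF gs(1) hz_trans[OF _ hz_sym[OF hs(1)]]])
  qed
qed

text \<open>The freedom in the two-point core is exploited here: \<open>b\<close> is the same for
  all \<open>\<beta>\<close>, only the remaining list depends on it. The leading edges of arbitrary
  weight serve later as conjugators.\<close>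

lemma hz_near_cycle_normal:
  assumes d: "d > 0" and f: "f \<in> X" and fin: "finite X"
    and es: "set es \<subseteq> edges d X" "pair_free d es" "mat_prod es = M p a"
    and a: "\<forall>i. a i \<noteq> 0" and nc: "near_cycle d f X p a"
  shows "\<exists>b\<in>X - {f}. \<exists>us. \<forall>\<beta>. \<beta> \<noteq> 0 \<longrightarrow> \<beta> ^ d = 1 \<longrightarrow> es \<sim> E f b \<beta> # us \<beta>"
  using assms
proof (induction "card X" arbitrary: X es p a rule: less_induct)
  case less
  obtain b where b: "b \<in> X" "b \<noteq> f" using less.prems(2,8) by (auto simp: near_cycle_def)
  show ?case
  proof (cases "X = {f, b}")
    case True
    have nc: "p f = f" "a f \<noteq> 1" "root_generator d (a f)" using less.prems(8) by (auto simp: near_cycle_def)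
    have fb: "f \<noteq> b" using b by auto
    obtain \<alpha> where \<alpha>: "\<alpha> \<noteq> 0" "\<alpha> ^ d = 1" "es = [E f b \<alpha>, E f b (\<alpha> / a f)]"
      using pair_free_two_points[OF d fb _ less.prems(5,6,7) nc(1,2)] less.prems(4) True by blast
    show ?thesis unfolding \<alpha>(3)
      using hz_shift[OF fb nc(3) less.prems(7)[rule_format] \<alpha>(1) _ \<alpha>(2)] b
      by (intro bexI[of _ b] exI[of _ "\<lambda>\<beta>. [E f b (\<beta> / a f)]"]) auto
  next
    case False
    obtain gs where gs: "es \<sim> gs @ [E b (p b) (a b)]" "set gs \<subseteq> edges d (X - {b})" "pair_free d gs"
      "mat_prod gs = M (cut_perm p b) (cut_weight p a b)"
      "near_cycle d f (X - {b}) (cut_perm p b) (cut_weight p a b)"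
      by (rule near_cycle_eliminate[OF d less.prems(4-6,7) b False less.prems(2,8)])
    have "card (X - {b}) < card X" using b less.prems(3) by (intro psubset_card_mono) auto
    then have "\<exists>b'\<in>X - {b} - {f}. \<exists>us. \<forall>\<beta>. \<beta> \<noteq> 0 \<longrightarrow> \<beta> ^ d = 1 \<longrightarrow> gs \<sim> E f b' \<beta> # us \<beta>"
      by (rule less.hyps[OF _ d _ _ gs(2-4) cut_weight_nonzero[OF less.prems(7)] gs(5)])
        (use less.prems(2,3) b in auto)
    then obtain b' us where "b' \<in> X - {f}" and
      *: "\<And>\<beta>. \<beta> \<noteq> 0 \<Longrightarrow> \<beta> ^ d = 1 \<Longrightarrow> gs \<sim> E f b' \<beta> # us \<beta>" by blast
    moreover have "es \<sim> E f b' \<beta> # us \<beta> @ [E b (p b) (a b)]" if "\<beta> \<noteq> 0" "\<beta> ^ d = 1" for \<beta>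
      using hz_trans[OF gs(1) hz_append_right[OF *[OF that]]] by simp
    ultimately show ?thesis
      by (intro bexI[of _ b'] exI[of _ "\<lambda>\<beta>. us \<beta> @ [E b (p b) (a b)]"]) auto
  qed
qed

text \<open>This is the same descent, but it ends at a single point, which carries no edges, so no
  weight is left free.\<close>

lemma hz_pair_free_long_cycle:
  assumes d: "d > 0" and fin: "finite X" and X: "X \<noteq> {}"
    and es: "set es \<subseteq> edges d X" "pair_free d es" "mat_prod es = M p a"
    and us: "set us \<subseteq> edges d X" "pair_free d us" "mat_prod us = M p a"
    and a: "\<forall>i. a i \<noteq> 0" and cyc: "cyc p X"
  shows "es \<sim> us"
  using assms
proof (induction "card X" arbitrary: X es us p a rule: less_induct)
  case less
  obtain x where x: "x \<in> X" using less.prems(3) by auto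
  show ?case
  proof (cases "X = {x}")
    case True
    then show ?thesis using less.prems(4,7) by (simp add: edges_singleton)
  next
    case False
    then obtain y where y: "y \<in> X" "x \<noteq> y" using x by blast
    have px: "p x \<noteq> x" using cyc_moves[OF less.prems(11) x y] .
    obtain gs where gs: "es \<sim> gs @ [E x (p x) (a x)]" "set gs \<subseteq> edges d (X - {x})" "pair_free d gs"
      using hz_eliminate_pair_free[OF d less.prems(4-6,10) px] by blast
    obtain hs where hs: "us \<sim> hs @ [E x (p x) (a x)]" "set hs \<subseteq> edges d (X - {x})" "pair_free d hs"
      using hz_eliminate_pair_free[OF d less.prems(7-9,10) px] by blast
    have mat_prod: "mat_prod gs = M (cut_perm p x) (cut_weight p a x)" "mat_prod hs = M (cut_perm p x) (cut_weight p a x)"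
      using hz_mat_prod[OF gs(1)] hz_mat_prod[OF hs(1)] less.prems(6,9,10) px by (auto intro!: mat_prod_without_last)
    have cyc: "cyc (cut_perm p x) (X - {x})"
      using cyc_remove[OF less.prems(11) x] by (simp add: cut_perm_def)
    have "card (X - {x}) < card X" using x less.prems(2) by (intro psubset_card_mono) auto
    then have "gs \<sim> hs"
      by (rule less.hyps[OF _ d _ _ gs(2,3) mat_prod(1) hs(2,3) mat_prod(2) cut_weight_nonzero[OF less.prems(10)] cyc])
        (use less.prems(2) y in auto)
    from hz_append_right[OF this] show ?thesis by (rule hz_trans[OF gs(1) hz_trans[OF _ hz_sym[OF hs(1)]]])
  qed
qed

section \<open>Conjugating a pair by the rest of the factorization\<close>

text \<open>The elements by which every pair in front of \<open>rest\<close> may be conjugated.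
  Defining them by their effect, and not as a generated subgroup, makes closure under products a
  mere concatenation of moves.\<close>

definition conjs :: "nat \<Rightarrow> (complex ^ 'n ^ 'n) list \<Rightarrow> (complex ^ 'n ^ 'n) set" where
  "conjs d rest = {g \<in> Mon d. \<forall>t t'. t \<in> edges d UNIV \<longrightarrow> t ** g = g ** t' \<longrightarrow>
     t # t # rest \<sim> t' # t' # rest}"

lemma conjsD: "g \<in> conjs d rest \<Longrightarrow> t \<in> edges d UNIV \<Longrightarrow> t ** g = g ** t' \<Longrightarrow>
    t # t # rest \<sim> t' # t' # rest"
  and conjs_Mon: "g \<in> conjs d rest \<Longrightarrow> g \<in> Mon d"
  by (auto simp: conjs_def)

lemma conjs_one: "mat 1 \<in> conjs d rest"
  by (simp add: conjs_def mat_1_Mon)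

lemma conjs_mult:
  assumes "g \<in> conjs d rest" "h \<in> conjs d rest"
  shows "g ** h \<in> conjs d rest"
  unfolding conjs_def
proof (intro CollectI conjI allI impI)
  show "g ** h \<in> Mon d" using assms by (intro Mon_mult conjs_Mon)
next
  fix t t' :: "complex ^ 'a ^ 'a"
  assume t: "t \<in> edges d UNIV" and eq: "t ** (g ** h) = g ** h ** t'"
  obtain t1 where t1: "t1 \<in> edges d UNIV" "t ** g = g ** t1"
    using edge_conj_Mon[OF t conjs_Mon[OF assms(1)]] by blast
  obtain t2 where t2: "t2 \<in> edges d UNIV" "t1 ** h = h ** t2"
    using edge_conj_Mon[OF t1(1) conjs_Mon[OF assms(2)]] by blast
  have "g ** (h ** t') = t ** (g ** h)" using eq by (simp add: matrix_mul_assoc)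
  also have "\<dots> = g ** (t1 ** h)" by (simp add: matrix_mul_assoc t1)
  finally have "h ** t' = h ** t2"
    using Mon_cancel_left[OF conjs_Mon[OF assms(1)]] t2(2) by metis
  then have "t' = t2" using Mon_cancel_left[OF conjs_Mon[OF assms(2)]] by blast
  then show "t # t # rest \<sim> t' # t' # rest"
    using conjsD[OF assms(1) t t1(2)] conjsD[OF assms(2) t1(1) t2(2)] hz_trans by blast
qed

lemma conjs_member:
  assumes "y \<in> set rest" "y \<in> Mon d" shows "y \<in> conjs d rest"
  unfolding conjs_def
proof (intro CollectI conjI allI impI assms(2))
  fix t t' :: "complex ^ 'a ^ 'a"
  assume t: "t \<in> edges d UNIV" "t ** y = y ** t'"
  have "t' \<in> edges d UNIV"
    using edge_conj_Mon[OF t(1) assms(2)] t(2) Mon_cancel_left[OF assms(2)] by metis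
  then show "t # t # rest \<sim> t' # t' # rest"
    using edge_square t(1) by (intro hz_pair_conj_member[OF _ _ assms(1) t(2)]) blast+
qed

text \<open>The rest may be rearranged, used, and restored, since the pair in front is not affected.
  Hence the members of every equivalent list are available as conjugators, not only those of
  \<open>rest\<close> itself.\<close>

lemma conjs_hz: "rest \<sim> rest' \<Longrightarrow> conjs d rest \<subseteq> conjs d rest'"
  unfolding conjs_def
proof (intro subsetI CollectI conjI allI impI; elim CollectE conjE)
  fix g t t' :: "complex ^ 'a ^ 'a"
  assume hz: "rest \<sim> rest'" and *: "\<forall>t t'. t \<in> edges d UNIV \<longrightarrow> t ** g = g ** t' \<longrightarrow>
     t # t # rest \<sim> t' # t' # rest" "t \<in> edges d UNIV" "t ** g = g ** t'"
  have "t # t # rest' \<sim> t # t # rest" using hz_append_left[OF hz_sym[OF hz], of "[t, t]"] by simp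
  also have "\<dots> \<sim> t' # t' # rest" using * by blast
  also have "\<dots> \<sim> t' # t' # rest'" using hz_append_left[OF hz, of "[t', t']"] by simp
  finally show "t # t # rest' \<sim> t' # t' # rest'" .
qed

definition unity_root :: "nat \<Rightarrow> complex \<Rightarrow> bool" where
  "unity_root d \<alpha> \<longleftrightarrow> \<alpha> \<noteq> 0 \<and> \<alpha> ^ d = 1"

lemma unity_root_simps:
  "unity_root d \<alpha> \<Longrightarrow> unity_root d \<beta> \<Longrightarrow> unity_root d (\<alpha> * \<beta>)"
  "unity_root d \<alpha> \<Longrightarrow> unity_root d \<beta> \<Longrightarrow> unity_root d (\<alpha> / \<beta>)"
  "unity_root d \<alpha> \<Longrightarrow> unity_root d (inverse \<alpha>)"
  "unity_root d 1"
  "unity_root d \<alpha> \<Longrightarrow> \<alpha> \<noteq> 0"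
  by (auto simp: unity_root_def power_mult_distrib power_divide power_inverse)

lemma E_root: "i \<noteq> j \<Longrightarrow> unity_root d \<alpha> \<Longrightarrow> E i j \<alpha> \<in> edges d UNIV"
  by (auto simp: unity_root_def intro: edgesI)

lemma edges_rootE:
  assumes "e \<in> edges d UNIV"
  obtains i j \<alpha> where "e = E i j \<alpha>" "i \<noteq> j" "unity_root d \<alpha>"
  using assms by (auto simp: unity_root_def edges_def)

text \<open>The multigraph formed by the edges in the list is connected.\<close>

definition connects :: "nat \<Rightarrow> (complex ^ 'n ^ 'n) list \<Rightarrow> bool" where
  "connects d es \<longleftrightarrow> (\<forall>S. S \<noteq> {} \<longrightarrow>
     (\<forall>i j \<alpha>. E i j \<alpha> \<in> set es \<longrightarrow> i \<noteq> j \<longrightarrow> unity_root d \<alpha> \<longrightarrow> i \<in> S \<longrightarrow> j \<in> S) \<longrightarrow> S = UNIV)"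

lemma connectsD:
  assumes "connects d es" "i \<in> S"
    "\<And>i j \<alpha>. E i j \<alpha> \<in> set es \<Longrightarrow> i \<noteq> j \<Longrightarrow> unity_root d \<alpha> \<Longrightarrow> i \<in> S \<Longrightarrow> j \<in> S"
  shows "j \<in> S"
  using assms(1)[unfolded connects_def, rule_format, of S] assms(2,3) by blast

lemma connects_mono: "connects d es \<Longrightarrow> set es \<subseteq> set us \<Longrightarrow> connects d us"
  unfolding connects_def by (meson subsetD)

text \<open>Conjugating an edge from \<open>i\<close> to \<open>k\<close> by an edge from
  \<open>k\<close> to \<open>l\<close> gives one from \<open>i\<close> to \<open>l\<close>. So the
  set of points joined to \<open>i\<close> by a conjugator is closed under the edges of
  \<open>rest\<close>, and connectivity makes it everything.\<close>

lemma connects_conjs: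
  assumes "connects d rest" "i \<noteq> j"
  shows "\<exists>\<alpha>. unity_root d \<alpha> \<and> E i j \<alpha> \<in> conjs d rest"
proof -
  define S where "S = {j. j = i \<or> (\<exists>\<alpha>. unity_root d \<alpha> \<and> E i j \<alpha> \<in> conjs d rest)}"
  have "j \<in> S"
  proof (rule connectsD[OF assms(1)])
    show "i \<in> S" by (simp add: S_def)
  next
    fix k l \<beta> assume e: "E k l \<beta> \<in> set rest" "k \<noteq> l" "unity_root d \<beta>" and k: "k \<in> S"
    have "E k l \<beta> \<in> Mon d" using E_root[OF e(2,3)] edges_Mon by blast
    then have kl: "E k l \<beta> \<in> conjs d rest" by (rule conjs_member[OF e(1)])
    consider "l = i" | "l \<noteq> i" "k = i" | "l \<noteq> i" "k \<noteq> i" by blast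
    then show "l \<in> S"
    proof cases
      case 3
      then obtain \<alpha> where \<alpha>: "unity_root d \<alpha>" "E i k \<alpha> \<in> conjs d rest" using k by (auto simp: S_def)
      have "E k l \<beta> ** (E i k \<alpha> ** E k l \<beta>) = E i l (\<alpha> * \<beta>)"
        using E_move_end[of i k l \<alpha> \<beta>] E_square[of k l \<beta>] 3 e \<alpha>
        by (simp add: unity_root_simps matrix_mul_assoc)
      moreover have "E k l \<beta> ** (E i k \<alpha> ** E k l \<beta>) \<in> conjs d rest"
        by (intro conjs_mult kl \<alpha>)
      ultimately show ?thesis using \<alpha>(1) e(3) unity_root_simps(1) by (auto simp: S_def)
    qed (use e kl in \<open>auto simp: S_def\<close>)
  qed
  then show ?thesis using assms(2) by (auto simp: S_def)
qed

lemma hz_pair_edge: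
  assumes "E k l \<beta> \<in> conjs d rest" "k \<noteq> l" "x \<noteq> k" "x \<noteq> l" "unity_root d \<alpha>" "unity_root d \<beta>"
  shows "E x k \<alpha> # E x k \<alpha> # rest \<sim> E x l (\<alpha> * \<beta>) # E x l (\<alpha> * \<beta>) # rest"
  using assms by (intro conjsD[OF assms(1)] E_root E_move_end) (auto simp: unity_root_simps)

text \<open>Connectivity allows the two ends of a pair to be moved one at a time to prescribed
  points. The resulting weight is not controlled here; adjusting it is where the two families
  differ.\<close>

lemma hz_pair_to_edge:
  assumes connects: "connects d rest" and t: "t \<in> edges d UNIV" and xy: "x \<noteq> y"
  shows "\<exists>\<alpha>. unity_root d \<alpha> \<and> t # t # rest \<sim> E x y \<alpha> # E x y \<alpha> # rest"
proof -
  have step: "\<exists>\<beta>. unity_root d \<beta> \<and> E i j \<alpha> # E i j \<alpha> # rest \<sim> E i k \<beta> # E i k \<beta> # rest"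
    if "i \<noteq> j" "i \<noteq> k" "unity_root d \<alpha>" for i j k \<alpha>
  proof (cases "j = k")
    case False
    then obtain \<gamma> where "unity_root d \<gamma>" "E j k \<gamma> \<in> conjs d rest" using connects_conjs[OF connects] by blast
    then show ?thesis using hz_pair_edge[of j k \<gamma> d rest i \<alpha>] that False unity_root_simps(1) by blast
  qed (use that in auto)
  have sym: "E i j \<alpha> = E j i (inverse \<alpha>)" if "i \<noteq> j" for i j \<alpha> using E_sym[OF that] .
  obtain i j \<alpha> where t': "t = E i j \<alpha>" "i \<noteq> j" "unity_root d \<alpha>" using t by (rule edges_rootE)
  have "\<exists>k \<beta>. k \<noteq> x \<and> unity_root d \<beta> \<and> t # t # rest \<sim> E x k \<beta> # E x k \<beta> # rest"
  proof (cases "i = x")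
    case True
    then show ?thesis using t' by (metis hz_refl)
  next
    case False
    then obtain \<beta> where "unity_root d \<beta>" "t # t # rest \<sim> E i x \<beta> # E i x \<beta> # rest"
      using step[OF t'(2) _ t'(3), of x] t' by blast
    then show ?thesis using False sym[OF False, of \<beta>] unity_root_simps(3) by metis
  qed
  then obtain k \<beta> where k: "k \<noteq> x" "unity_root d \<beta>" "t # t # rest \<sim> E x k \<beta> # E x k \<beta> # rest" by blast
  show ?thesis using step[of x k y \<beta>] k xy hz_trans by blast
qed

lemma D_mult: "D x u ** D x v = D x (u * v)"
  unfolding D_def M_mult by (intro M_cong) auto

lemma D_one: "D x 1 = mat 1"
  unfolding D_def mat_1_eq_M by (intro M_cong) auto

lemma mat_prod_D: "mat_prod (map (D x) ws) = D x (prod_list ws)"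
  by (induction ws) (simp_all add: D_mult D_one)

lemma D_Mon: "unity_root d w \<Longrightarrow> D x w \<in> Mon d"
  using loops_Mon[of d] by (auto simp: loops_def unity_root_def)

lemma E_D:
  assumes "x \<noteq> y" "unity_root d \<alpha>" "unity_root d w"
  shows "E x y \<alpha> ** D x w = D x w ** E x y (\<alpha> / w)"
  unfolding D_def using E_conj[of id "\<lambda>k. if k = x then w else 1" x y \<alpha>] assms
  by (auto simp: unity_root_def bij_id split: if_splits)

text \<open>Conjugation by \<open>D x w\<close> divides the weight of an edge leaving
  \<open>x\<close> by \<open>w\<close>. Powers of the product of the loop weights give every root of
  unity, so any pair on \<open>x\<close>, \<open>y\<close> can take any weight, and all pairs become
  exchangeable.\<close>

lemma hz_pairs_with_loops:
  assumes connects: "connects d (map (D x) ws @ es)" and ws: "\<And>w. w \<in> set ws \<Longrightarrow> unity_root d w"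
    and root_generator: "root_generator d (prod_list ws)" and xy: "x \<noteq> y"
    and ts: "t \<in> edges d UNIV" "s \<in> edges d UNIV"
  shows "t # t # map (D x) ws @ es \<sim> s # s # map (D x) ws @ es" (is "t # t # ?r \<sim> _")
proof -
  have "D x (prod_list us) \<in> conjs d ?r" if "set us \<subseteq> set ws" for us
    using that
  proof (induction us)
    case (Cons u us)
    have "D x u \<in> conjs d ?r" using Cons.prems ws by (intro conjs_member D_Mon) auto
    moreover have "D x (prod_list us) \<in> conjs d ?r" using Cons by auto
    ultimately have "D x u ** D x (prod_list us) \<in> conjs d ?r" by (rule conjs_mult)
    then show ?case by (simp add: D_mult)
  qed (simp add: D_one conjs_one)
  then have 1: "D x (prod_list ws) \<in> conjs d ?r" by blast
  have 2: "D x (prod_list ws ^ k) \<in> conjs d ?r" for k :: nat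
  proof (induction k)
    case (Suc k)
    show ?case using conjs_mult[OF 1 Suc] by (simp add: D_mult)
  qed (simp add: D_one conjs_one)
  have 3: "E x y \<alpha> # E x y \<alpha> # ?r \<sim> E x y \<beta> # E x y \<beta> # ?r" if "unity_root d \<alpha>" "unity_root d \<beta>" for \<alpha> \<beta>
  proof -
    have r: "unity_root d (\<alpha> / \<beta>)" using that by (rule unity_root_simps)
    then obtain k where "\<alpha> / \<beta> = prod_list ws ^ k" using root_generator by (auto simp: root_generator_def unity_root_def)
    then have "D x (\<alpha> / \<beta>) \<in> conjs d ?r" using 2[of k] by simp
    then show ?thesis
      using E_D[OF xy that(1) r] that by (intro conjsD E_root xy) (auto simp: unity_root_def)
  qed
  obtain \<alpha> where \<alpha>: "unity_root d \<alpha>" "t # t # ?r \<sim> E x y \<alpha> # E x y \<alpha> # ?r"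
    using hz_pair_to_edge[OF connects ts(1) xy] by blast
  obtain \<beta> where \<beta>: "unity_root d \<beta>" "s # s # ?r \<sim> E x y \<beta> # E x y \<beta> # ?r"
    using hz_pair_to_edge[OF connects ts(2) xy] by blast
  show ?thesis by (rule hz_trans[OF \<alpha>(2) hz_trans[OF 3[OF \<alpha>(1) \<beta>(1)] hz_sym[OF \<beta>(2)]]])
qed

text \<open>For each weight there is an equivalent list that starts with the edge of this weight,
  and conjugators do not depend on the chosen representative of the orbit.\<close>

lemma near_cycle_conjs:
  fixes es :: "(complex ^ 'n ^ 'n) list"
  assumes d: "d > 0" and es: "set es \<subseteq> edges d UNIV" "pair_free d es" "mat_prod es = M p a"
    and a: "\<forall>i. a i \<noteq> 0" and nc: "near_cycle d f UNIV p a"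
  obtains b where "b \<noteq> f" "\<And>\<beta>. unity_root d \<beta> \<Longrightarrow> E f b \<beta> \<in> conjs d es"
proof -
  obtain b us where b: "b \<noteq> f" "\<And>\<beta>. \<beta> \<noteq> 0 \<Longrightarrow> \<beta> ^ d = 1 \<Longrightarrow> es \<sim> E f b \<beta> # us \<beta>"
    using hz_near_cycle_normal[OF d _ _ es a nc] by auto
  have "E f b \<beta> \<in> conjs d es" if "unity_root d \<beta>" for \<beta>
  proof -
    have hz: "E f b \<beta> # us \<beta> \<sim> es" using b(2)[of \<beta>] that hz_sym by (auto simp: unity_root_def)
    have "E f b \<beta> \<in> Mon d" using E_root[of f b d \<beta>] that b(1) edges_Mon by blast
    then have "E f b \<beta> \<in> conjs d (E f b \<beta> # us \<beta>)" by (intro conjs_member) auto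
    then show ?thesis using conjs_hz[OF hz] by blast
  qed
  then show ?thesis using that b(1) by blast
qed

lemma hz_pair_reflect:
  assumes "E f b \<beta> \<in> conjs d rest" "f \<noteq> b" "unity_root d \<alpha>" "unity_root d \<beta>"
  shows "E f b \<alpha> # E f b \<alpha> # rest \<sim> E f b (\<beta>\<^sup>2 / \<alpha>) # E f b (\<beta>\<^sup>2 / \<alpha>) # rest"
  using assms by (intro conjsD[OF assms(1)] E_root E_reflect) (auto simp: unity_root_simps)

text \<open>With a third point \<open>x\<close>, a pair on \<open>{f, b}\<close> can be carried around the triangle; the weights
  of the edges \<open>E f b \<beta>\<close> are free, so every weight is reached.\<close>

lemma hz_pairs_near_cycle:
  fixes es :: "(complex ^ 'n ^ 'n) list"
  assumes d: "d > 0" and es: "set es \<subseteq> edges d UNIV" "pair_free d es" "mat_prod es = M p a"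
    and a: "\<forall>i. a i \<noteq> 0" and nc: "near_cycle d f UNIV p a" and connects: "connects d es"
    and card: "CARD('n) \<ge> 3"
    and ts: "t \<in> edges d UNIV" "s \<in> edges d UNIV"
  shows "t # t # es \<sim> s # s # es"
proof -
  obtain b where b: "b \<noteq> f" "\<And>\<beta>. unity_root d \<beta> \<Longrightarrow> E f b \<beta> \<in> conjs d es"
    using near_cycle_conjs[OF d es a nc] by blast
  have "\<not> UNIV \<subseteq> {f, b}" using card card_mono[of "{f, b}" UNIV] b(1) by auto
  then obtain x where x: "x \<noteq> f" "x \<noteq> b" by blast
  obtain \<gamma> where \<gamma>: "unity_root d \<gamma>" "E b x \<gamma> \<in> conjs d es" using connects_conjs[OF connects, of b x] x by blast
  have 3: "E f b \<alpha> # E f b \<alpha> # es \<sim> E f b \<delta> # E f b \<delta> # es" if r: "unity_root d \<alpha>" "unity_root d \<delta>" for \<alpha> \<delta>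
  proof -
    let ?P = "\<lambda>e. e # e # es"
    \<comment> \<open>The factors \<open>\<gamma>\<close> from the way out and the way back cancel.
      What remains is the quotient of the weights \<open>\<alpha> / \<delta>\<close> and
      \<open>1\<close> of the two conjugating edges on \<open>f\<close>, \<open>b\<close>.\<close>
    let ?\<beta> = "\<alpha> / \<delta>"
    have r': "unity_root d ?\<beta>" using r by (simp add: unity_root_simps)
    have nz: "\<alpha> \<noteq> 0" "\<delta> \<noteq> 0" "\<gamma> \<noteq> 0" using r \<gamma> by (auto simp: unity_root_simps)
    have "?P (E f b \<alpha>) \<sim> ?P (E f x (\<alpha> * \<gamma>))"
      by (rule hz_pair_edge[OF \<gamma>(2)]) (use x b r \<gamma> in auto)
    also have "\<dots> \<sim> ?P (E b x (\<delta> * \<gamma>))"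
    proof (rule conjsD[OF b(2)[OF r']])
      show "E f x (\<alpha> * \<gamma>) ** E f b ?\<beta> = E f b ?\<beta> ** E b x (\<delta> * \<gamma>)"
        using E_conj_E[of f b ?\<beta> f x "\<alpha> * \<gamma>"] nz x b(1) by (simp add: mult.commute)
    qed (use x r \<gamma> in \<open>auto intro!: E_root simp: unity_root_simps\<close>)
    also have "\<dots> \<sim> ?P (E f x (\<delta> * \<gamma>))"
    proof (rule conjsD[OF b(2)[of 1]])
      show "E b x (\<delta> * \<gamma>) ** E f b 1 = E f b 1 ** E f x (\<delta> * \<gamma>)"
        using E_conj_E[of f b 1 b x "\<delta> * \<gamma>"] nz x b(1) by (simp add: mult.commute)
    qed (use x r \<gamma> in \<open>auto intro!: E_root simp: unity_root_simps\<close>)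
    also have "\<dots> \<sim> ?P (E f b \<delta>)"
    proof (rule conjsD[OF \<gamma>(2)])
      show "E f x (\<delta> * \<gamma>) ** E b x \<gamma> = E b x \<gamma> ** E f b \<delta>"
        using E_conj_E[of b x \<gamma> f x "\<delta> * \<gamma>"] nz x b(1) by (simp add: mult.assoc)
    qed (use x r \<gamma> in \<open>auto intro!: E_root simp: unity_root_simps\<close>)
    finally show ?thesis .
  qed
  obtain \<alpha> where \<alpha>: "unity_root d \<alpha>" "t # t # es \<sim> E f b \<alpha> # E f b \<alpha> # es"
    using hz_pair_to_edge[OF connects ts(1)] b(1) by metis
  obtain \<beta> where \<beta>: "unity_root d \<beta>" "s # s # es \<sim> E f b \<beta> # E f b \<beta> # es"
    using hz_pair_to_edge[OF connects ts(2)] b(1) by metis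
  show ?thesis by (rule hz_trans[OF \<alpha>(2) hz_trans[OF 3[OF \<alpha>(1) \<beta>(1)] hz_sym[OF \<beta>(2)]]])
qed

section \<open>Connectivity deduced from the product\<close>

lemma mat_prod_invariant:
  assumes "set es \<subseteq> edges d UNIV" "mat_prod es = M p a" "\<forall>i. a i \<noteq> 0"
    and "\<And>i j \<alpha>. E i j \<alpha> \<in> set es \<Longrightarrow> i \<noteq> j \<Longrightarrow> unity_root d \<alpha> \<Longrightarrow> i \<in> S \<Longrightarrow> j \<in> S"
    and "i \<in> S"
  shows "p i \<in> S"
  using assms
proof (induction es arbitrary: p a i)
  case Nil
  then have "p = id" using M_perm_eq[of p a id "\<lambda>_. 1"] by (simp add: mat_1_eq_M)
  then show ?case using Nil by simp
next
  case (Cons e es)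
  have "e \<in> edges d UNIV" using Cons.prems by auto
  then obtain k l \<alpha> where e: "e = E k l \<alpha>" "k \<noteq> l" "unity_root d \<alpha>" by (rule edges_rootE)
  have es: "set es \<subseteq> edges d UNIV" using Cons.prems by auto
  obtain q b where q: "mat_prod es = M q b" "bij q" "\<forall>i. b i \<noteq> 0 \<and> b i ^ d = 1"
    "\<forall>i. i \<notin> UNIV \<longrightarrow> q i = i \<and> b i = 1"
    by (rule mat_prod_edges[OF es])
  have "M p a = E k l \<alpha> ** M q b" using Cons.prems(2) q(1) e(1) by simp
  then have p: "p = q \<circ> tr k l" unfolding E_def M_mult using M_perm_eq[OF _ Cons.prems(3)] by blast
  have "E k l \<alpha> \<in> set (e # es)" "E l k (inverse \<alpha>) \<in> set (e # es)"
    using E_sym[OF e(2), of \<alpha>] e(1) by simp_all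
  then have kl: "k \<in> S \<longleftrightarrow> l \<in> S"
    using Cons.prems(4)[of k l \<alpha>] Cons.prems(4)[of l k "inverse \<alpha>"] e(2) e(3) unity_root_simps(3)[OF e(3)]
    by argo
  have "i \<in> S" using Cons.prems by blast
  then have tr: "tr k l i \<in> S"
    using kl by (metis transpose_apply_first transpose_apply_second transpose_apply_other)
  have nz: "\<forall>i. b i \<noteq> 0" using q(3) by blast
  have inv: "j \<in> S" if "E i j \<alpha> \<in> set es" "i \<noteq> j" "unity_root d \<alpha>" "i \<in> S" for i j \<alpha>
    by (rule Cons.prems(4)[OF _ that(2-4)]) (use that(1) in simp)
  have "q (tr k l i) \<in> S" by (rule Cons.IH[OF es q(1) nz inv tr])
  then show ?case unfolding p by simp
qed

lemma connects_long_cycle: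
  assumes "set es \<subseteq> edges d UNIV" "mat_prod es = M p a" "\<forall>i. a i \<noteq> 0" "cyc p UNIV"
  shows "connects d es"
  unfolding connects_def
proof (intro allI impI)
  fix S assume S: "S \<noteq> {}" "\<forall>i j \<alpha>. E i j \<alpha> \<in> set es \<longrightarrow> i \<noteq> j \<longrightarrow> unity_root d \<alpha> \<longrightarrow> i \<in> S \<longrightarrow> j \<in> S"
  have "p ` S \<subseteq> S" using mat_prod_invariant[OF assms(1-3), of S] S(2) by blast
  then show "S = UNIV" using assms(4) S(1) by (auto simp: cyc_def)
qed

text \<open>The permutation alone cannot show that \<open>f\<close> is connected to the cycle,
  because it fixes \<open>f\<close>. The weight does: if no edge touched \<open>f\<close>, the
  product would have weight 1 there.\<close>

lemma connects_near_cycle: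
  fixes es :: "(complex ^ 'n ^ 'n) list"
  assumes es: "set es \<subseteq> edges d UNIV" "mat_prod es = M p a" and a: "\<forall>i. a i \<noteq> 0"
    and nc: "near_cycle d f UNIV p a"
  shows "connects d es"
  unfolding connects_def
proof (intro allI impI)
  fix S assume S: "S \<noteq> {}" "\<forall>i j \<alpha>. E i j \<alpha> \<in> set es \<longrightarrow> i \<noteq> j \<longrightarrow> unity_root d \<alpha> \<longrightarrow> i \<in> S \<longrightarrow> j \<in> S"
  have pS: "p i \<in> S" if "i \<in> S" for i using mat_prod_invariant[OF es a, of S] S(2) that by blast
  have kl: "i \<in> S \<longleftrightarrow> j \<in> S" if "E i j \<alpha> \<in> set es" "i \<noteq> j" "unity_root d \<alpha>" for i j \<alpha>
    using S(2) that E_sym[of i j \<alpha>] unity_root_simps(3)[of d \<alpha>] by metis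
  have "\<not> set es \<subseteq> edges d (UNIV - {f})"
  proof
    assume "set es \<subseteq> edges d (UNIV - {f})"
    then obtain q b where q: "mat_prod es = M q b" "bij q" "\<forall>i. b i \<noteq> 0 \<and> b i ^ d = 1"
    "\<forall>i. i \<notin> UNIV - {f} \<longrightarrow> q i = i \<and> b i = 1"
      by (rule mat_prod_edges)
    have "a = b" using M_weight_eq[OF _ a, of p q b] es(2) q(1) by metis
    then show False using q(4) nc by (simp add: near_cycle_def)
  qed
  then obtain e where e: "e \<in> set es" "e \<notin> edges d (UNIV - {f})" by blast
  obtain b where b: "b \<noteq> f" "e \<in> star d f b"
    using edges_cases_star[of e d UNIV f] es(1) e by blast
  then obtain \<alpha> where \<alpha>: "e = E f b \<alpha>" "unity_root d \<alpha>" by (auto simp: star_def unity_root_def)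
  have fb: "f \<in> S \<longleftrightarrow> b \<in> S" using kl[of f b \<alpha>] e(1) \<alpha> b(1) by auto
  have ne: "S - {f} \<noteq> {}" using S(1) fb b(1) by auto
  have "p i \<noteq> f" if "i \<noteq> f" for i
  proof -
    obtain q c where "mat_prod es = M q c" "bij q" by (rule mat_prod_edges[OF es(1)])
    then have "bij p" using M_perm_eq[OF _ a] es(2) by metis
    then show ?thesis using nc that by (metis bij_def injD near_cycle_def)
  qed
  then have "p ` (S - {f}) \<subseteq> S - {f}" using pS by auto
  then have "S - {f} = UNIV - {f}" using nc ne unfolding near_cycle_def cyc_def by blast
  then show "S = UNIV" using fb b(1) by auto
qed

section \<open>Collecting the diagonal reflections\<close>

lemma hz_move_right:
  assumes "e \<in> S" "\<And>e y. e \<in> S \<Longrightarrow> y \<in> set ys \<Longrightarrow> \<exists>e'\<in>S. e ** y = y ** e'"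
  shows "\<exists>e'\<in>S. e # ys \<sim> ys @ [e']"
  using assms
proof (induction ys arbitrary: e)
  case Nil
  then show ?case by (intro bexI[of _ e]) auto
next
  case (Cons y ys)
  obtain e' where e': "e' \<in> S" "e ** y = y ** e'" using Cons.prems by fastforce
  obtain e'' where e'': "e'' \<in> S" "e' # ys \<sim> ys @ [e'']" using Cons.IH[OF e'(1)] Cons.prems(2) by fastforce
  have "e # y # ys \<sim> (y # ys) @ [e'']" using hz_trans[OF hz_move0[OF e'(2)] hz_Cons[OF e''(2)]] by simp
  then show ?case using e''(1) by blast
qed

lemma hz_permute_commuting:
  assumes "mset us = mset vs" "\<And>a b. a \<in> set us \<Longrightarrow> b \<in> set us \<Longrightarrow> a ** b = b ** a"
  shows "us \<sim> vs"
  using assms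
proof (induction us arbitrary: vs)
  case (Cons u us)
  have "u \<in> set vs" using Cons.prems(1) by (metis list.set_intros(1) set_mset_mset)
  then obtain xs ys where vs: "vs = xs @ u # ys" by (metis split_list)
  have ms: "mset us = mset (xs @ ys)" using Cons.prems(1) by (simp add: vs)
  then have "us \<sim> xs @ ys" using Cons by auto
  then have "u # us \<sim> u # xs @ ys" by (rule hz_Cons)
  also have "\<exists>e'\<in>{u}. u # xs \<sim> xs @ [e']"
  proof (rule hz_move_right)
    have "set xs \<subseteq> set us" using mset_eq_setD[OF ms] by auto
    then show "\<exists>e'\<in>{u}. e ** y = y ** e'" if "e \<in> {u}" "y \<in> set xs" for e y
      using that Cons.prems(2)[of u y] by auto
  qed simp
  then have "u # xs \<sim> xs @ [u]" by simp
  from hz_append_right[OF this, of ys] have "u # xs @ ys \<sim> vs" by (simp add: vs)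
  finally show ?case .
qed simp

text \<open>The same end points with a possibly different weight. All representations are quantified
  over because \<open>E i j \<alpha>\<close> and \<open>E j i (inverse \<alpha>)\<close> are the
  same matrix. Loops passing over edges change only weights, so connectivity is carried along by
  this relation.\<close>

definition same_shape :: "nat \<Rightarrow> complex ^ 'n ^ 'n \<Rightarrow> complex ^ 'n ^ 'n \<Rightarrow> bool" where
  "same_shape d e e' \<longleftrightarrow> (\<forall>i j \<alpha>. e = E i j \<alpha> \<longrightarrow> i \<noteq> j \<longrightarrow> unity_root d \<alpha> \<longrightarrow> (\<exists>\<beta>. unity_root d \<beta> \<and> e' = E i j \<beta>))"

abbreviation same_shapes :: "nat \<Rightarrow> (complex ^ 'n ^ 'n) list \<Rightarrow> (complex ^ 'n ^ 'n) list \<Rightarrow> bool" where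
  "same_shapes d \<equiv> list_all2 (same_shape d)"

lemma same_shape_refl: "same_shape d e e"
  by (auto simp: same_shape_def)

lemma same_shape_trans: "same_shape d e e' \<Longrightarrow> same_shape d e' e'' \<Longrightarrow> same_shape d e e''"
  unfolding same_shape_def by blast

lemma same_shapes_refl: "same_shapes d es es"
  by (simp add: list.rel_refl same_shape_refl)

lemma same_shapes_trans: "same_shapes d es es' \<Longrightarrow> same_shapes d es' es'' \<Longrightarrow> same_shapes d es es''"
  by (rule list_all2_trans[of "same_shape d" "same_shape d"]) (auto intro: same_shape_trans)

lemma same_shapes_connects:
  assumes "same_shapes d es es'" "connects d es" shows "connects d es'"
proof -
  have "\<exists>\<beta>. unity_root d \<beta> \<and> E i j \<beta> \<in> set es'" if "E i j \<alpha> \<in> set es" "i \<noteq> j" "unity_root d \<alpha>" for i j \<alpha>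
    using assms(1) that unfolding list_all2_conv_all_nth in_set_conv_nth same_shape_def by metis
  then show ?thesis using assms(2) unfolding connects_def by (metis (no_types, lifting))
qed

lemma same_shapes_edges:
  assumes "same_shapes d es es'" "set es \<subseteq> edges d UNIV" shows "set es' \<subseteq> edges d UNIV"
  using assms
proof (induction rule: list_all2_induct)
  case (Cons e es e' es')
  have "e \<in> edges d UNIV" using Cons by auto
  then obtain i j \<alpha> where "e = E i j \<alpha>" "i \<noteq> j" "unity_root d \<alpha>" by (rule edges_rootE)
  then have "e' \<in> edges d UNIV" using Cons(1) E_root unfolding same_shape_def by metis
  then show ?case using Cons by auto
qed simp

lemma same_shape_conj:
  assumes "unity_root d w" "e ** D i w = D i w ** e'" "e \<in> edges d UNIV"
  shows "same_shape d e e'" "same_shape d e' e"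
proof -
  have conj: "E k l \<alpha> ** D i w = D i w ** E k l (\<alpha> * (if l = i then w else 1) / (if k = i then w else 1))"
    if "k \<noteq> l" "unity_root d \<alpha>" for k l \<alpha>
    unfolding D_def using that assms(1) E_conj[of id "\<lambda>k. if k = i then w else 1" k l \<alpha>]
    by (auto simp: unity_root_def bij_id split: if_splits)
  have DM: "D i w \<in> Mon d" using assms(1) by (rule D_Mon)
  have r: "unity_root d (\<alpha> * (if l = i then w else 1) / (if k = i then w else 1))" if "unity_root d \<alpha>" for k l \<alpha>
    using that assms(1) by (auto simp: unity_root_simps)
  show "same_shape d e e'" unfolding same_shape_def
  proof (intro allI impI)
    fix k l \<alpha> assume e: "e = E k l \<alpha>" "k \<noteq> l" "unity_root d \<alpha>"
    have "D i w ** e' = D i w ** E k l (\<alpha> * (if l = i then w else 1) / (if k = i then w else 1))"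
      using conj[OF e(2,3)] e(1) assms(2) by simp
    then show "\<exists>\<beta>. unity_root d \<beta> \<and> e' = E k l \<beta>" using Mon_cancel_left[OF DM] r e(3) by blast
  qed
  show "same_shape d e' e" unfolding same_shape_def
  proof (intro allI impI)
    fix k l \<alpha> assume e: "e' = E k l \<alpha>" "k \<noteq> l" "unity_root d \<alpha>"
    let ?\<beta> = "\<alpha> * (if k = i then w else 1) / (if l = i then w else 1)"
    have rb: "unity_root d ?\<beta>" using e assms(1) by (auto simp: unity_root_simps)
    have "?\<beta> * (if l = i then w else 1) / (if k = i then w else 1) = \<alpha>"
      using assms(1) by (auto simp: unity_root_def)
    then have "E k l ?\<beta> ** D i w = e ** D i w" using conj[OF e(2) rb] e(1) assms(2) by simp
    then show "\<exists>\<beta>. unity_root d \<beta> \<and> e = E k l \<beta>" using Mon_cancel_right[OF DM] rb by metis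
  qed
qed

text \<open>The loop crosses unchanged and the edges take the conjugation by a diagonal
  matrix.\<close>

lemma hz_loop_left:
  assumes "set es \<subseteq> edges d UNIV" "unity_root d w"
  shows "\<exists>es'. es @ [D i w] \<sim> D i w # es' \<and> same_shapes d es es'"
  using assms(1)
proof (induction es)
  case (Cons e es)
  then obtain es' where es': "es @ [D i w] \<sim> D i w # es'" "same_shapes d es es'" by auto
  have e: "e \<in> edges d UNIV" using Cons by auto
  obtain e' where e': "e ** D i w = D i w ** e'" using edge_conj_Mon[OF e D_Mon[OF assms(2)]] by blast
  have "(e # es) @ [D i w] \<sim> e # D i w # es'" using hz_Cons[OF es'(1)] by simp
  also have "\<dots> \<sim> D i w # e' # es'" by (rule hz_move0[OF e'])
  finally show ?case using es'(2) same_shape_conj(1)[OF assms(2) e' e] by blast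
qed (intro exI[of _ "[]"], simp)

lemma hz_loop_right:
  assumes "set es \<subseteq> edges d UNIV" "unity_root d w"
  shows "\<exists>es'. D i w # es \<sim> es' @ [D i w] \<and> same_shapes d es es'"
  using assms(1)
proof (induction es)
  case (Cons e es)
  then obtain es' where es': "D i w # es \<sim> es' @ [D i w]" "same_shapes d es es'" by auto
  have e: "e \<in> edges d UNIV" using Cons by auto
  obtain e' where e': "e' \<in> edges d UNIV" "e' ** D i w = D i w ** e"
    using edge_conj_Mon'[OF e D_Mon[OF assms(2)]] by blast
  have "D i w # e # es \<sim> e' # D i w # es" by (rule hz_sym[OF hz_move0[OF e'(2)]])
  also have "\<dots> \<sim> (e' # es') @ [D i w]" using hz_Cons[OF es'(1)] by simp
  finally show ?case using es'(2) same_shape_conj(2)[OF assms(2) e'(2,1)] by blast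
qed (intro exI[of _ "[]"], simp)

text \<open>The loop is carried right until it stands before an edge from \<open>k\<close> to
  \<open>l\<close>, crosses that edge by being conjugated itself, which moves it from
  \<open>k\<close> to \<open>l\<close>, and returns to the front. By connectivity it reaches
  \<open>x\<close>; its weight never changes.\<close>

lemma hz_loop_to:
  assumes "connects d es" "set es \<subseteq> edges d UNIV" "unity_root d w"
  shows "\<exists>es'. D i w # es \<sim> D x w # es' \<and> same_shapes d es es'"
proof -
  define S where "S = {k. \<exists>es'. D i w # es \<sim> D k w # es' \<and> same_shapes d es es'}"
  have "x \<in> S"
  proof (rule connectsD[OF assms(1)])
    show "i \<in> S" unfolding S_def using hz_refl same_shapes_refl by blast
  next
    fix k l \<alpha> assume e: "E k l \<alpha> \<in> set es" "k \<noteq> l" "unity_root d \<alpha>" and k: "k \<in> S"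
    obtain es' where es': "D i w # es \<sim> D k w # es'" "same_shapes d es es'" using k by (auto simp: S_def)
    obtain us e' vs where sp: "es' = us @ e' # vs" "same_shape d (E k l \<alpha>) e'"
    proof -
      obtain n where n: "n < length es" "es ! n = E k l \<alpha>" using e(1) by (auto simp: in_set_conv_nth)
      have "n < length es'" "same_shape d (es ! n) (es' ! n)"
        using es'(2) n by (auto simp: list_all2_conv_all_nth)
      then show ?thesis using that[of "take n es'" "es' ! n" "drop (Suc n) es'"] n(2) id_take_nth_drop by metis
    qed
    obtain \<beta> where \<beta>: "unity_root d \<beta>" "e' = E k l \<beta>" using sp(2) e unfolding same_shape_def by blast
    have ed: "set es' \<subseteq> edges d UNIV" using same_shapes_edges es'(2) assms(2) by blast
    have edus: "set us \<subseteq> edges d UNIV" "e' \<in> edges d UNIV" using ed sp by auto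
    obtain us' where us': "D k w # us \<sim> us' @ [D k w]" "same_shapes d us us'"
      using hz_loop_right[OF edus(1) assms(3), of k] by blast
    have conj: "D k w ** e' = e' ** D l w"
      using D_conj[of "tr k l" "\<lambda>i. if i = k then \<beta> else if i = l then inverse \<beta> else 1" k w] \<beta> e(2)
      unfolding \<beta>(2) E_def by (auto simp: unity_root_def split: if_splits)
    have edus': "set (us' @ [e']) \<subseteq> edges d UNIV" using same_shapes_edges[OF us'(2) edus(1)] edus(2) by auto
    obtain ws where ws: "(us' @ [e']) @ [D l w] \<sim> D l w # ws" "same_shapes d (us' @ [e']) ws"
      using hz_loop_left[OF edus' assms(3), of l] by blast
    have "D i w # es \<sim> D k w # us @ e' # vs" using es'(1) sp(1) by simp
    also have "\<dots> \<sim> us' @ D k w # e' # vs" using hz_append_right[OF us'(1), of "e' # vs"] by simp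
    also have "\<dots> \<sim> us' @ e' # D l w # vs" by (rule hz_move[OF conj])
    also have "\<dots> \<sim> D l w # ws @ vs" using hz_append_right[OF ws(1), of vs] by simp
    finally have 1: "D i w # es \<sim> D l w # ws @ vs" .
    have "same_shapes d (us @ [e']) ws"
      by (rule same_shapes_trans[OF _ ws(2)]) (simp add: us'(2) same_shape_refl list_all2_appendI)
    then have "same_shapes d ((us @ [e']) @ vs) (ws @ vs)"
      by (rule list_all2_appendI) (rule same_shapes_refl)
    then have "same_shapes d es (ws @ vs)" using same_shapes_trans[OF es'(2)] sp(1) by simp
    then show "l \<in> S" using 1 by (auto simp: S_def)
  qed
  then show ?thesis by (auto simp: S_def)
qed

lemma D_commute: "D i u ** D j v = D j v ** D i u"
  unfolding D_def M_mult by (intro M_cong) auto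

text \<open>Relocating one loop alters the weights of the edges, so connectivity has to be
  transferred to the new edges before the next loop is treated.\<close>

lemma hz_collect_loops:
  assumes "connects d es" "set es \<subseteq> edges d UNIV" "\<And>i w. (i, w) \<in> set iws \<Longrightarrow> unity_root d w"
  shows "\<exists>es'. map (\<lambda>(i, w). D i w) iws @ es \<sim> map (D x) (map snd iws) @ es' \<and> same_shapes d es es'"
  using assms(3)
proof (induction iws)
  case Nil
  show ?case by (intro exI[of _ es]) (simp add: same_shapes_refl)
next
  case (Cons iw iws)
  obtain i w where iw: "iw = (i, w)" by force
  let ?ds = "map (D x) (map snd iws)"
  obtain es' where es': "map (\<lambda>(i, w). D i w) iws @ es \<sim> ?ds @ es'" "same_shapes d es es'"
    using Cons.IH Cons.prems by (metis list.set_intros(2))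
  obtain es'' where es'': "D i w # es' \<sim> D x w # es''" "same_shapes d es' es''"
    using hz_loop_to[OF same_shapes_connects[OF es'(2) assms(1)] same_shapes_edges[OF es'(2) assms(2)]]
      Cons.prems iw by (metis list.set_intros(1))
  have perm: "D j w # ?ds \<sim> ?ds @ [D j w]" for j
    by (rule hz_permute_commuting) (auto simp: D_commute)
  have "D i w # map (\<lambda>(i, w). D i w) iws @ es \<sim> D i w # ?ds @ es'" by (rule hz_Cons[OF es'(1)])
  also have "\<dots> \<sim> ?ds @ D i w # es'" using hz_append_right[OF perm[of i], of es'] by simp
  also have "\<dots> \<sim> ?ds @ D x w # es''" by (rule hz_append_left[OF es''(1)])
  also have "\<dots> \<sim> D x w # ?ds @ es''" using hz_append_right[OF hz_sym[OF perm[of x]], of es''] by simp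
  finally show ?case using same_shapes_trans[OF es'(2) es''(2)] by (auto simp: iw)
qed

lemma hz_loops_first:
  assumes "set ts \<subseteq> edges d UNIV \<union> {D i w | i w. unity_root d w \<and> w \<noteq> 1}"
  shows "\<exists>iws es. ts \<sim> map (\<lambda>(i, w). D i w) iws @ es \<and> set es \<subseteq> edges d UNIV \<and>
    (\<forall>(i, w) \<in> set iws. unity_root d w \<and> w \<noteq> 1)"
  using assms
proof (induction ts)
  case Nil
  then show ?case by (intro exI[of _ "[]"]) auto
next
  case (Cons t ts)
  then obtain iws es where IH: "ts \<sim> map (\<lambda>(i, w). D i w) iws @ es" "set es \<subseteq> edges d UNIV"
    "\<forall>(i, w) \<in> set iws. unity_root d w \<and> w \<noteq> 1" by auto
  consider i w where "t = D i w" "unity_root d w" "w \<noteq> 1" | "t \<in> edges d UNIV" using Cons.prems by auto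
  then show ?case
  proof cases
    case 1
    then show ?thesis using hz_Cons[OF IH(1), of t] IH by (intro exI[of _ "(i, w) # iws"] exI[of _ es]) auto
  next
    case 2
    let ?ds = "map (\<lambda>(i, w). D i w) iws"
    have "\<exists>e'\<in>edges d UNIV. t # ?ds \<sim> ?ds @ [e']"
    proof (rule hz_move_right[OF 2])
      fix e y :: "complex ^ 'a ^ 'a" assume e: "e \<in> edges d UNIV" "y \<in> set ?ds"
      then have "y \<in> Mon d" using IH(3) D_Mon by fastforce
      then show "\<exists>e'\<in>edges d UNIV. e ** y = y ** e'" using edge_conj_Mon[OF e(1)] by metis
    qed
    then obtain e' where e': "e' \<in> edges d UNIV" "t # ?ds \<sim> ?ds @ [e']" by blast
    have "t # ts \<sim> t # ?ds @ es" by (rule hz_Cons[OF IH(1)])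
    also have "\<dots> \<sim> ?ds @ e' # es" using hz_append_right[OF e'(2), of es] by simp
    finally show ?thesis using IH e'(1) by (intro exI[of _ iws] exI[of _ "e' # es"]) auto
  qed
qed

section \<open>Reflections and their hyperplanes\<close>

lemma carrier_full: "carrier (monomial_group d 1) = (Mon d :: (complex ^ 'n ^ 'n) set)"
proof
  show "carrier (monomial_group d 1) \<subseteq> (Mon d :: (complex ^ 'n ^ 'n) set)"
  proof
    fix A :: "complex ^ 'n ^ 'n" assume "A \<in> carrier (monomial_group d 1)"
    then show "A \<in> Mon d" by (rule carrier_monomial_groupE) (unfold Mon_def M_def, auto)
  qed
  show "(Mon d :: (complex ^ 'n ^ 'n) set) \<subseteq> carrier (monomial_group d 1)"
  proof
    fix A :: "complex ^ 'n ^ 'n" assume "A \<in> Mon d"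
    then obtain p a where "A = M p a" "bij p" "\<And>i. a i \<noteq> 0" "\<And>i. a i ^ d = 1" by (rule MonE) blast
    then show "A \<in> carrier (monomial_group d 1)"
      unfolding M_def by (auto intro!: carrier_monomial_groupI simp: prod_power_distrib)
  qed
qed

lemma M_mem_carrier_special:
  assumes "bij p" "\<forall>i. a i \<noteq> 0"
  shows "M p a \<in> carrier (monomial_group 1 d) \<longleftrightarrow> (\<forall>i. a i ^ d = 1) \<and> (\<Prod>i\<in>UNIV. a i) = 1"
proof
  assume "M p a \<in> carrier (monomial_group 1 d)"
  then obtain q b where q: "M p a = M q b" "\<And>i. b i ^ d = 1" "(\<Prod>i\<in>UNIV. b i) = 1"
    unfolding M_def by (rule carrier_monomial_groupE) simp
  have "a = b" using M_weight_eq[OF q(1) assms(2)] .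
  then show "(\<forall>i. a i ^ d = 1) \<and> (\<Prod>i\<in>UNIV. a i) = 1" using q by simp
next
  assume "(\<forall>i. a i ^ d = 1) \<and> (\<Prod>i\<in>UNIV. a i) = 1"
  then show "M p a \<in> carrier (monomial_group 1 d)"
    unfolding M_def using assms by (intro carrier_monomial_groupI) auto
qed

lemma carrier_special_Mon: "carrier (monomial_group 1 d) \<subseteq> Mon d"
proof
  fix A :: "complex ^ 'a ^ 'a" assume "A \<in> carrier (monomial_group 1 d)"
  then show "A \<in> Mon d" by (rule carrier_monomial_groupE) (unfold Mon_def M_def, auto)
qed

lemma edges_special: "edges d UNIV \<subseteq> carrier (monomial_group 1 d)"
proof
  fix e :: "complex ^ 'a ^ 'a" assume "e \<in> edges d UNIV"
  then obtain i j \<alpha> where e: "e = E i j \<alpha>" "i \<noteq> j" "unity_root d \<alpha>" by (rule edges_rootE)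
  let ?a = "\<lambda>k. if k = i then \<alpha> else if k = j then inverse \<alpha> else 1"
  have "(\<Prod>k\<in>UNIV. ?a k) = (\<Prod>k\<in>{i, j}. ?a k)"
    by (rule prod.mono_neutral_right) auto
  also have "\<dots> = 1" using e by (simp add: unity_root_simps)
  finally show "e \<in> carrier (monomial_group 1 d)" unfolding e(1) E_def
    using e by (subst M_mem_carrier_special) (auto simp: unity_root_def power_inverse split: if_splits)
qed

lemma D_special: "unity_root d w \<Longrightarrow> D i w \<in> carrier (monomial_group 1 d) \<longleftrightarrow> w = 1"
proof -
  assume w: "unity_root d w"
  have "(\<Prod>k\<in>UNIV. if k = i then w else 1) = w" by (subst prod.delta) auto
  then show ?thesis unfolding D_def using w
    by (subst M_mem_carrier_special) (auto simp: unity_root_def bij_id split: if_splits)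
qed

text \<open>\<open>c = 0\<close> is allowed and gives the coordinate hyperplane.\<close>

definition plane :: "'n \<Rightarrow> 'n \<Rightarrow> complex \<Rightarrow> (complex ^ 'n) set" where
  "plane i j c = {v. v $ i = c * v $ j}"

lemma subspace_plane: "vec.subspace (plane i j c)"
  by (rule vec.subspaceI) (auto simp: plane_def algebra_simps)

lemma dim_plane:
  fixes i j :: "'n::finite"
  assumes "i \<noteq> j" shows "vec.dim (plane i j c) = CARD('n) - 1"
proof -
  let ?S = "plane i j c" and ?x = "axis i 1 :: complex ^ 'n"
  have span: "vec.span ?S = ?S" using subspace_plane by (rule vec.span_eq_iff[THEN iffD2])
  have x: "?x \<notin> ?S" using assms by (auto simp: plane_def axis_def)
  have "v \<in> vec.span (insert ?x ?S)" for v
  proof -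
    have "v - (v $ i - c * v $ j) *s ?x \<in> ?S" using assms by (simp add: plane_def axis_def)
    then show ?thesis unfolding vec.span_insert span by blast
  qed
  then have "vec.span (insert ?x ?S) = UNIV" by auto
  then have "vec.dim (insert ?x ?S) = CARD('n)" by (metis vec.dim_span vec_dim_card)
  then show ?thesis using x by (simp add: vec.dim_insert span)
qed

lemma fixed_space_M: "fixed_space (M p a) = {v. \<forall>i. a i * v $ p i = v $ i}"
  by (auto simp: fixed_space_def vec_eq_iff M_vec)

lemma subspace_fixed_space: "vec.subspace (fixed_space A)"
  by (rule vec.subspaceI)
    (auto simp: fixed_space_def matrix_vector_right_distrib vector_scalar_commute)

lemma fixed_space_E:
  assumes "i \<noteq> j" "\<alpha> \<noteq> 0" shows "fixed_space (E i j \<alpha>) = plane i j \<alpha>"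
proof -
  have "(\<forall>k. (if k = i then \<alpha> else if k = j then inverse \<alpha> else 1) * v $ tr i j k = v $ k)
      \<longleftrightarrow> v $ i = \<alpha> * v $ j" (is "?l = ?r") for v :: "complex ^ 'a"
  proof
    assume ?l
    from this[rule_format, of i] show ?r by simp
  next
    assume ?r
    then show ?l using assms by (auto simp: Transposition.transpose_def)
  qed
  then show ?thesis by (simp add: E_def fixed_space_M plane_def)
qed

lemma fixed_space_D:
  assumes "w \<noteq> 1" shows "fixed_space (D i w) = plane i j 0"
  using assms by (auto simp: D_def fixed_space_M plane_def)

lemma is_reflection_E: "i \<noteq> j \<Longrightarrow> \<alpha> \<noteq> 0 \<Longrightarrow> is_reflection (E i j \<alpha>)"
  by (simp add: is_reflection_def fixed_space_E dim_plane)

lemma is_reflection_D: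
  fixes i :: "'n::finite"
  assumes "w \<noteq> 1" "CARD('n) \<ge> 2" shows "is_reflection (D i w)"
proof -
  obtain j where "i \<noteq> j" using ex_card[OF assms(2)] by (metis (full_types) card_2_iff')
  then show ?thesis by (simp add: is_reflection_def fixed_space_D[OF assms(1), of i j] dim_plane)
qed

lemma fixed_space_eq_plane:
  assumes "is_reflection A" "fixed_space A \<subseteq> plane i j c" "i \<noteq> j"
  shows "fixed_space A = plane i j c"
  using assms dim_plane[OF assms(3), of c]
  by (intro vec.subspace_dim_equal subspace_fixed_space subspace_plane) (auto simp: is_reflection_def)

lemma axis_plane: "k \<noteq> i \<Longrightarrow> k \<noteq> j \<Longrightarrow> axis k 1 \<in> plane i j c"
  by (simp add: plane_def axis_def)

text \<open>A single row in which \<open>A\<close> differs from the identity confines the fixed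
  space to a hyperplane, which it fills by dimension. The coordinate vectors in this hyperplane are
  then fixed, which determines all rows but at most two.\<close>

lemma reflection_cases:
  fixes A :: "complex ^ 'n ^ 'n"
  assumes A: "A \<in> Mon d" "is_reflection A" and n: "CARD('n) \<ge> 2"
  shows "A \<in> edges d UNIV \<or> (\<exists>i w. unity_root d w \<and> w \<noteq> 1 \<and> A = D i w)"
proof -
  obtain p a where pa: "A = M p a" "bij p" "\<And>i. a i \<noteq> 0" "\<And>i. a i ^ d = 1"
    using A(1) by (rule MonE) blast
  note fs = fixed_space_M[of p a, folded pa(1)]
  have fixed: "p k = k \<and> a k = 1" if "axis k 1 \<in> fixed_space A" for k
  proof -
    have "a k * (axis k 1 :: complex ^ 'n) $ p k = 1" using that unfolding fs by (simp add: axis_def)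
    then show ?thesis by (auto simp: axis_def split: if_splits)
  qed
  show ?thesis
  proof (cases "\<exists>i. p i \<noteq> i")
    case True
    then obtain i where i: "p i \<noteq> i" by blast
    have eq: "fixed_space A = plane i (p i) (a i)"
      using i by (intro fixed_space_eq_plane A) (auto simp: fs plane_def)
    have other: "p k = k \<and> a k = 1" if "k \<noteq> i" "k \<noteq> p i" for k
      using fixed axis_plane[OF that] eq by blast
    have ppi: "p (p i) = i"
      using other[of "p (p i)"] i pa(2) by (metis bij_def injD)
    \<comment> \<open>A vector of the hyperplane supported on \<open>i\<close> and
      \<open>p i\<close>; row \<open>p i\<close> of the equation for fixed vectors yields the
      remaining weight.\<close>
    let ?v = "a i *s axis i 1 + axis (p i) 1 :: complex ^ 'n"
    have "?v \<in> fixed_space A" unfolding eq plane_def using i by (simp add: axis_def)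
    then have "a (p i) * ?v $ p (p i) = ?v $ p i" unfolding fs by blast
    then have ai: "a (p i) = inverse (a i)" using i pa(3)[of i]
      by (simp add: ppi axis_def field_simps split: if_splits)
    have "A = E i (p i) (a i)" unfolding pa(1) E_def
    proof (rule M_cong)
      show "p = tr i (p i)"
      proof
        fix k show "p k = tr i (p i) k"
          using other[of k] ppi by (cases "k = i"; cases "k = p i") auto
      qed
      show "a k = (if k = i then a i else if k = p i then inverse (a i) else 1)" for k
        using other[of k] ai by auto
    qed
    then show ?thesis using i pa(3,4) by (auto intro: edgesI)
  next
    case False
    then have p: "p = id" by auto
    have "\<exists>i. a i \<noteq> 1"
    proof (rule ccontr)
      assume "\<nexists>i. a i \<noteq> 1"
      then have "fixed_space A = UNIV" by (auto simp: fs p)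
      then have "vec.dim (fixed_space A) = CARD('n)" by (simp only: vec_dim_card)
      then show False using A(2) n by (simp add: is_reflection_def)
    qed
    then obtain i where i: "a i \<noteq> 1" by blast
    obtain j where j: "i \<noteq> j" using ex_card[OF n] by (metis (full_types) card_2_iff')
    have "fixed_space A = plane i j 0"
      using j i by (intro fixed_space_eq_plane A) (auto simp: fs plane_def p)
    moreover have "axis k 1 \<in> plane i j 0" if "k \<noteq> i" for k using that by (simp add: plane_def axis_def)
    ultimately have "a k = 1" if "k \<noteq> i" for k using fixed that by blast
    then have "A = D i (a i)" unfolding pa(1) D_def p by (intro M_cong) auto
    then show ?thesis using i pa(3,4) by (auto simp: unity_root_def)
  qed
qed

definition diag_reflections :: "nat \<Rightarrow> (complex ^ 'n ^ 'n) set" where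
  "diag_reflections d = {D i w | i w. unity_root d w \<and> w \<noteq> 1}"

lemma edge_is_reflection: "e \<in> edges d UNIV \<Longrightarrow> is_reflection e"
  by (auto elim: edgesE intro: is_reflection_E)

lemma reflections_full:
  assumes "CARD('n) \<ge> 2"
  shows "reflections (monomial_group d 1) = edges d UNIV \<union> (diag_reflections d :: (complex ^ 'n ^ 'n) set)"
proof (intro equalityI subsetI)
  fix t :: "complex ^ 'n ^ 'n" assume "t \<in> reflections (monomial_group d 1)"
  then show "t \<in> edges d UNIV \<union> diag_reflections d"
    unfolding reflections_def carrier_full diag_reflections_def
    using reflection_cases[OF _ _ assms, of t d] by blast
next
  fix t :: "complex ^ 'n ^ 'n" assume "t \<in> edges d UNIV \<union> diag_reflections d"
  then show "t \<in> reflections (monomial_group d 1)"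
    unfolding reflections_def carrier_full diag_reflections_def
    using edges_Mon[of d UNIV] edge_is_reflection D_Mon is_reflection_D[OF _ assms] by auto
qed

lemma reflections_special:
  assumes "CARD('n) \<ge> 2"
  shows "reflections (monomial_group 1 d) = (edges d UNIV :: (complex ^ 'n ^ 'n) set)"
proof
  show "(edges d UNIV :: (complex ^ 'n ^ 'n) set) \<subseteq> reflections (monomial_group 1 d)"
    unfolding reflections_def using edges_special[of d] edge_is_reflection by blast
  show "reflections (monomial_group 1 d) \<subseteq> (edges d UNIV :: (complex ^ 'n ^ 'n) set)"
  proof
    fix t :: "complex ^ 'n ^ 'n" assume t: "t \<in> reflections (monomial_group 1 d)"
    then have "t \<in> Mon d" "is_reflection t" using carrier_special_Mon[of d] by (auto simp: reflections_def)
    then consider "t \<in> edges d UNIV" | i w where "unity_root d w" "w \<noteq> 1" "t = D i w"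
      using reflection_cases[OF _ _ assms] by blast
    then show "t \<in> edges d UNIV"
      by cases (use t D_special in \<open>auto simp: reflections_def\<close>)
  qed
qed

subsection \<open>Counting\<close>

lemma card_roots: "d > 0 \<Longrightarrow> card {w. unity_root d w} = d" "d > 0 \<Longrightarrow> finite {w. unity_root d w}"
proof -
  assume d: "d > 0"
  have "{w. unity_root d w} = {w. w ^ d = 1}" using d by (auto simp: unity_root_def zero_power)
  then show "card {w. unity_root d w} = d" "finite {w. unity_root d w}"
    using card_roots_unity_eq[OF d] finite_roots_unity[of d] d by auto
qed

text \<open>The coordinate vectors outside a plane with nonzero coefficient are those of its two
  coordinates, so the plane recovers them.\<close>

lemma plane_inject:
  assumes eq: "plane i j \<alpha> = plane i' j' \<beta>" and "i \<noteq> j" "i' \<noteq> j'" "\<alpha> \<noteq> 0"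
  shows "{i, j} \<subseteq> {i', j'}" "i = i' \<Longrightarrow> j = j' \<Longrightarrow> \<alpha> = \<beta>"
proof -
  have "axis k 1 \<notin> plane i j \<alpha>" if "k \<in> {i, j}" for k
    using that assms(2,4) by (auto simp: plane_def axis_def)
  moreover have "axis k 1 \<in> plane i' j' \<beta>" if "k \<notin> {i', j'}" for k
    using that by (auto intro: axis_plane)
  ultimately show "{i, j} \<subseteq> {i', j'}" unfolding eq by blast
  show "\<alpha> = \<beta>" if "i = i'" "j = j'"
  proof -
    have "\<alpha> *s axis i 1 + axis j 1 \<in> plane i j \<alpha>" using assms(2) by (simp add: plane_def axis_def)
    then show ?thesis unfolding eq using that assms(2) by (simp add: plane_def axis_def)
  qed
qed

lemma card_edges:
  assumes d: "d > 0"
  shows "card (fixed_space ` (edges d UNIV :: (complex ^ 'n ^ 'n) set)) = card (edges d UNIV :: (complex ^ 'n ^ 'n) set)"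
    and "2 * card (edges d UNIV :: (complex ^ 'n ^ 'n) set) = CARD('n) * (CARD('n) - 1) * d"
    and "finite (edges d UNIV :: (complex ^ 'n ^ 'n) set)"
proof -
  \<comment> \<open>An auxiliary order on the indices: it selects one of the two orientations of
    each edge, so that no edge is counted twice.\<close>
  obtain h :: "'n \<Rightarrow> nat" where h: "inj h" using finite_imp_inj_to_nat_seg[of "UNIV :: 'n set"] by auto
  let ?N = "{(i, j). h i < h j}"
  define T where "T = ?N \<times> {w. unity_root d w}"
  let ?E = "\<lambda>((i, j), \<alpha>). E i j \<alpha>" and ?P = "\<lambda>((i, j), \<alpha>). plane i j \<alpha>"
  have ET: "edges d UNIV = ?E ` T"
  proof
    show "edges d UNIV \<subseteq> ?E ` T"
    proof
      fix e :: "complex ^ 'n ^ 'n" assume "e \<in> edges d UNIV"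
      then obtain i j \<alpha> where e: "e = E i j \<alpha>" "i \<noteq> j" "unity_root d \<alpha>" by (rule edges_rootE)
      consider "h i < h j" | "h j < h i" using e(2) h by (metis injD linorder_neqE_nat)
      then show "e \<in> ?E ` T"
      proof cases
        case 1
        then have "((i, j), \<alpha>) \<in> T" using e by (simp add: T_def)
        then show ?thesis using e(1) by force
      next
        case 2
        then have "((j, i), inverse \<alpha>) \<in> T" using e unity_root_simps(3) by (simp add: T_def)
        then show ?thesis using e(1) E_sym[OF e(2), of \<alpha>] by force
      qed
    qed
    show "?E ` T \<subseteq> edges d UNIV" by (auto simp: T_def intro!: E_root)
  qed
  have PE: "fixed_space (?E x) = ?P x" if "x \<in> T" for x
    using that by (auto simp: T_def unity_root_def intro!: fixed_space_E)
  have inj: "inj_on ?P T"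
  proof (rule inj_onI)
    fix x y assume xy: "x \<in> T" "y \<in> T" "?P x = ?P y"
    obtain i j \<alpha> i' j' \<beta> where x: "x = ((i, j), \<alpha>)" "y = ((i', j'), \<beta>)" by (metis surj_pair)
    have *: "plane i j \<alpha> = plane i' j' \<beta>" "i \<noteq> j" "i' \<noteq> j'" "\<alpha> \<noteq> 0" "h i < h j" "h i' < h j'"
      using xy by (auto simp: x T_def unity_root_def)
    note pl = plane_inject[OF *(1-4)]
    have "i = i' \<and> j = j'" using pl(1) *(2,5,6) by auto
    then show "x = y" using pl(2) x by simp
  qed
  have "inj_on (\<lambda>x. fixed_space (?E x)) T"
    using inj PE by (simp add: inj_on_def)
  then have injE: "inj_on ?E T" unfolding inj_on_def by metis
  have im: "fixed_space ` edges d UNIV = ?P ` T"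
    unfolding ET image_image using PE by (rule image_cong[OF refl])
  show "card (fixed_space ` (edges d UNIV :: (complex ^ 'n ^ 'n) set)) = card (edges d UNIV :: (complex ^ 'n ^ 'n) set)"
    unfolding im using card_image[OF inj] card_image[OF injE] by (simp add: ET)
  have finT: "finite T" unfolding T_def using card_roots(2)[OF d] by simp
  then show "finite (edges d UNIV :: (complex ^ 'n ^ 'n) set)" by (simp add: ET)
  have "card (edges d UNIV :: (complex ^ 'n ^ 'n) set) = card ?N * d"
    using card_image[OF injE] card_roots(1)[OF d] by (simp add: ET T_def card_cartesian_product)
  moreover have "2 * card ?N = CARD('n) * (CARD('n) - 1)"
  proof -
    have "card {(i, j). h j < h i} = card ?N"
      by (rule bij_betw_same_card[of prod.swap]) (auto simp: bij_betw_def inj_on_def image_def)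
    moreover have "card (?N \<union> {(i, j). h j < h i}) = card ?N + card {(i, j). h j < h i}"
      by (rule card_Un_disjoint) auto
    moreover have "?N \<union> {(i, j). h j < h i} = UNIV - range (\<lambda>i. (i, i))"
      using h by (auto simp: inj_eq dest: injD linorder_neqE_nat)
    moreover have "card (UNIV - range (\<lambda>i::'n. (i, i))) = CARD('n) * CARD('n) - CARD('n)"
      by (subst card_Diff_subset) (auto simp: card_image inj_on_def)
    ultimately show ?thesis by (simp add: diff_mult_distrib2)
  qed
  ultimately show "2 * card (edges d UNIV :: (complex ^ 'n ^ 'n) set) = CARD('n) * (CARD('n) - 1) * d" by simp
qed

lemma D_inject: "D i w = D j u \<Longrightarrow> w \<noteq> 0 \<Longrightarrow> w \<noteq> 1 \<Longrightarrow> i = j \<and> w = u"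
  unfolding D_def using M_weight_eq[of id "\<lambda>k. if k = i then w else 1" id "\<lambda>k. if k = j then u else 1"]
  by (metis (no_types, lifting) one_neq_zero)

lemma D_not_edge: "unity_root d w \<Longrightarrow> D i w \<notin> edges d UNIV"
proof
  assume w: "unity_root d w" and "D i w \<in> edges d UNIV"
  then obtain k l \<alpha> where e: "D i w = E k l \<alpha>" "k \<noteq> l" by (auto elim: edges_rootE)
  have "id = tr k l"
    by (rule M_perm_eq[OF e(1)[unfolded D_def E_def]]) (use w in \<open>auto simp: unity_root_def\<close>)
  then show False using e(2) by (metis id_apply transpose_apply_first)
qed

lemma coxeter_number_special:
  assumes "d > 0" "CARD('n) \<ge> 2"
  shows "real (card (reflections (monomial_group 1 d :: (complex ^ 'n ^ 'n) monoid)) +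
      card (reflecting_hyperplanes (monomial_group 1 d :: (complex ^ 'n ^ 'n) monoid))) / real CARD('n)
    = real ((CARD('n) - 1) * d)"
proof -
  have "card (reflections (monomial_group 1 d :: (complex ^ 'n ^ 'n) monoid)) +
      card (reflecting_hyperplanes (monomial_group 1 d :: (complex ^ 'n ^ 'n) monoid)) = CARD('n) * ((CARD('n) - 1) * d)"
    unfolding reflecting_hyperplanes_def reflections_special[OF assms(2)]
    using card_edges[OF assms(1), where 'n = 'n] by simp
  then show ?thesis using assms(2) by (simp del: of_nat_mult add: of_nat_mult[of "CARD('n)"])
qed

text \<open>The edges contribute \<open>n * (n - 1) * d / 2\<close> reflections and as many
  hyperplanes, the loops \<open>n * (d - 1)\<close> reflections but only \<open>n\<close>
  hyperplanes. The sum is \<open>n * n * d\<close>.\<close>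

lemma coxeter_number_full:
  assumes "d \<ge> 2" "CARD('n) \<ge> 2"
  shows "real (card (reflections (monomial_group d 1 :: (complex ^ 'n ^ 'n) monoid)) +
      card (reflecting_hyperplanes (monomial_group d 1 :: (complex ^ 'n ^ 'n) monoid))) / real CARD('n)
    = real (CARD('n) * d)"
proof -
  let ?n = "CARD('n)" and ?Ed = "edges d UNIV :: (complex ^ 'n ^ 'n) set"
  let ?Di = "diag_reflections d :: (complex ^ 'n ^ 'n) set"
  have d: "d > 0" using assms by simp
  define R where "R = {w. unity_root d w} - {1}"
  have R: "finite R" "card R = d - 1" unfolding R_def using card_roots[OF d] by (auto simp: unity_root_simps)
  have Di: "?Di = (\<lambda>(i, w). D i w) ` (UNIV \<times> R)" by (auto simp: diag_reflections_def R_def)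
  have "inj_on (\<lambda>(i, w). D i w) ((UNIV :: 'n set) \<times> R)"
    using D_inject by (fastforce simp: inj_on_def R_def unity_root_def)
  then have cDi: "card ?Di = ?n * (d - 1)" "finite ?Di"
    using R by (auto simp: Di card_image card_cartesian_product)
  have dis: "?Ed \<inter> ?Di = {}" using D_not_edge by (auto simp: diag_reflections_def)
  define Q where "Q i = {v :: complex ^ 'n. v $ i = 0}" for i
  have Qp: "Q i = plane i j 0" for i j by (simp add: Q_def plane_def)
  obtain w where w: "w \<in> R" using R assms(1) by (cases "R = {}") auto
  \<comment> \<open>\<open>plane i j 0\<close> does not depend on \<open>j\<close>, so
    \<open>j = i\<close> serves.\<close>
  have fD: "fixed_space (D i w) = Q i" if "w \<in> R" for i w
    unfolding Qp[of i i] using that by (intro fixed_space_D) (auto simp: R_def)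
  have FDi: "fixed_space ` ?Di = range Q"
  proof
    show "fixed_space ` ?Di \<subseteq> range Q" unfolding Di using fD by auto
    show "range Q \<subseteq> fixed_space ` ?Di" unfolding Di image_image
      using fD[OF w] w by (auto intro!: image_eqI[of _ _ "(_, w)"])
  qed
  have Qax: "axis k 1 \<in> Q i \<longleftrightarrow> k \<noteq> i" for i k by (auto simp: Q_def axis_def)
  have "inj Q" unfolding inj_def using Qax by metis
  then have cQ: "card (fixed_space ` ?Di) = ?n" by (simp add: FDi card_image)
  have disF: "fixed_space ` ?Ed \<inter> fixed_space ` ?Di = {}"
  proof (rule ccontr)
    assume "fixed_space ` ?Ed \<inter> fixed_space ` ?Di \<noteq> {}"
    then obtain e i where e: "e \<in> ?Ed" "fixed_space e = Q i" using FDi by auto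
    then obtain k l \<alpha> where kl: "e = E k l \<alpha>" "k \<noteq> l" "unity_root d \<alpha>" by (auto elim: edges_rootE)
    have eq: "plane k l \<alpha> = Q i" using e(2) kl fixed_space_E[of k l \<alpha>] by (simp add: unity_root_def)
    have "axis k 1 \<notin> Q i" "axis l 1 \<notin> Q i" unfolding eq[symmetric]
      using kl by (auto simp: plane_def axis_def unity_root_def)
    then show False using Qax kl(2) by metis
  qed
  have ce: "2 * card ?Ed = ?n * (?n - 1) * d" "card (fixed_space ` ?Ed) = card ?Ed" "finite ?Ed"
    using card_edges[OF d, where 'n = 'n] by auto
  have "card (?Ed \<union> ?Di) + card (fixed_space ` (?Ed \<union> ?Di)) = card ?Ed + ?n * (d - 1) + (card ?Ed + ?n)"
    unfolding image_Un using card_Un_disjoint[OF ce(3) cDi(2) dis]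
      card_Un_disjoint[OF finite_imageI[OF ce(3)] finite_imageI[OF cDi(2)] disF] ce(2) cDi(1) cQ by simp
  also have "\<dots> = 2 * card ?Ed + ?n * (d - 1 + 1)" by (simp add: algebra_simps)
  also have "\<dots> = ?n * ((?n - 1 + 1) * d)" unfolding ce(1) using d by (simp add: algebra_simps)
  also have "?n - 1 + 1 = ?n" using assms(2) by simp
  finally show ?thesis
    unfolding reflecting_hyperplanes_def reflections_full[OF assms(2)]
    using assms(2) by (simp del: of_nat_mult add: of_nat_mult[of "CARD('n)"])
qed

section \<open>Coxeter elements\<close>

text \<open>The first \<open>d\<close> powers are distinct, and there are only \<open>d\<close>
  roots to be hit.\<close>

lemma root_generator_if_order:
  assumes d: "d > 0" and w: "w ^ d = 1" "\<And>j. w ^ j = 1 \<Longrightarrow> d dvd j"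
  shows "root_generator d w"
proof -
  have w0: "w \<noteq> 0" using w(1) d by (auto simp: zero_power)
  have "k = l" if "k \<le> l" "l < d" "w ^ k = w ^ l" for k l
  proof -
    have "w ^ l = w ^ k * w ^ (l - k)" using that(1) by (simp flip: power_add)
    then have "w ^ (l - k) = 1" using that(3) w0 by simp
    then have "d dvd l - k" by (rule w(2))
    then show ?thesis using that by (auto dest: dvd_imp_le)
  qed
  then have "inj_on (\<lambda>k. w ^ k) {..<d}" by (intro inj_onI) (metis lessThan_iff nle_le)
  then have "card ((\<lambda>k. w ^ k) ` {..<d}) = card {w. unity_root d w}" by (simp add: card_image card_roots[OF d])
  moreover have "(\<lambda>k. w ^ k) ` {..<d} \<subseteq> {w. unity_root d w}"
    using w0 w(1) by (auto simp: unity_root_def simp flip: power_mult) (metis mult.commute power_mult power_one)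
  ultimately have "(\<lambda>k. w ^ k) ` {..<d} = {w. unity_root d w}"
    using card_roots(2)[OF d] by (intro card_subset_eq)
  moreover have "unity_root d \<alpha>" if "\<alpha> ^ d = 1" for \<alpha> using that d by (auto simp: unity_root_def zero_power)
  ultimately show ?thesis unfolding root_generator_def using w(1) by blast
qed

lemma root_not_one: "d \<ge> 2 \<Longrightarrow> \<exists>w. unity_root d w \<and> w \<noteq> 1"
proof (rule ccontr)
  assume d: "d \<ge> 2" and "\<nexists>w. unity_root d w \<and> w \<noteq> 1"
  then have "card {w. unity_root d w} \<le> card {1 :: complex}" by (intro card_mono) auto
  then show False using d card_roots(1)[of d] by simp
qed

section \<open>Powers, eigenvectors and orders of monomial matrices\<close>

lemma pow_M:
  "M p a [^]\<^bsub>monomial_group d e\<^esub> (k :: nat) = M (p ^^ k) (\<lambda>i. \<Prod>m<k. a ((p ^^ m) i))"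
proof (induction k)
  case 0
  then show ?case by (simp add: nat_pow_def monomial_group_def mat_1_eq_M id_def)
next
  case (Suc k)
  have "M p a [^]\<^bsub>monomial_group d e\<^esub> Suc k = M (p ^^ k) (\<lambda>i. \<Prod>m<k. a ((p ^^ m) i)) ** M p a"
    unfolding Suc[symmetric] by (simp add: nat_pow_def monomial_group_def)
  also have "\<dots> = M (p ^^ Suc k) (\<lambda>i. \<Prod>m<Suc k. a ((p ^^ m) i))" unfolding M_mult by (rule M_cong) simp_all
  finally show ?case .
qed

lemma pow_M_id: "M id b [^]\<^bsub>monomial_group d e\<^esub> (k :: nat) = M id (\<lambda>i. b i ^ k)"
proof -
  have "(id ^^ m) = id" for m by (induction m) auto
  then show ?thesis by (simp add: pow_M)
qed

lemma one_monomial_group: "\<one>\<^bsub>monomial_group d e\<^esub> = M id (\<lambda>_. 1)"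
  by (simp add: monomial_group_def mat_1_eq_M)

definition eigen :: "('n \<Rightarrow> 'n) \<Rightarrow> ('n \<Rightarrow> complex) \<Rightarrow> ('n \<Rightarrow> complex) \<Rightarrow> complex \<Rightarrow> bool" where
  "eigen p a v z \<longleftrightarrow> (\<forall>i. a i * v (p i) = z * v i)"

lemma eigenD: "eigen p a v z \<Longrightarrow> a i * v (p i) = z * v i"
  by (simp add: eigen_def)

lemma eigenvector_iterate:
  assumes "eigen p a v z"
  shows "(\<Prod>m<k. a ((p ^^ m) i)) * v ((p ^^ k) i) = z ^ k * v i"
proof (induction k)
  case (Suc k)
  have "(\<Prod>m<Suc k. a ((p ^^ m) i)) * v ((p ^^ Suc k) i)
      = (\<Prod>m<k. a ((p ^^ m) i)) * (a ((p ^^ k) i) * v (p ((p ^^ k) i)))" by simp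
  also have "\<dots> = z * ((\<Prod>m<k. a ((p ^^ m) i)) * v ((p ^^ k) i))" unfolding eigenD[OF assms] by simp
  also have "\<dots> = z ^ Suc k * v i" unfolding Suc by simp
  finally show ?case .
qed simp

text \<open>Multiply the eigenvector equations over \<open>S\<close>, on which \<open>p\<close> is a permutation.\<close>

lemma eigenvalue_power:
  fixes p :: "'n::finite \<Rightarrow> 'n"
  assumes eig: "eigen p a v z" and "bij p" "p ` S \<subseteq> S" and nz: "\<forall>i\<in>S. v i \<noteq> 0"
  shows "(\<Prod>i\<in>S. a i) = z ^ card S"
proof -
  have "inj_on p S" using assms(2) inj_on_subset[of p UNIV S] by (simp add: bij_def)
  then have bij: "bij_betw p S S"
    using assms(3) by (simp add: bij_betw_def endo_inj_surj)
  have "(\<Prod>i\<in>S. a i) * (\<Prod>i\<in>S. v i) = (\<Prod>i\<in>S. a i * v (p i))"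
    using prod.reindex_bij_betw[OF bij, of v] by (simp add: prod.distrib)
  also have "\<dots> = z ^ card S * (\<Prod>i\<in>S. v i)" unfolding eigenD[OF eig] by (simp add: prod.distrib)
  finally show ?thesis using nz by simp
qed

text \<open>The d-th power of the iterated eigenvector equation loses all weights and says that
  \<open>v\<close> has the same d-th power at \<open>i\<close> and at its s-th iterate. Injectivity
  makes the two points equal, and then the accumulated weight must be \<open>z ^ s\<close>.\<close>

lemma iterate_trivial:
  fixes p :: "'n::finite \<Rightarrow> 'n"
  assumes eig: "eigen p a v z" and p: "p ` Y \<subseteq> Y"
    and a: "\<forall>i. a i ^ d = 1" and z: "(z ^ s) ^ d = 1"
    and nz: "\<forall>i\<in>Y. v i \<noteq> 0" and inj: "inj_on (\<lambda>i. v i ^ d) Y" and i: "i \<in> Y"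
  shows "(p ^^ s) i = i" "(\<Prod>m<s. a ((p ^^ m) i)) = z ^ s"
proof -
  note it = eigenvector_iterate[OF eig, where k = s and i = i]
  have "(p ^^ k) i \<in> Y" for k using i p by (induction k) auto
  moreover have "v ((p ^^ s) i) ^ d = v i ^ d"
  proof -
    have "(\<Prod>m<s. a ((p ^^ m) i)) ^ d = 1" by (simp add: prod_power_distrib a)
    then show ?thesis using arg_cong[OF it, of "\<lambda>x. x ^ d"] z by (simp add: power_mult_distrib)
  qed
  ultimately show 1: "(p ^^ s) i = i" using inj i by (auto dest: inj_onD)
  show "(\<Prod>m<s. a ((p ^^ m) i)) = z ^ s" using it nz i unfolding 1 by simp
qed

lemma ord_dvd_iff:
  assumes "M p a \<in> carrier (monomial_group d e)"
  shows "M p a [^]\<^bsub>monomial_group d e\<^esub> (k :: nat) = M id (\<lambda>_. 1) \<longleftrightarrow>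
    group.ord (monomial_group d e) (M p a) dvd k"
  using group.pow_eq_id[OF group_monomial_group assms, of k] by (simp add: one_monomial_group)

lemma ord_dvd_scalar:
  assumes "M p a \<in> carrier (monomial_group d e)" "p ^^ s = id" "\<And>i. (\<Prod>m<s. a ((p ^^ m) i)) ^ j = 1"
  shows "group.ord (monomial_group d e) (M p a) dvd s * j"
proof -
  have "M p a [^]\<^bsub>monomial_group d e\<^esub> (s * j) =
      (M p a [^]\<^bsub>monomial_group d e\<^esub> s) [^]\<^bsub>monomial_group d e\<^esub> j"
    by (simp add: monoid.nat_pow_pow[OF group.is_monoid[OF group_monomial_group] assms(1)])
  also have "\<dots> = M id (\<lambda>i. (\<Prod>m<s. a ((p ^^ m) i)) ^ j)"
    by (subst pow_M) (simp add: assms(2) pow_M_id)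
  also have "\<dots> = M id (\<lambda>_. 1)" by (simp add: assms(3))
  finally show ?thesis using ord_dvd_iff[OF assms(1)] by blast
qed

lemma ord_dvd:
  assumes "M p a \<in> carrier (monomial_group d e)" "p ^^ s = id" "\<And>i. a i ^ r = 1"
  shows "group.ord (monomial_group d e) (M p a) dvd s * r"
  by (rule ord_dvd_scalar[OF assms(1,2)]) (simp add: prod_power_distrib assms(3))

text \<open>This is how regularity enters: equal d-th powers of two coordinates mean that they
  differ by a root of unity, which puts \<open>v\<close> on the hyperplane of an edge.\<close>

lemma not_in_planes_inj:
  assumes d: "d > 0" and v: "\<forall>i j \<alpha>. i \<noteq> j \<longrightarrow> unity_root d \<alpha> \<longrightarrow> v $ i \<noteq> \<alpha> * v $ j"
  shows "inj_on (\<lambda>i. (v $ i) ^ d) Y"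
proof (rule inj_onI, rule ccontr)
  fix i j assume eq: "(v $ i) ^ d = (v $ j) ^ d" and ij: "i \<noteq> j"
  show False
  proof (cases "v $ j = 0")
    case True
    then have "v $ i = 1 * v $ j" using d eq by (simp add: zero_power)
    then show False using v ij unity_root_simps(4) by blast
  next
    case False
    then have "v $ i \<noteq> 0" using d eq by (metis power_eq_0_iff)
    then have "unity_root d (v $ i / v $ j)" using False eq by (simp add: unity_root_def power_divide)
    moreover have "v $ i = (v $ i / v $ j) * v $ j" using False by simp
    ultimately show False using v ij by blast
  qed
qed

text \<open>On a nonempty invariant set \<open>S\<close> the product of the weights is
  \<open>z ^ card S\<close>, a d-th root of unity, so that power of \<open>c\<close> is scalar and
  the order divides \<open>card S * d\<close>. The order is \<open>n * d\<close>, hence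
  \<open>S\<close> is everything. The scalar for the whole index set is the product of all weights
  and must have order exactly \<open>d\<close>.\<close>

lemma coxeter_full:
  fixes c :: "complex ^ 'n ^ 'n"
  assumes d: "d \<ge> 2" and n: "CARD('n) \<ge> 2" and c: "coxeter_element (monomial_group d 1) c"
  obtains p a where "c = M p a" "\<forall>i. a i \<noteq> 0" "cyc p UNIV" "root_generator d (\<Prod>i\<in>UNIV. a i)"
proof -
  let ?G = "monomial_group d 1 :: (complex ^ 'n ^ 'n) monoid"
  have d0: "d > 0" using d by simp
  have "regular_element ?G c" and ord: "group.ord ?G c = CARD('n) * d"
    using c coxeter_number_full[OF d n] unfolding coxeter_element_def by (metis, metis of_nat_eq_iff)
  then obtain v z where cG: "c \<in> carrier ?G" and v: "c *v v = z *s v"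
    "\<And>H. H \<in> reflecting_hyperplanes ?G \<Longrightarrow> v \<notin> H" unfolding regular_element_def by blast
  obtain p a where pa: "c = M p a" "bij p" "\<And>i. a i \<noteq> 0" "\<And>i. a i ^ d = 1"
    using cG unfolding carrier_full by (rule MonE) blast
  have eig': "a i * v $ p i = z * v $ i" for i
    using arg_cong[OF v(1), of "\<lambda>x. x $ i"] unfolding pa(1) M_vec by simp
  then have eig: "eigen p a (($) v) z" by (simp add: eigen_def)
  have ad: "\<forall>i. a i ^ d = 1" using pa(4) by blast
  have Vt: "v \<notin> fixed_space t" if "t \<in> edges d UNIV \<union> diag_reflections d" for t
    using v(2) that unfolding reflecting_hyperplanes_def reflections_full[OF n] by blast
  have vE: "v $ i \<noteq> \<alpha> * v $ j" if "i \<noteq> j" "unity_root d \<alpha>" for i j \<alpha>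
    using Vt[of "E i j \<alpha>"] E_root[OF that] fixed_space_E[of i j \<alpha>] that by (simp add: plane_def unity_root_def)
  obtain w where w: "unity_root d w" "w \<noteq> 1" using root_not_one[OF d] by blast
  have v0: "v $ i \<noteq> 0" for i
    using Vt[of "D i w"] w fixed_space_D[OF w(2), of i i] by (auto simp: plane_def diag_reflections_def)
  have v0': "\<forall>i\<in>UNIV. v $ i \<noteq> 0" using v0 by blast
  have inj: "inj_on (\<lambda>i. (v $ i) ^ d) Y" for Y
    by (rule not_in_planes_inj[OF d0]) (use vE in blast)
  have triv: "p ^^ card S = id" "(\<Prod>m<card S. a ((p ^^ m) i)) = z ^ card S"
    if S: "p ` S \<subseteq> S" for S i
  proof -
    have "(\<Prod>i\<in>S. a i) = z ^ card S" by (rule eigenvalue_power[OF eig pa(2) S]) (use v0 in blast)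
    then have zs: "(z ^ card S) ^ d = 1" using pa(4) by (metis prod_power_distrib prod.neutral)
    show "p ^^ card S = id" using iterate_trivial(1)[OF eig _ ad zs v0' inj] by auto
    show "(\<Prod>m<card S. a ((p ^^ m) i)) = z ^ card S"
      by (rule iterate_trivial(2)[OF eig _ ad zs v0' inj]) auto
  qed
  have cG': "M p a \<in> carrier ?G" using cG pa(1) by simp
  have cyc: "cyc p UNIV" unfolding cyc_def
  proof (intro allI impI)
    fix S assume S: "S \<noteq> {}" "p ` S \<subseteq> S"
    have "CARD('n) * d dvd card S * d" using ord_dvd[OF cG' triv(1)[OF S(2)] pa(4)] ord pa(1) by simp
    moreover have "card S * d > 0" using S d0 by (simp add: card_gt_0_iff)
    ultimately have "CARD('n) \<le> card S" using d0 by (auto dest: dvd_imp_le)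
    then show "S = UNIV" by (intro card_seteq) auto
  qed
  have prod: "(\<Prod>i\<in>UNIV. a i) = z ^ CARD('n)" by (rule eigenvalue_power[OF eig pa(2)]) (use v0 in auto)
  have "root_generator d (\<Prod>i\<in>UNIV. a i)"
  proof (rule root_generator_if_order[OF d0])
    show "(\<Prod>i\<in>UNIV. a i) ^ d = 1" by (simp add: prod_power_distrib pa(4))
  next
    fix j assume j: "(\<Prod>i\<in>UNIV. a i) ^ j = 1"
    have "CARD('n) * d dvd CARD('n) * j"
      using ord_dvd_scalar[OF cG' triv(1)[of UNIV], of j] triv(2)[of UNIV] j ord pa(1) prod by simp
    then show "d dvd j" by simp
  qed
  then show ?thesis using that pa(1,3) cyc by blast
qed

text \<open>If \<open>v\<close> vanishes at a coordinate \<open>f\<close>, the argument for G(d,1,n)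
  works on the other coordinates; as all weights multiply to 1, \<open>a f\<close> is the inverse of
  the scalar obtained there. If no coordinate vanishes, the order divides \<open>n\<close>, which
  leaves only \<open>n = d = 2\<close> and the negative of the identity.\<close>

lemma coxeter_special:
  fixes c :: "complex ^ 'n ^ 'n"
  assumes d: "d \<ge> 2" and n: "CARD('n) \<ge> 2" and c: "coxeter_element (monomial_group 1 d) c"
  obtains p a f where "c = M p a" "\<forall>i. a i \<noteq> 0" "near_cycle d f UNIV p a"
proof -
  let ?G = "monomial_group 1 d :: (complex ^ 'n ^ 'n) monoid"
  have d0: "d > 0" using d by simp
  have "regular_element ?G c" and ord: "group.ord ?G c = (CARD('n) - 1) * d"
    using c coxeter_number_special[OF d0 n] unfolding coxeter_element_def by (metis, metis of_nat_eq_iff)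
  then obtain v z where cG: "c \<in> carrier ?G" and v: "c *v v = z *s v"
    "\<And>H. H \<in> reflecting_hyperplanes ?G \<Longrightarrow> v \<notin> H" unfolding regular_element_def by blast
  obtain p a where pa: "c = M p a" "bij p" "\<And>i. a i \<noteq> 0" "\<And>i. a i ^ d = 1"
    using cG carrier_special_Mon[of d] by (blast elim: MonE)
  have cG': "M p a \<in> carrier ?G" using cG pa(1) by simp
  have prod: "(\<Prod>i\<in>UNIV. a i) = 1" using cG' M_mem_carrier_special[OF pa(2)] pa(3) by blast
  have eig': "a i * v $ p i = z * v $ i" for i
    using arg_cong[OF v(1), of "\<lambda>x. x $ i"] unfolding pa(1) M_vec by simp
  then have eig: "eigen p a (($) v) z" by (simp add: eigen_def)
  have ad: "\<forall>i. a i ^ d = 1" using pa(4) by blast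
  have vE: "v $ i \<noteq> \<alpha> * v $ j" if "i \<noteq> j" "unity_root d \<alpha>" for i j \<alpha>
    using v(2) E_root[OF that] fixed_space_E[of i j \<alpha>] that
    unfolding reflecting_hyperplanes_def reflections_special[OF n] by (auto simp: plane_def unity_root_def)
  have inj: "inj_on (\<lambda>i. (v $ i) ^ d) Y" for Y
    by (rule not_in_planes_inj[OF d0]) (use vE in blast)
  have pinj: "p i = p j \<longleftrightarrow> i = j" for i j using pa(2) by (simp add: bij_def inj_eq)
  show ?thesis
  proof (cases "\<exists>f. v $ f = 0")
    case True
    then obtain f where f: "v $ f = 0" by blast
    let ?Y = "UNIV - {f}"
    \<comment> \<open>Two vanishing coordinates would have equal d-th powers, so \<open>f\<close> is
      the only one.\<close>
    have v0: "v $ i \<noteq> 0" if "i \<in> ?Y" for i using inj_onD[OF inj[of UNIV], of i f] that f d0 by (auto simp: zero_power)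
    have v0': "\<forall>i\<in>?Y. v $ i \<noteq> 0" using v0 by blast
    have "a f * v $ p f = 0" using eig'[of f] f by simp
    then have pf: "p f = f" using v0[of "p f"] pa(3)[of f] by auto
    have pY: "p ` ?Y \<subseteq> ?Y" using pf pinj by fastforce
    have pkf: "(p ^^ k) f = f" for k using pf by (induction k) auto
    have triv: "p ^^ card S = id" "\<And>i. i \<noteq> f \<Longrightarrow> (\<Prod>m<card S. a ((p ^^ m) i)) = z ^ card S"
      if S: "p ` S \<subseteq> S" "S \<subseteq> ?Y" for S
    proof -
      have "(\<Prod>i\<in>S. a i) = z ^ card S" by (rule eigenvalue_power[OF eig pa(2) S(1)]) (use v0 S in blast)
      then have zs: "(z ^ card S) ^ d = 1" using pa(4) by (metis prod_power_distrib prod.neutral)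
      show "p ^^ card S = id"
      proof
        fix i show "(p ^^ card S) i = id i"
          using iterate_trivial(1)[OF eig pY ad zs v0' inj, of i] pkf by (cases "i = f") auto
      qed
      show "(\<Prod>m<card S. a ((p ^^ m) i)) = z ^ card S" if "i \<noteq> f" for i
        by (rule iterate_trivial(2)[OF eig pY ad zs v0' inj]) (use that in auto)
    qed
    have cyc: "cyc p ?Y" unfolding cyc_def
    proof (intro allI impI)
      fix S assume S: "S \<subseteq> ?Y" "S \<noteq> {}" "p ` S \<subseteq> S"
      have fin: "finite S" by simp
      have "(CARD('n) - 1) * d dvd card S * d"
        using ord_dvd[OF cG' triv(1)[OF S(3,1)] pa(4)] ord pa(1) by simp
      moreover have "card S * d > 0" using S(2) d0 by (simp add: card_gt_0_iff)
      ultimately have "card ?Y \<le> card S" using d0 by (auto dest: dvd_imp_le)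
      then show "S = ?Y" using S(1) by (intro card_seteq) auto
    qed
    have "(\<Prod>i\<in>?Y. a i) = z ^ card ?Y" by (rule eigenvalue_power[OF eig pa(2) pY v0'])
    then have afz: "a f * z ^ (CARD('n) - 1) = 1" using prod by (subst (asm) prod.remove[of _ f]) auto
    have key: "d dvd j" if j: "a f ^ j = 1" for j
    proof -
      have zj: "(z ^ (CARD('n) - 1)) ^ j = 1" using arg_cong[OF afz, of "\<lambda>x. x ^ j"] j by (simp add: power_mult_distrib)
      have "(\<Prod>m<CARD('n) - 1. a ((p ^^ m) i)) ^ j = 1" for i
      proof (cases "i = f")
        case True
        then show ?thesis by (simp add: pkf) (metis j mult.commute power_mult power_one)
      next
        case False
        then show ?thesis using triv(2)[OF pY] zj by simp
      qed
      then have "(CARD('n) - 1) * d dvd (CARD('n) - 1) * j"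
        using ord_dvd_scalar[OF cG', of "CARD('n) - 1" j] triv(1)[OF pY] ord pa(1) by simp
      then show ?thesis using n by simp
    qed
    have "root_generator d (a f)" by (rule root_generator_if_order[OF d0 pa(4) key])
    moreover have "a f \<noteq> 1" using key[of 1] d by auto
    moreover have "(UNIV :: 'n set) \<noteq> {f}"
    proof
      assume "(UNIV :: 'n set) = {f}"
      then have "CARD('n) = card {f}" by (rule arg_cong)
      then show False using n by simp
    qed
    ultimately have "near_cycle d f UNIV p a" using cyc pf by (simp add: near_cycle_def)
    then show ?thesis using that[OF pa(1)] pa(3) by blast
  next
    case False
    then have v0: "v $ i \<noteq> 0" for i by blast
    then have v0': "\<forall>i\<in>UNIV. v $ i \<noteq> 0" by blast
    have zn: "z ^ CARD('n) = 1" using eigenvalue_power[OF eig pa(2) _ v0'] prod by simp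
    then have zs: "(z ^ CARD('n)) ^ d = 1" by simp
    have "p ^^ CARD('n) = id" using iterate_trivial(1)[OF eig _ ad zs v0' inj] by auto
    moreover have "(\<Prod>m<CARD('n). a ((p ^^ m) i)) = 1" for i
      using iterate_trivial(2)[OF eig _ ad zs v0' inj] zn by auto
    ultimately have "(CARD('n) - 1) * d dvd CARD('n)"
      using ord_dvd_scalar[OF cG', of "CARD('n)" 1] ord pa(1) by simp
    then have "(CARD('n) - 1) * d \<le> CARD('n)" by (intro dvd_imp_le) auto
    moreover have "(CARD('n) - 1) * 2 \<le> (CARD('n) - 1) * d" using d by simp
    ultimately have n2: "CARD('n) = 2" using n by linarith
    then have d2: "d = 2" using \<open>(CARD('n) - 1) * d \<le> CARD('n)\<close> d by simp
    obtain f b :: 'n where fb: "UNIV = {f, b}" "f \<noteq> b" using n2 by (auto simp: card_2_iff)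
    have cases: "i = f \<or> i = b" for i using UNIV_I[of i] unfolding fb(1) by blast
    \<comment> \<open>If \<open>p\<close> moved \<open>f\<close> to \<open>b\<close>, squaring the
      eigenvector equation would give the two coordinates of \<open>v\<close> equal squares, against
      regularity.\<close>
    have pf: "p f = f"
    proof (rule ccontr)
      assume "p f \<noteq> f"
      then have "p f = b" using cases by blast
      then have "(a f * v $ b) ^ 2 = (z * v $ f) ^ 2" using eig'[of f] by simp
      then have "(v $ b) ^ d = (v $ f) ^ d"
        using zn pa(4)[of f] by (simp add: power_mult_distrib n2 d2)
      then show False using inj_onD[OF inj[of UNIV], of b f] fb(2) by simp
    qed
    have pb: "p b = b" using cases[of "p b"] pf pinj[of b f] fb(2) by auto
    have p: "p = id"
    proof
      fix i show "p i = id i" using cases[of i] pf pb by auto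
    qed
    have az: "a i = z" for i using eig'[of i] v0[of i] by (simp add: p)
    have key: "d dvd j" if j: "a f ^ j = 1" for j
    proof -
      have "a i ^ j = 1" for i using j by (simp add: az)
      then have "(CARD('n) - 1) * d dvd 1 * j" using ord_dvd[OF cG', of 1 j] ord pa(1) p by simp
      then show ?thesis using n2 by simp
    qed
    have "root_generator d (a f)" by (rule root_generator_if_order[OF d0 pa(4) key])
    moreover have "a f \<noteq> 1" using key[of 1] d by auto
    moreover have "cyc p (UNIV - {f})" using fb by (auto simp: cyc_def)
    moreover have "UNIV \<noteq> {f}" using fb(2) by (metis UNIV_I singletonD)
    ultimately have "near_cycle d f UNIV p a" using pf by (simp add: near_cycle_def)
    then show ?thesis using that[OF pa(1)] pa(3) by blast
  qed
qed

section \<open>Moves, orbits and conjugacy classes\<close>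

lemma mult_monomial_group [simp]: "x \<otimes>\<^bsub>monomial_group d e\<^esub> y = x ** y"
  by (simp add: monomial_group_def)

lemma list_product_eq_mat_prod: "list_product (monomial_group d e) = mat_prod"
  by (simp add: fun_eq_iff list_product_def mat_prod_def monomial_group_def)

lemma monomial_group_inverse:
  fixes b :: "complex ^ 'n ^ 'n"
  assumes "b \<in> carrier (monomial_group d e)"
  shows "b ** inv\<^bsub>monomial_group d e\<^esub> b = mat 1" "inv\<^bsub>monomial_group d e\<^esub> b ** b = mat 1"
proof -
  interpret group "monomial_group d e :: (complex ^ 'n ^ 'n) monoid" by (rule group_monomial_group)
  show "b ** inv\<^bsub>monomial_group d e\<^esub> b = mat 1" "inv\<^bsub>monomial_group d e\<^esub> b ** b = mat 1"
    using r_inv[OF assms] l_inv[OF assms] by (simp_all add: monomial_group_def)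
qed

lemma monomial_group_conj:
  assumes "b \<in> carrier (monomial_group d e)" "a ** b = b ** a'"
  shows "a' = inv\<^bsub>monomial_group d e\<^esub> b ** a ** b" "a = b ** a' ** inv\<^bsub>monomial_group d e\<^esub> b"
proof -
  note bb = monomial_group_inverse[OF assms(1)]
  show "a' = inv\<^bsub>monomial_group d e\<^esub> b ** a ** b"
    using assms(2) bb(2) by (metis matrix_mul_assoc matrix_mul_lid)
  show "a = b ** a' ** inv\<^bsub>monomial_group d e\<^esub> b"
    using assms(2) bb(1) by (metis matrix_mul_assoc matrix_mul_rid)
qed

text \<open>Generator number \<open>i\<close> acts on the list positions \<open>i - 1\<close> and
  \<open>i\<close>, hence the successor of \<open>length xs\<close>.\<close>

lemma hurwitz_letter_at:
  "hurwitz_letter G (Suc (length xs), True) (xs @ a # b # ys) = xs @ b # inv\<^bsub>G\<^esub> b \<otimes>\<^bsub>G\<^esub> a \<otimes>\<^bsub>G\<^esub> b # ys"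
  "hurwitz_letter G (Suc (length xs), False) (xs @ a # b # ys) = xs @ a \<otimes>\<^bsub>G\<^esub> b \<otimes>\<^bsub>G\<^esub> inv\<^bsub>G\<^esub> a # a # ys"
  by (simp_all add: hurwitz_letter_def hurwitz_gen_def hurwitz_gen_inv_def Let_def nth_append list_update_append)

lemma same_hurwitz_orbit_letter:
  assumes "same_hurwitz_orbit G ts us" "1 \<le> i" "i < length us" "length (hurwitz_letter G (i, s) us) = length us"
  shows "same_hurwitz_orbit G ts (hurwitz_letter G (i, s) us)"
proof -
  obtain w where w: "length ts = length us" "w \<in> braid_words (length ts)" "hurwitz_action G w ts = us"
    using assms(1) by (auto simp: same_hurwitz_orbit_def)
  then have "(i, s) # w \<in> braid_words (length ts)" using assms(2,3) by (auto simp: braid_words_def)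
  moreover have "hurwitz_action G ((i, s) # w) ts = hurwitz_letter G (i, s) us"
    using w(3) by (simp add: hurwitz_action_def)
  ultimately show ?thesis unfolding same_hurwitz_orbit_def using w(1) assms(4) by metis
qed

text \<open>The three claims share one induction: only inside the carrier are inverses available,
  and only there does an equation \<open>a ** b = b ** a'\<close> become a letter of the braid word
  and a conjugation in the group.\<close>

lemma hz_imp_same_hurwitz_orbit:
  fixes ts :: "(complex ^ 'n ^ 'n) list"
  assumes "ts \<sim> us" "set ts \<subseteq> carrier (monomial_group d e)"
  shows "set us \<subseteq> carrier (monomial_group d e) \<and> same_hurwitz_orbit (monomial_group d e) ts us \<and>
    image_mset (conjugacy_class (monomial_group d e)) (mset us) =
    image_mset (conjugacy_class (monomial_group d e)) (mset ts)"
  using assms(1)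
proof (induction rule: hz_induct)
  case refl
  have "same_hurwitz_orbit (monomial_group d e) ts ts"
    unfolding same_hurwitz_orbit_def hurwitz_action_def braid_words_def
    by (auto intro: exI[of _ "[]"])
  then show ?case using assms(2) by simp
next
  let ?G = "monomial_group d e :: (complex ^ 'n ^ 'n) monoid"
  interpret group ?G by (rule group_monomial_group)
  have cl: "conjugacy_class ?G (b ** a ** inv\<^bsub>?G\<^esub> b) = conjugacy_class ?G a"
    if "a \<in> carrier ?G" "b \<in> carrier ?G" for a b
  proof -
    have sub: "conjugacy_class ?G (b \<otimes>\<^bsub>?G\<^esub> a \<otimes>\<^bsub>?G\<^esub> inv\<^bsub>?G\<^esub> b) \<subseteq> conjugacy_class ?G a"
      if ab: "a \<in> carrier ?G" "b \<in> carrier ?G" for a b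
    proof
      fix x assume "x \<in> conjugacy_class ?G (b \<otimes>\<^bsub>?G\<^esub> a \<otimes>\<^bsub>?G\<^esub> inv\<^bsub>?G\<^esub> b)"
      then obtain g where g: "g \<in> carrier ?G"
        "x = g \<otimes>\<^bsub>?G\<^esub> (b \<otimes>\<^bsub>?G\<^esub> a \<otimes>\<^bsub>?G\<^esub> inv\<^bsub>?G\<^esub> b) \<otimes>\<^bsub>?G\<^esub> inv\<^bsub>?G\<^esub> g"
        by (auto simp: conjugacy_class_def)
      then have "x = (g \<otimes>\<^bsub>?G\<^esub> b) \<otimes>\<^bsub>?G\<^esub> a \<otimes>\<^bsub>?G\<^esub> inv\<^bsub>?G\<^esub> (g \<otimes>\<^bsub>?G\<^esub> b)"
        using ab by (simp add: inv_mult_group m_assoc del: mult_monomial_group)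
      then show "x \<in> conjugacy_class ?G a" unfolding conjugacy_class_def using g(1) ab by blast
    qed
    let ?a' = "b \<otimes>\<^bsub>?G\<^esub> a \<otimes>\<^bsub>?G\<^esub> inv\<^bsub>?G\<^esub> b"
    have "inv\<^bsub>?G\<^esub> b \<otimes>\<^bsub>?G\<^esub> ?a' \<otimes>\<^bsub>?G\<^esub> inv\<^bsub>?G\<^esub> (inv\<^bsub>?G\<^esub> b) = a"
      using that by (simp add: m_assoc cancel_inv_middle del: mult_monomial_group)
    then have "conjugacy_class ?G ?a' = conjugacy_class ?G a"
      using sub[of a b] sub[of ?a' "inv\<^bsub>?G\<^esub> b"] that m_closed inv_closed by (metis subset_antisym)
    then show ?thesis by simp
  qed
  {
    case (move xs a b a' ys)
    have ab: "a \<in> carrier ?G" "b \<in> carrier ?G" using move(1) by auto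
    have a': "a' = inv\<^bsub>?G\<^esub> b ** a ** b" "a = b ** a' ** inv\<^bsub>?G\<^esub> b"
      using monomial_group_conj[OF ab(2) move(2)] by auto
    have a'c: "a' \<in> carrier ?G" using ab a'(1) m_closed inv_closed by (metis mult_monomial_group)
    have "hurwitz_letter ?G (Suc (length xs), True) (xs @ a # b # ys) = xs @ b # a' # ys"
      unfolding hurwitz_letter_at by (simp add: a'(1))
    then have "same_hurwitz_orbit ?G ts (xs @ b # a' # ys)"
      using same_hurwitz_orbit_letter[of ?G ts "xs @ a # b # ys" "Suc (length xs)" True] move(1) by simp
    moreover have "conjugacy_class ?G a' = conjugacy_class ?G a"
      using cl[OF a'c ab(2)] a'(2) by simp
    ultimately show ?case using move(1) a'c by (auto simp: add_mset_commute)
  next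
    case (unmove xs a b a' ys)
    have ab: "a' \<in> carrier ?G" "b \<in> carrier ?G" using unmove(1) by auto
    have a: "a = b ** a' ** inv\<^bsub>?G\<^esub> b" using monomial_group_conj[OF ab(2) unmove(2)] by auto
    have ac: "a \<in> carrier ?G" using ab a m_closed inv_closed by (metis mult_monomial_group)
    have "hurwitz_letter ?G (Suc (length xs), False) (xs @ b # a' # ys) = xs @ a # b # ys"
      unfolding hurwitz_letter_at by (simp add: a)
    then have "same_hurwitz_orbit ?G ts (xs @ a # b # ys)"
      using same_hurwitz_orbit_letter[of ?G ts "xs @ b # a' # ys" "Suc (length xs)" False] unmove(1) by simp
    moreover have "conjugacy_class ?G a = conjugacy_class ?G a'" using cl[OF ab] a by simp
    ultimately show ?case using unmove(1) ac by (auto simp: add_mset_commute)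
  }
qed

lemma hz_hurwitz_letter:
  assumes "set ts \<subseteq> carrier (monomial_group d e)" "1 \<le> i" "i < length ts"
  shows "ts \<sim> hurwitz_letter (monomial_group d e) (i, s) ts"
proof -
  let ?G = "monomial_group d e"
  define xs where "xs = take (i - 1) ts"
  define ys where "ys = drop (Suc i) ts"
  define a where "a = ts ! (i - 1)"
  define b where "b = ts ! i"
  have ts: "ts = xs @ a # b # ys" unfolding xs_def ys_def a_def b_def
    using assms(2,3) by (metis Cons_nth_drop_Suc One_nat_def Suc_pred append_take_drop_id less_imp_diff_less less_le_trans zero_less_one)
  have i: "i = Suc (length xs)" using assms(2,3) by (simp add: xs_def)
  have ab: "a \<in> carrier ?G" "b \<in> carrier ?G" using assms(1) ts by auto
  show ?thesis
  proof (cases s)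
    case True
    have "a ** b = b ** (inv\<^bsub>?G\<^esub> b ** a ** b)"
      using monomial_group_inverse[OF ab(2)] by (metis matrix_mul_assoc matrix_mul_lid)
    then show ?thesis unfolding ts i using True by (simp add: hurwitz_letter_at hz_move)
  next
    case False
    have "(a ** b ** inv\<^bsub>?G\<^esub> a) ** a = a ** b"
      using monomial_group_inverse[OF ab(1)] by (metis matrix_mul_assoc matrix_mul_rid)
    then show ?thesis unfolding ts i using False by (simp add: hurwitz_letter_at hz_sym[OF hz_move])
  qed
qed

lemma same_hurwitz_orbit_imp_hz:
  assumes "same_hurwitz_orbit (monomial_group d e) ts us" "set ts \<subseteq> carrier (monomial_group d e)"
  shows "ts \<sim> us"
proof -
  obtain w where w: "w \<in> braid_words (length ts)" "hurwitz_action (monomial_group d e) w ts = us"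
    using assms(1) by (auto simp: same_hurwitz_orbit_def)
  have "ts \<sim> hurwitz_action (monomial_group d e) w ts" using w(1)
  proof (induction w)
    case (Cons x w)
    obtain i s where x: "x = (i, s)" by force
    let ?us = "hurwitz_action (monomial_group d e) w ts"
    have IH: "ts \<sim> ?us" using Cons by (simp add: braid_words_def)
    have "set ?us \<subseteq> carrier (monomial_group d e)" "length ?us = length ts"
      using hz_imp_same_hurwitz_orbit[OF IH assms(2)] hz_length[OF IH] by auto
    then have "?us \<sim> hurwitz_letter (monomial_group d e) (i, s) ?us"
      using Cons.prems by (intro hz_hurwitz_letter) (auto simp: braid_words_def x)
    then show ?case using hz_trans[OF IH] by (simp add: hurwitz_action_def x)
  qed (simp add: hurwitz_action_def)
  then show ?thesis using w(2) by simp
qed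

lemma conjugacy_class_eqD:
  fixes t s :: "complex ^ 'n ^ 'n"
  assumes "conjugacy_class (monomial_group d e) t = conjugacy_class (monomial_group d e) s" "s \<in> carrier (monomial_group d e)"
  obtains g where "g \<in> carrier (monomial_group d e)" "s ** g = g ** t"
proof -
  let ?G = "monomial_group d e :: (complex ^ 'n ^ 'n) monoid"
  interpret group ?G by (rule group_monomial_group)
  have "s = \<one>\<^bsub>?G\<^esub> \<otimes>\<^bsub>?G\<^esub> s \<otimes>\<^bsub>?G\<^esub> inv\<^bsub>?G\<^esub> \<one>\<^bsub>?G\<^esub>"
    using assms(2) by (simp del: mult_monomial_group)
  then have "s \<in> conjugacy_class ?G s" unfolding conjugacy_class_def by blast
  then obtain g where g: "g \<in> carrier ?G" "s = g ** t ** inv\<^bsub>?G\<^esub> g"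
    using assms(1) by (auto simp: conjugacy_class_def)
  have "s ** g = g ** t ** (inv\<^bsub>?G\<^esub> g ** g)" using g(2) by (simp add: matrix_mul_assoc)
  then show ?thesis using that g(1) monomial_group_inverse(2)[OF g(1)] by simp
qed

section \<open>The two families\<close>

lemma hz_dbl_past: "(\<And>t. t \<in> set ps \<Longrightarrow> t ** t = mat 1) \<Longrightarrow> xs @ dbl ps @ ys \<sim> dbl ps @ xs @ ys"
proof (induction ps)
  case (Cons t ps)
  have "xs @ dbl (t # ps) @ ys \<sim> t # t # xs @ dbl ps @ ys"
    using hz_pair_past[of t xs "dbl ps @ ys"] Cons.prems by simp
  also have "\<dots> \<sim> t # t # dbl ps @ xs @ ys"
    using hz_append_left[OF Cons.IH, of "[t, t]"] Cons.prems by simp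
  finally show ?case by simp
qed simp

text \<open>The pair-free parts are equivalent because their product is the same Coxeter element, so
  what remains is to exchange the pairs class by class.\<close>

lemma same_orbit_special:
  fixes c :: "complex ^ 'n ^ 'n"
  assumes n: "CARD('n) \<ge> 2" and d: "d \<ge> 2" and c: "coxeter_element (monomial_group 1 d) c"
    and ts: "set ts \<subseteq> edges d UNIV" "mat_prod ts = c" and us: "set us \<subseteq> edges d UNIV" "mat_prod us = c"
    and cl: "image_mset (conjugacy_class (monomial_group 1 d)) (mset ts) =
      image_mset (conjugacy_class (monomial_group 1 d)) (mset us)"
  shows "ts \<sim> us"
proof -
  let ?G = "monomial_group 1 d :: (complex ^ 'n ^ 'n) monoid"
  let ?cl = "conjugacy_class ?G"
  have d0: "d > 0" using d by simp
  obtain p a f where c: "c = M p a" "\<forall>i. a i \<noteq> 0" "near_cycle d f UNIV p a"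
    using coxeter_special[OF d n c] by blast
  obtain ps es where 1: "ts \<sim> dbl ps @ es" "pair_free d es" "set ps \<subseteq> edges d UNIV" "set es \<subseteq> edges d UNIV"
    using hz_split_pairs[OF ts(1)] by blast
  obtain qs vs where 2: "us \<sim> dbl qs @ vs" "pair_free d vs" "set qs \<subseteq> edges d UNIV" "set vs \<subseteq> edges d UNIV"
    using hz_split_pairs[OF us(1)] by blast
  have sq: "t ** t = mat 1" if "t \<in> edges d UNIV" for t :: "complex ^ 'n ^ 'n"
    using edge_square[OF that] .
  have lpd: "mat_prod (dbl ps) = mat 1" "mat_prod (dbl qs) = mat 1"
    using sq 1(3) 2(3) by (auto intro!: mat_prod_dbl)
  have lpe: "mat_prod es = M p a" "mat_prod vs = M p a"
    using hz_mat_prod[OF 1(1)] hz_mat_prod[OF 2(1)] lpd ts(2) us(2) c(1) by simp_all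
  have ev: "es \<sim> vs"
    using hz_pair_free_near_cycle[OF d0 _ _ 1(4,2) lpe(1) 2(4,2) lpe(2) c(2,3)] by simp
  have inG: "set xs \<subseteq> carrier ?G" if "set xs \<subseteq> edges d UNIV" for xs
    using that edges_special by blast
  have clm: "image_mset ?cl (mset ys) = image_mset ?cl (mset xs)" if "xs \<sim> ys" "set xs \<subseteq> edges d UNIV" for xs ys
    using hz_imp_same_hurwitz_orbit[OF that(1) inG[OF that(2)]] by blast
  \<comment> \<open>Every pair contributes its class twice, and the equivalent parts
    \<open>es\<close> and \<open>vs\<close> contribute the same classes. Cancelling these and
    halving compares \<open>ps\<close> with \<open>qs\<close>.\<close>
  have "image_mset ?cl (mset ps) + image_mset ?cl (mset ps) + image_mset ?cl (mset es) =
      image_mset ?cl (mset qs) + image_mset ?cl (mset qs) + image_mset ?cl (mset es)"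
    using clm[OF 1(1) ts(1)] clm[OF 2(1) us(1)] clm[OF ev 1(4)] cl by (simp add: mset_dbl)
  then have "image_mset ?cl (mset ps) + image_mset ?cl (mset ps) = image_mset ?cl (mset qs) + image_mset ?cl (mset qs)"
    by (rule add_right_imp_eq)
  then have clps: "image_mset ?cl (mset ps) = image_mset ?cl (mset qs)"
    by (simp add: multiset_eq_iff mult_2[symmetric])
  have connects: "connects d es" using connects_near_cycle[OF 1(4) lpe(1) c(2,3)] .
  have exch: "t # t # es \<sim> s # s # es"
    if ts: "t \<in> set ps" "s \<in> set qs" "?cl t = ?cl s" for t s
  proof -
    have te: "t \<in> edges d UNIV" "s \<in> edges d UNIV" using ts 1(3) 2(3) by auto
    show ?thesis
    proof (cases "CARD('n) \<ge> 3")
      case True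
      then show ?thesis using hz_pairs_near_cycle[OF d0 1(4,2) lpe(1) c(2,3) connects _ te] by blast
    next
      case False
      then have "CARD('n) = 2" using n by simp
      obtain b where b: "b \<noteq> f" "\<And>\<beta>. unity_root d \<beta> \<Longrightarrow> E f b \<beta> \<in> conjs d es"
        using near_cycle_conjs[OF d0 1(4,2) lpe(1) c(2,3)] by blast
      have U: "UNIV = {f, b}"
        using \<open>CARD('n) = 2\<close> b(1) by (intro card_seteq[symmetric]) auto
      have fb: "f \<noteq> b" using b(1) by simp
      have "t \<in> star d f b" "s \<in> star d f b" using te edges_pair[OF fb, of d] unfolding U by auto
      then obtain \<alpha> \<sigma> where t: "t = E f b \<alpha>" "unity_root d \<alpha>" and s: "s = E f b \<sigma>" "unity_root d \<sigma>"
        by (auto simp: star_def unity_root_def)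
      have sG: "s \<in> carrier ?G" using te edges_special by blast
      obtain g where g: "g \<in> carrier ?G" "s ** g = g ** t" using conjugacy_class_eqD[OF ts(3) sG] by blast
      have gM: "g \<in> Mon d" using g(1) carrier_special_Mon by blast
      then obtain q e where q: "g = M q e" "bij q" "\<And>i. e i \<noteq> 0" "\<And>i. e i ^ d = 1" by (rule MonE) blast
      have "(\<Prod>i\<in>UNIV. e i) = 1" using g(1) M_mem_carrier_special[OF q(2)] q(1,3) by blast
      then have ebf: "e f * e b = 1" unfolding U using fb by simp
      have eb: "unity_root d (e b)" using q by (simp add: unity_root_def)
      have "g ** t = g ** E (q f) (q b) (\<sigma> * e b / e f)"
        using E_conj[OF q(2,3) fb, of \<sigma>] g(2) s q(1) by (simp add: unity_root_def)
      moreover have "e f = inverse (e b)" using ebf q(3)[of b] by (simp add: field_simps)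
      \<comment> \<open>Because the weights of \<open>g\<close> multiply to 1, the factor
        \<open>e b / e f\<close> is a square. For even \<open>d\<close> this separates two classes
        of reflections in the dihedral case.\<close>
      ultimately have t': "t = E (q f) (q b) (\<sigma> * (e b)\<^sup>2)"
        using Mon_cancel_left[OF gM] by (simp add: power2_eq_square field_simps)
      have qfb: "q f \<noteq> q b" using q(2) fb by (metis bij_def injD)
      have mem: "i = f \<or> i = b" for i using UNIV_I[of i] unfolding U by blast
      \<comment> \<open>Conjugation by \<open>g\<close> is imitated by available reflections: a
        single one, of weight \<open>inverse (e b)\<close>, if \<open>g\<close> swaps the two
        points, and otherwise two, of weights 1 and \<open>e b\<close>.\<close>
      have st: "s # s # es \<sim> t # t # es"
      proof (cases "q f = f")
        case True
        then have "q b = b" using mem[of "q b"] qfb by auto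
        have "s # s # es \<sim> E f b (1 / \<sigma>) # E f b (1 / \<sigma>) # es"
          using hz_pair_reflect[OF b(2)[of 1] fb s(2)] s(1) by (simp add: unity_root_simps)
        also have "\<dots> \<sim> t # t # es"
          using hz_pair_reflect[OF b(2)[OF eb] fb _ eb, of "1 / \<sigma>"] t' True \<open>q b = b\<close> s(2)
          by (simp add: unity_root_simps mult.commute)
        finally show ?thesis .
      next
        case False
        then have "q f = b" "q b = f" using mem[of "q f"] mem[of "q b"] qfb by auto
        then have "t = E f b (inverse (\<sigma> * (e b)\<^sup>2))" using t' E_sym[of b f] b(1) by simp
        moreover have "inverse (\<sigma> * (e b)\<^sup>2) = (inverse (e b))\<^sup>2 / \<sigma>"
          by (simp add: power_inverse divide_inverse)
        ultimately show ?thesis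
          using hz_pair_reflect[OF b(2)[OF unity_root_simps(3)[OF eb]] fb s(2) unity_root_simps(3)[OF eb]] s(1) by simp
      qed
      then show ?thesis by (rule hz_sym)
    qed
  qed
  have "dbl ps @ es \<sim> dbl qs @ es"
    using sq 1(3) 2(3) by (intro hz_dbl_exchange[OF _ exch clps]) auto
  then have "ts \<sim> dbl qs @ es" by (rule hz_trans[OF 1(1)])
  also have "\<dots> \<sim> dbl qs @ vs" by (rule hz_append_left[OF ev])
  also have "\<dots> \<sim> us" by (rule hz_sym[OF 2(1)])
  finally show ?thesis .
qed

text \<open>Removable pairs, loops at the chosen coordinate \<open>x\<close>, and pair-free edges.
  Pairs are split off only after the loops have been collected, because relocating a loop changes
  the weights of edges and could break up a pair.\<close>

lemma full_normal_form:
  fixes ts :: "(complex ^ 'n ^ 'n) list"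
  assumes ts: "set ts \<subseteq> edges d UNIV \<union> diag_reflections d" "mat_prod ts = M p a"
    and a: "\<forall>i. a i \<noteq> 0" and cyc: "cyc p UNIV"
  obtains ps ws es b where "ts \<sim> dbl ps @ map (D x) ws @ es" "set ps \<subseteq> edges d UNIV"
    "\<And>w. w \<in> set ws \<Longrightarrow> unity_root d w \<and> w \<noteq> 1" "set es \<subseteq> edges d UNIV" "pair_free d es" "connects d es"
    "mat_prod es = M p b" "\<forall>i. b i \<noteq> 0" "prod_list ws = (\<Prod>i\<in>UNIV. a i)" "D x (prod_list ws) ** mat_prod es = M p a"
proof -
  obtain iws es0 where 1: "ts \<sim> map (\<lambda>(i, w). D i w) iws @ es0" "set es0 \<subseteq> edges d UNIV"
    "\<forall>(i, w) \<in> set iws. unity_root d w \<and> w \<noteq> 1"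
    using hz_loops_first[of ts d] ts(1) unfolding diag_reflections_def by blast
  have diag: "\<exists>b. mat_prod (map (\<lambda>(i, w). D i w) iws) = M id b"
  proof (induction iws)
    case (Cons iw iws)
    then show ?case by (auto simp: D_def M_mult split: prod.split)
  qed (simp add: mat_1_eq_M id_def, blast)
  obtain q b where q: "mat_prod es0 = M q b" "bij q" "\<forall>i. b i \<noteq> 0 \<and> b i ^ d = 1" "\<forall>i. i \<notin> UNIV \<longrightarrow> q i = i \<and> b i = 1"
    by (rule mat_prod_edges[OF 1(2)])
  obtain b' where b': "mat_prod (map (\<lambda>(i, w). D i w) iws) = M id b'" using diag by blast
  have "M p a = M (q \<circ> id) (\<lambda>i. b' i * b (id i))"
    using hz_mat_prod[OF 1(1)] ts(2) q(1) b' by (simp add: M_mult)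
  then have "p = q" using M_perm_eq[OF _ a] by fastforce
  \<comment> \<open>Loops do not change the permutation, so the edges alone already multiply to the
    long cycle and connect all points.\<close>
  then have conn0: "connects d es0" using connects_long_cycle[OF 1(2) q(1)] q(3) cyc by blast
  define ws where "ws = map snd iws"
  have ws: "unity_root d w \<and> w \<noteq> 1" if "w \<in> set ws" for w using that 1(3) by (auto simp: ws_def)
  obtain es1 where 2: "map (\<lambda>(i, w). D i w) iws @ es0 \<sim> map (D x) ws @ es1" "same_shapes d es0 es1"
    using hz_collect_loops[OF conn0 1(2)] 1(3) unfolding ws_def by blast
  have es1: "set es1 \<subseteq> edges d UNIV" by (rule same_shapes_edges[OF 2(2) 1(2)])
  obtain ps es where 3: "es1 \<sim> dbl ps @ es" "pair_free d es" "set ps \<subseteq> edges d UNIV" "set es \<subseteq> edges d UNIV"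
    using hz_split_pairs[OF es1] by blast
  have sq: "t ** t = mat 1" if "t \<in> set ps" for t using that 3(3) edge_square by blast
  have "ts \<sim> map (D x) ws @ es1" by (rule hz_trans[OF 1(1) 2(1)])
  also have "\<dots> \<sim> map (D x) ws @ dbl ps @ es" by (rule hz_append_left[OF 3(1)])
  also have "\<dots> \<sim> dbl ps @ map (D x) ws @ es" by (rule hz_dbl_past[OF sq])
  finally have hz: "ts \<sim> dbl ps @ map (D x) ws @ es" .
  have prod: "D x (prod_list ws) ** mat_prod es = M p a"
    using hz_mat_prod[OF hz] ts(2) mat_prod_dbl[OF sq] by (simp add: mat_prod_D)
  obtain r e where r: "mat_prod es = M r e" "bij r" "\<forall>i. e i \<noteq> 0 \<and> e i ^ d = 1" "\<forall>i. i \<notin> UNIV \<longrightarrow> r i = i \<and> e i = 1"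
    by (rule mat_prod_edges[OF 3(4)])
  have *: "M p a = M (r \<circ> id) (\<lambda>i. (if i = x then prod_list ws else 1) * e (id i))"
    using prod r(1) by (simp add: D_def M_mult)
  have pr: "p = r" using M_perm_eq[OF * a] by simp
  have ae: "a i = (if i = x then prod_list ws else 1) * e i" for i using M_weight_eq[OF * a] by simp
  \<comment> \<open>Edges lie in G(d,d,n), where the weights multiply to 1. The product of the
    weights of \<open>c\<close> is therefore due to the loops alone.\<close>
  have "mat_prod es \<in> carrier (monomial_group 1 d)"
  proof -
    interpret group "monomial_group 1 d :: (complex ^ 'n ^ 'n) monoid" by (rule group_monomial_group)
    have "mat_prod xs \<in> carrier (monomial_group 1 d)" if "set xs \<subseteq> edges d UNIV" for xs :: "(complex ^ 'n ^ 'n) list"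
      using that
    proof (induction xs)
      case Nil
      show ?case using one_closed by (simp add: monomial_group_def)
    next
      case (Cons y ys)
      then have "y \<in> carrier (monomial_group 1 d)" "mat_prod ys \<in> carrier (monomial_group 1 d)"
        using edges_special by auto
      then show ?case using m_closed by (metis mat_prod_Cons mult_monomial_group)
    qed
    then show ?thesis using 3(4) .
  qed
  then have "(\<Prod>i\<in>UNIV. e i) = 1" using M_mem_carrier_special[OF r(2)] r(1,3) by metis
  then have "(\<Prod>i\<in>UNIV. a i) = prod_list ws" unfolding ae by (simp add: prod.distrib)
  moreover have "connects d es" using connects_long_cycle[OF 3(4) r(1)] r(3) cyc pr by blast
  ultimately show ?thesis using that[OF hz 3(3) ws 3(4,2)] r pr prod by metis
qed

text \<open>The classes determine the loop weights up to order. With equal loops at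
  \<open>x\<close>, the edges of both normal forms have the same product, and equal lengths give
  equally many pairs.\<close>

lemma same_orbit_full:
  fixes c :: "complex ^ 'n ^ 'n"
  assumes n: "CARD('n) \<ge> 2" and d: "d \<ge> 2" and c: "coxeter_element (monomial_group d 1) c"
    and ts: "set ts \<subseteq> edges d UNIV \<union> diag_reflections d" "mat_prod ts = c"
    and us: "set us \<subseteq> edges d UNIV \<union> diag_reflections d" "mat_prod us = c"
    and cl: "image_mset (conjugacy_class (monomial_group d 1)) (mset ts) =
      image_mset (conjugacy_class (monomial_group d 1)) (mset us)"
  shows "ts \<sim> us"
proof -
  let ?G = "monomial_group d 1 :: (complex ^ 'n ^ 'n) monoid"
  let ?cl = "conjugacy_class ?G"
  have d0: "d > 0" using d by simp
  obtain p a where c: "c = M p a" "\<forall>i. a i \<noteq> 0" "cyc p UNIV" "root_generator d (\<Prod>i\<in>UNIV. a i)"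
    using coxeter_full[OF d n c] by blast
  obtain x y :: 'n where xy: "x \<noteq> y" using ex_card[OF n] by (metis (full_types) card_2_iff')
  obtain ps ws es b where 1: "ts \<sim> dbl ps @ map (D x) ws @ es" "set ps \<subseteq> edges d UNIV"
    "\<And>w. w \<in> set ws \<Longrightarrow> unity_root d w \<and> w \<noteq> 1" "set es \<subseteq> edges d UNIV" "pair_free d es" "connects d es"
    "mat_prod es = M p b" "\<forall>i. b i \<noteq> 0" "prod_list ws = (\<Prod>i\<in>UNIV. a i)" "D x (prod_list ws) ** mat_prod es = M p a"
    by (rule full_normal_form[OF ts(1) _ c(2,3), of x]) (use ts(2) c(1) in auto)
  obtain qs ws' vs b' where 2: "us \<sim> dbl qs @ map (D x) ws' @ vs" "set qs \<subseteq> edges d UNIV"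
    "\<And>w. w \<in> set ws' \<Longrightarrow> unity_root d w \<and> w \<noteq> 1" "set vs \<subseteq> edges d UNIV" "pair_free d vs" "connects d vs"
    "mat_prod vs = M p b'" "\<forall>i. b' i \<noteq> 0" "prod_list ws' = (\<Prod>i\<in>UNIV. a i)" "D x (prod_list ws') ** mat_prod vs = M p a"
    by (rule full_normal_form[OF us(1) _ c(2,3), of x]) (use us(2) c(1) in auto)
  have inG: "set xs \<subseteq> carrier ?G" if "set xs \<subseteq> edges d UNIV \<union> diag_reflections d" for xs
    using that edges_Mon D_Mon unfolding carrier_full diag_reflections_def by blast
  have clm: "image_mset ?cl (mset ys) = image_mset ?cl (mset xs)"
    if "xs \<sim> ys" "set xs \<subseteq> edges d UNIV \<union> diag_reflections d" for xs ys
    using hz_imp_same_hurwitz_orbit[OF that(1) inG[OF that(2)]] by blast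
  have conjD: "t = D (q i) w" if "D i w ** g = g ** t" "g = M q e" "g \<in> Mon d" "bij q" "\<And>k. e k \<noteq> 0"
    for t q w e and i :: 'n and g :: "complex ^ 'n ^ 'n"
    by (rule Mon_cancel_left[OF that(3)]) (use D_conj[OF that(4,5), of i w] that(1,2) in simp)
  have clD: "\<exists>j. t = D j w" if "?cl t = ?cl (D x w)" "unity_root d w" for t w
  proof -
    have "D x w \<in> carrier ?G" unfolding carrier_full by (rule D_Mon[OF that(2)])
    with that(1) obtain g where "g \<in> carrier ?G" and g2: "D x w ** g = g ** t"
      by (rule conjugacy_class_eqD)
    then have g: "g \<in> Mon d" unfolding carrier_full by simp
    obtain q e where q: "g = M q e" "bij q" "\<And>i. e i \<noteq> 0" using g by (rule MonE) blast
    have "t = D (q x) w" by (rule conjD[OF g2 q(1) g q(2,3)])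
    then show ?thesis by blast
  qed
  define R where "R = {w. unity_root d w \<and> w \<noteq> 1}"
  \<comment> \<open>No diagonal reflection is conjugate to an edge, so discarding the classes in
    \<open>K\<close> leaves those of the loops; these in turn determine the weights, since
    conjugation moves a loop but keeps its weight.\<close>
  define K where "K = ?cl ` edges d UNIV"
  have KD: "?cl (D x w) \<notin> K" if "w \<in> R" for w
    using clD[of _ w] that D_not_edge[of d w] by (auto simp: K_def R_def)
  have inj: "inj_on (\<lambda>w. ?cl (D x w)) R"
  proof (rule inj_onI)
    fix w u assume wu: "w \<in> R" "u \<in> R" "?cl (D x w) = ?cl (D x u)"
    then obtain j where "D x w = D j u" using clD[OF wu(3)] by (auto simp: R_def)
    then show "w = u" using D_inject[of x w j u] wu by (auto simp: R_def unity_root_def)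
  qed
  have filt: "filter_mset (\<lambda>k. k \<notin> K) (image_mset ?cl (mset (dbl ps @ map (D x) ws @ es)))
      = image_mset (\<lambda>w. ?cl (D x w)) (mset ws)"
    if "set ps \<subseteq> edges d UNIV" "set es \<subseteq> edges d UNIV" "set ws \<subseteq> R" for ps es ws
  proof -
    have none: "filter_mset (\<lambda>k. k \<notin> K) (image_mset ?cl (mset xs)) = {#}" if "set xs \<subseteq> edges d UNIV" for xs
      using that by (auto simp: filter_mset_eq_conv K_def)
    have "filter_mset (\<lambda>k. k \<notin> K) (image_mset (\<lambda>w. ?cl (D x w)) (mset ws)) = image_mset (\<lambda>w. ?cl (D x w)) (mset ws)"
      using that(3) KD by (auto simp: filter_mset_eq_conv)
    then show ?thesis using none[of "dbl ps"] none[of es] that by (simp add: multiset.map_comp comp_def)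
  qed
  have wsR: "set ws \<subseteq> R" "set ws' \<subseteq> R" using 1(3) 2(3) by (auto simp: R_def)
  have "image_mset (\<lambda>w. ?cl (D x w)) (mset ws) = image_mset (\<lambda>w. ?cl (D x w)) (mset ws') + {#}"
    unfolding filt[OF 1(2,4) wsR(1), symmetric] filt[OF 2(2,4) wsR(2), symmetric]
      clm[OF 1(1) ts(1)] clm[OF 2(1) us(1)] cl add_0_right ..
  moreover have "inj_on (\<lambda>w. ?cl (D x w)) (set_mset (mset ws) \<union> set_mset (mset ws'))"
    using wsR by (intro inj_on_subset[OF inj]) auto
  ultimately have "\<exists>C. mset ws = mset ws' + C \<and> {#} = image_mset (\<lambda>w. ?cl (D x w)) C"
    by (rule image_mset_eq_image_mset_plusD)
  then have mws: "mset ws = mset ws'" by auto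
  have wsw: "map (D x) ws' \<sim> map (D x) ws"
  proof (rule hz_permute_commuting)
    show "mset (map (D x) ws') = mset (map (D x) ws)" unfolding mset_map mws ..
    show "e ** e' = e' ** e" if ee: "e \<in> set (map (D x) ws')" "e' \<in> set (map (D x) ws')" for e e'
    proof -
      obtain u v where "e = D x u" "e' = D x v" using ee by auto
      then show ?thesis using D_commute[of x u x v] by simp
    qed
  qed
  have pM: "D x (prod_list ws) \<in> Mon d"
  proof (rule D_Mon)
    have "prod_list ws ^ d = 1" using c(4) unfolding 1(9) root_generator_def by blast
    moreover from this have "prod_list ws \<noteq> 0" using d0 by (metis zero_neq_one zero_power)
    ultimately show "unity_root d (prod_list ws)" by (simp add: unity_root_def)
  qed
  have "D x (prod_list ws) ** mat_prod es = D x (prod_list ws) ** mat_prod vs"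
    using 1(10) 2(10) unfolding 1(9) 2(9) by simp
  then have "mat_prod es = mat_prod vs" by (rule Mon_cancel_left[OF pM])
  then have lpv: "mat_prod vs = M p b" using 1(7) by simp
  have ev: "es \<sim> vs"
    using hz_pair_free_long_cycle[OF d0 _ _ 1(4,5,7) 2(4,5) lpv 1(8) c(3)] by simp
  let ?rest = "map (D x) ws @ es"
  have "length ps = length qs"
  proof -
    have "length (dbl xs) = 2 * length xs" for xs :: "(complex ^ 'n ^ 'n) list" by (induction xs) auto
    moreover have "length ts = length us" using cl by (metis size_image_mset size_mset)
    moreover have "length ws = length ws'" using mws by (metis size_mset)
    moreover note hz_length[OF 1(1)] hz_length[OF 2(1)] hz_length[OF ev]
    ultimately show ?thesis by simp
  qed
  \<comment> \<open>Any two pairs can be exchanged in front of \<open>?rest\<close>, so a constant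
    serves as the invariant and only the number of pairs has to agree.\<close>
  then have len: "image_mset (\<lambda>_. ()) (mset ps) = image_mset (\<lambda>_. ()) (mset qs)"
    by (simp add: image_mset_const_eq)
  have connects: "connects d ?rest" using connects_mono[OF 1(6)] by auto
  have exch: "t # t # ?rest \<sim> s # s # ?rest" if "t \<in> set ps" "s \<in> set qs" for t s
    using hz_pairs_with_loops[OF connects _ _ xy, of t s] 1(2,3,9) 2(2) c(4) that by auto
  have sq: "t ** t = mat 1" if "t \<in> set ps \<union> set qs" for t
    using that 1(2) 2(2) edge_square by blast
  have "dbl ps @ ?rest \<sim> dbl qs @ ?rest" by (rule hz_dbl_exchange[OF sq exch len])
  then have "ts \<sim> dbl qs @ ?rest" by (rule hz_trans[OF 1(1)])
  also have "\<dots> \<sim> dbl qs @ map (D x) ws @ vs" using hz_append_left[OF ev, of "dbl qs @ map (D x) ws"] by simp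
  also have "\<dots> \<sim> dbl qs @ map (D x) ws' @ vs" using hz_context[OF hz_sym[OF wsw], of "dbl qs" vs] .
  also have "\<dots> \<sim> us" by (rule hz_sym[OF 2(1)])
  finally show ?thesis .
qed

theorem mainTheorem1:
  fixes d :: nat
    and G :: "(complex ^ 'n ^ 'n) monoid"
    and c :: "complex ^ 'n ^ 'n"
    and ts ts' :: "(complex ^ 'n ^ 'n) list"
  assumes "CARD('n) \<ge> 2"
    and "d \<ge> 2"
    and "G = monomial_group d 1 \<or> G = monomial_group 1 d"
    and "coxeter_element G c"
    and "reflection_factorization G c ts"
    and "reflection_factorization G c ts'"
  shows "same_hurwitz_orbit G ts ts' \<longleftrightarrow>
    image_mset (conjugacy_class G) (mset ts) = image_mset (conjugacy_class G) (mset ts')"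
proof -
  obtain k e where G: "G = monomial_group k e" using assms(3) by blast
  have refl: "set ts \<subseteq> reflections G" "set ts' \<subseteq> reflections G" "mat_prod ts = c" "mat_prod ts' = c"
    using assms(5,6) by (simp_all add: reflection_factorization_def G list_product_eq_mat_prod)
  then have tsG: "set ts \<subseteq> carrier G" by (auto simp: reflections_def)
  have "ts \<sim> ts'" if cl: "image_mset (conjugacy_class G) (mset ts) = image_mset (conjugacy_class G) (mset ts')"
    using assms(3)
  proof
    assume G': "G = monomial_group d 1"
    show ?thesis
      using same_orbit_full[OF assms(1,2), of c ts ts'] assms(4) refl cl
      unfolding G' reflections_full[OF assms(1)] by blast
  next
    assume G': "G = monomial_group 1 d"
    show ?thesis
      using same_orbit_special[OF assms(1,2), of c ts ts'] assms(4) refl cl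
      unfolding G' reflections_special[OF assms(1)] by blast
  qed
  then show ?thesis
    using hz_imp_same_hurwitz_orbit tsG same_hurwitz_orbit_imp_hz unfolding G by metis
qed

end
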